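(* Let $k$ be an infinite field, $r\ge3$, $R=k[y_1,\ldots,y_r]$, and let $I\subset R$ be a homogeneous ideal such that the graded ring $A:=R/I$ is of dimension zero. Let $B_R(I)=(a;n^2_1,\ldots,n^2_a;\cdots;n^r_1,\ldots,n^r_{m_r})$ be the basic sequence of $I$. Then $A$ has the weak Lefschetz property if and only if $n^r_1\ge n^{r-1}_{m_{r-1}}$.
   Context: A graded ring $A$ has the weak Lefschetz property if there is $\ell\in[A]_1$ such that $\times\ell:[A]_i\to[A]_{i+1}$ has maximal rank for every $i\in\mathbb{Z}$. Basic sequence. Let $x_1,\ldots,x_r$ be a basis of the linear forms of $R$. For a finitely generated graded $R$-module $E$, a pseudo Weierstrass basis of $E$ with respect to $x_1,\ldots,x_r$ is a set $P=\{e^i_l\mid 1\le i\le r+1,\ 1\le l\le m_i\}$ of homogeneous generators of $E$ such that, writing $E^{\langle i\rangle}:=\sum_{l=1}^{m_i}k[x_i,\ldots,x_r]e^i_l$ (with $k[x_i,\ldots,x_r]=k$ for $i=r+1$) and $E^{[j]}:=\sum_{i=j}^{r+1}E^{\langle i\rangle}$: (i) each $k[x_i,\ldots,x_r]e^i_l$ is free over $k[x_i,\ldots,x_r]$; (ii) the sums defining $E^{\langle i\rangle}$ are direct; (iii) the sums defining $E^{[j]}$ are direct over $k$; (iv) $E=E^{[1]}$; (v) for all $1\le i'<j\le r+1$ and $1\le l\le m_j$, $x_{i'}e^j_l\in(x_j,\ldots,x_r)\bigl(\sum_{i=1}^{j-1}E^{\langle i\rangle}\bigr)+E^{[j]}$,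 where $(x_j,\ldots,x_r)E'$ means $x_jE'+\cdots+x_rE'$ for $j\le r$ and $\{0\}$ for $j=r+1$. For sufficiently general $x_1,\ldots,x_r$ (in a nonempty Zariski open set of bases) such a basis exists, and the $m_i$ and the degrees of the $e^i_l$ (up to permutation for each $i$) do not depend on the choices. For a proper homogeneous ideal $I\subset R$ with $\dim R/I=0$ one has $m_1=1$, $m_{r+1}=0$, and the basic sequence of $I$ is $(a;n^2_1,\ldots,n^2_a;\cdots;n^r_1,\ldots,n^r_{m_r})$ where $a=\deg e^1_1$, $m_2=a$, and $n^i_1\le\cdots\le n^i_{m_i}$ are the degrees of $e^i_1,\ldots,e^i_{m_i}$ in nondecreasing order. *)

theory Defs
  imports Complex_Main "HOL-Library.Poly_Mapping" "HOL-Algebra.QuotRing"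
begin

section \<open>Polynomial rings\<close>

text \<open>A polynomial is a finitely supported map from monomials (themselves finitely supported
  exponent maps on the variables) to coefficients.\<close>

type_synonym ('v, 'k) mpoly = "('v \<Rightarrow>\<^sub>0 nat) \<Rightarrow>\<^sub>0 'k"

definition polys_in :: "'v set \<Rightarrow> ('v, 'k::zero) mpoly set" where
  "polys_in V = {p. \<forall>t\<in>Poly_Mapping.keys p. Poly_Mapping.keys t \<subseteq> V}"

definition total_deg :: "('v \<Rightarrow>\<^sub>0 nat) \<Rightarrow> nat" where
  "total_deg t = (\<Sum>v\<in>Poly_Mapping.keys t. Poly_Mapping.lookup t v)"

definition homog_part :: "'v set \<Rightarrow> int \<Rightarrow> ('v, 'k::zero) mpoly set" where
  "homog_part V d = {p \<in> polys_in V. \<forall>t\<in>Poly_Mapping.keys p. int (total_deg t) = d}"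

definition poly_eval ::
    "('k::zero \<Rightarrow> 's::comm_ring_1) \<Rightarrow> ('v \<Rightarrow> 's) \<Rightarrow> ('v, 'k) mpoly \<Rightarrow> 's" where
  "poly_eval \<phi> x p = (\<Sum>t\<in>Poly_Mapping.keys p.
     \<phi> (Poly_Mapping.lookup p t) * (\<Prod>v\<in>Poly_Mapping.keys t. x v ^ Poly_Mapping.lookup t v))"

abbreviation const :: "'k::zero \<Rightarrow> ('v, 'k) mpoly" where
  "const c \<equiv> Poly_Mapping.single 0 c"

definition poly_ring :: "nat \<Rightarrow> (nat, 'k::field) mpoly ring" where
  "poly_ring r = \<lparr>carrier = polys_in {1..r}, mult = (*), one = 1, zero = 0, add = (+)\<rparr>"

lemma polys_in_add: "p \<in> polys_in V \<Longrightarrow> q \<in> polys_in V \<Longrightarrow> p + q \<in> polys_in V"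
  using keys_add [of p q] by (auto simp: polys_in_def)

lemma polys_in_mult:
  fixes p q :: "('v, 'k::comm_ring_1) mpoly"
  assumes "p \<in> polys_in V" "q \<in> polys_in V"
  shows "p * q \<in> polys_in V"
  unfolding polys_in_def
proof (intro CollectI ballI)
  fix t assume "t \<in> Poly_Mapping.keys (p * q)"
  then have "t \<in> {a + b | a b. a \<in> Poly_Mapping.keys p \<and> b \<in> Poly_Mapping.keys q}"
    by (rule subsetD [OF keys_mult])
  then obtain u v where uv: "u \<in> Poly_Mapping.keys p" "v \<in> Poly_Mapping.keys q" "t = u + v"
    by auto
  then have "Poly_Mapping.keys u \<subseteq> V" "Poly_Mapping.keys v \<subseteq> V"
    using assms by (auto simp: polys_in_def)
  then show "Poly_Mapping.keys t \<subseteq> V"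
    using keys_add [of u v] uv(3) by auto
qed

lemma polys_in_uminus:
  fixes p :: "('v, 'k::ab_group_add) mpoly"
  assumes "p \<in> polys_in V"
  shows "- p \<in> polys_in V"
  using assms by (simp add: polys_in_def in_keys_iff)

lemma polys_in_0: "0 \<in> polys_in V"
  and polys_in_1: "(1 :: ('v, 'k::comm_ring_1) mpoly) \<in> polys_in V"
  by (simp_all add: polys_in_def)

lemma cring_poly_ring: "cring (poly_ring r :: (nat, 'k::field) mpoly ring)"
proof (rule cringI)
  show "abelian_group (poly_ring r :: (nat, 'k) mpoly ring)"
  proof (rule abelian_groupI)
    fix p :: "(nat, 'k) mpoly"
    assume "p \<in> carrier (poly_ring r)"
    then show "\<exists>q\<in>carrier (poly_ring r). q \<oplus>\<^bsub>poly_ring r\<^esub> p = \<zero>\<^bsub>poly_ring r\<^esub>"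
      using polys_in_uminus by (auto simp: poly_ring_def intro!: bexI[of _ "- p"])
  qed (auto simp: poly_ring_def polys_in_add polys_in_0 add.assoc add.commute)
  show "Group.comm_monoid (poly_ring r :: (nat, 'k) mpoly ring)"
    by (rule comm_monoidI) (auto simp: poly_ring_def polys_in_mult polys_in_1 mult.assoc mult.commute)
qed (auto simp: poly_ring_def distrib_right)

definition homogeneous_ideal :: "nat \<Rightarrow> (nat, 'k::field) mpoly set \<Rightarrow> bool" where
  "homogeneous_ideal r I \<longleftrightarrow> ideal I (poly_ring r) \<and>
     (\<exists>H. H \<subseteq> (\<Union>d. homog_part {1..r} d) \<and> I = Idl\<^bsub>poly_ring r\<^esub> H)"

definition quot_part :: "nat \<Rightarrow> (nat, 'k::field) mpoly set \<Rightarrow> int \<Rightarrow> (nat, 'k) mpoly set set" where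
  "quot_part r I d = (\<lambda>p. I +>\<^bsub>poly_ring r\<^esub> p) ` homog_part {1..r} d"


section \<open>Krull dimension and the weak Lefschetz property\<close>

definition prime_chain :: "('a, 'b) ring_scheme \<Rightarrow> nat \<Rightarrow> (nat \<Rightarrow> 'a set) \<Rightarrow> bool" where
  "prime_chain A n P \<longleftrightarrow> (\<forall>i\<le>n. primeideal (P i) A) \<and> (\<forall>i<n. P i \<subset> P (Suc i))"

text \<open>The zero ring has no prime ideals, hence no dimension in this sense.\<close>

definition has_krull_dim :: "('a, 'b) ring_scheme \<Rightarrow> nat \<Rightarrow> bool" where
  "has_krull_dim A n \<longleftrightarrow> (\<exists>P. prime_chain A n P) \<and> \<not> (\<exists>P. prime_chain A (Suc n) P)"

definition maximal_rank :: "('a \<Rightarrow> 'b) \<Rightarrow> 'a set \<Rightarrow> 'b set \<Rightarrow> bool" where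
  "maximal_rank f V W \<longleftrightarrow> inj_on f V \<or> f ` V = W"

definition weak_lefschetz :: "('a, 'b) ring_scheme \<Rightarrow> (int \<Rightarrow> 'a set) \<Rightarrow> bool" where
  "weak_lefschetz A G \<longleftrightarrow>
     (\<exists>l\<in>G 1. \<forall>i::int. maximal_rank (\<lambda>a. l \<otimes>\<^bsub>A\<^esub> a) (G i) (G (i + 1)))"


section \<open>Bases of the linear forms\<close>

definition scale :: "'k::field \<Rightarrow> ('v, 'k) mpoly \<Rightarrow> ('v, 'k) mpoly" where
  "scale c p = const c * p"

interpretation coeffs: vector_space "scale :: 'k::field \<Rightarrow> ('v, 'k) mpoly \<Rightarrow> _"
proof
  fix a b :: 'k and p q :: "('v, 'k) mpoly"
  show "scale a (p + q) = scale a p + scale a q"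
    by (simp add: scale_def distrib_left)
  show "scale (a + b) p = scale a p + scale b p"
    by (simp add: scale_def single_add distrib_right)
  show "scale a (scale b p) = scale (a * b) p"
    unfolding scale_def mult.assoc [symmetric] mult_single by simp
  show "scale 1 p = p"
    by (simp add: scale_def)
qed

definition linear_basis :: "nat \<Rightarrow> (nat \<Rightarrow> (nat, 'k::field) mpoly) \<Rightarrow> bool" where
  "linear_basis r x \<longleftrightarrow> inj_on x {1..r} \<and> coeffs.independent (x ` {1..r}) \<and>
     coeffs.span (x ` {1..r}) = homog_part {1..r} 1"

text \<open>A basis is a point of affine space of dimension \<open>r\<^sup>2\<close>, with coordinate \<open>(i, j)\<close> the
  coefficient of the \<open>j\<close>-th variable in \<open>x i\<close>. The values of \<open>x\<close> outside \<open>{1..r}\<close> are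
  irrelevant.\<close>

definition basis_coord :: "(nat \<Rightarrow> (nat, 'k::zero) mpoly) \<Rightarrow> nat \<times> nat \<Rightarrow> 'k" where
  "basis_coord x = (\<lambda>(i, j). Poly_Mapping.lookup (x i) (Poly_Mapping.single j 1))"

definition zariski_open_bases :: "nat \<Rightarrow> (nat \<Rightarrow> (nat, 'k::field) mpoly) set \<Rightarrow> bool" where
  "zariski_open_bases r U \<longleftrightarrow>
     (\<exists>F \<subseteq> polys_in ({1..r} \<times> {1..r}).
        U = {x. linear_basis r x \<and> (\<exists>f\<in>F. poly_eval id (basis_coord x) f \<noteq> 0)})"


section \<open>Pseudo Weierstrass bases\<close>

text \<open>The algebra \<open>k[x\<^sub>i, \<dots>, x\<^sub>r]\<close>, which is \<open>k\<close> for \<open>i = r + 1\<close>.\<close>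

definition tail_alg ::
    "nat \<Rightarrow> (nat \<Rightarrow> (nat, 'k::field) mpoly) \<Rightarrow> nat \<Rightarrow> (nat, 'k) mpoly set" where
  "tail_alg r x i = poly_eval const x ` polys_in {i..r}"

text \<open>In the following, an \<open>R\<close>-module is a subset \<open>E\<close> of an abelian group with a
  scalar multiplication \<open>s\<close>, and a family \<open>e i l\<close> with \<open>1 \<le> l \<le> m i\<close> is given.\<close>

definition block :: "('a \<Rightarrow> 'e::ab_group_add \<Rightarrow> 'e) \<Rightarrow> (nat \<Rightarrow> 'a set) \<Rightarrow> (nat \<Rightarrow> nat) \<Rightarrow>
    (nat \<Rightarrow> nat \<Rightarrow> 'e) \<Rightarrow> nat \<Rightarrow> 'e set" where
  "block s S m e i = {(\<Sum>l = 1..m i. s (c l) (e i l)) | c. \<forall>l\<in>{1..m i}. c l \<in> S i}"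

definition blocks :: "('a \<Rightarrow> 'e::ab_group_add \<Rightarrow> 'e) \<Rightarrow> (nat \<Rightarrow> 'a set) \<Rightarrow> (nat \<Rightarrow> nat) \<Rightarrow>
    (nat \<Rightarrow> nat \<Rightarrow> 'e) \<Rightarrow> nat set \<Rightarrow> 'e set" where
  "blocks s S m e J = {(\<Sum>i\<in>J. u i) | u. \<forall>i\<in>J. u i \<in> block s S m e i}"

definition direct_sum :: "('i \<Rightarrow> 'e::ab_group_add set) \<Rightarrow> 'i set \<Rightarrow> bool" where
  "direct_sum M J \<longleftrightarrow>
     (\<forall>u. (\<forall>i\<in>J. u i \<in> M i) \<longrightarrow> (\<Sum>i\<in>J. u i) = 0 \<longrightarrow> (\<forall>i\<in>J. u i = 0))"

text \<open>The grading of the module \<open>E\<close> is \<open>G\<close>. Freeness of a cyclic submodule is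
  understood as freeness on its generator, so that all \<open>e i l\<close> are nonzero.\<close>

definition pseudo_weierstrass_basis ::
    "nat \<Rightarrow> (nat \<Rightarrow> (nat, 'k::field) mpoly) \<Rightarrow> ((nat, 'k) mpoly \<Rightarrow> 'e::ab_group_add \<Rightarrow> 'e) \<Rightarrow>
     'e set \<Rightarrow> (int \<Rightarrow> 'e set) \<Rightarrow> (nat \<Rightarrow> nat) \<Rightarrow> (nat \<Rightarrow> nat \<Rightarrow> 'e) \<Rightarrow> bool" where
  "pseudo_weierstrass_basis r x s E G m e \<longleftrightarrow>
     (let S = tail_alg r x;
          E_blocks = blocks s S m e
      in (\<forall>i\<in>{1..r+1}. \<forall>l\<in>{1..m i}. e i l \<in> E \<and> (\<exists>d. e i l \<in> G d)) \<and>
         E = {(\<Sum>i = 1..r+1. \<Sum>l = 1..m i. s (f i l) (e i l)) | f.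
                \<forall>i\<in>{1..r+1}. \<forall>l\<in>{1..m i}. f i l \<in> polys_in {1..r}} \<and>
         (\<forall>i\<in>{1..r+1}. \<forall>l\<in>{1..m i}. \<forall>c\<in>S i. s c (e i l) = 0 \<longrightarrow> c = 0) \<and>
         (\<forall>i\<in>{1..r+1}. direct_sum (\<lambda>l. {s c (e i l) | c. c \<in> S i}) {1..m i}) \<and>
         (\<forall>j\<in>{1..r+1}. direct_sum (block s S m e) {j..r+1}) \<and>
         E = E_blocks {1..r+1} \<and>
         (\<forall>j\<in>{1..r+1}. \<forall>i'\<in>{1..<j}. \<forall>l\<in>{1..m j}.
            \<exists>w v. (\<forall>h\<in>{j..r}. w h \<in> E_blocks {1..j-1}) \<and> v \<in> E_blocks {j..r+1} \<and>
                  s (x i') (e j l) = (\<Sum>h = j..r. s (x h) (w h)) + v))"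


section \<open>The basic sequence\<close>

text \<open>\<open>basic_sequence r I a m n\<close> says that the basic sequence of \<open>I\<close> is
  \<open>(a; n 2 1, \<dots>, n 2 a; \<dots>; n r 1, \<dots>, n r (m r))\<close>. Reindexing \<open>l\<close> within a fixed \<open>i\<close>
  preserves pseudo Weierstrass bases, so the degrees may be taken in nondecreasing order.\<close>

definition basic_sequence :: "nat \<Rightarrow> (nat, 'k::field) mpoly set \<Rightarrow> nat \<Rightarrow> (nat \<Rightarrow> nat) \<Rightarrow>
    (nat \<Rightarrow> nat \<Rightarrow> nat) \<Rightarrow> bool" where
  "basic_sequence r I a m n \<longleftrightarrow>
     m 1 = 1 \<and> m 2 = a \<and> m (r + 1) = 0 \<and> (\<forall>i\<in>{2..r}. mono_on {1..m i} (n i)) \<and>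
     (\<exists>U. zariski_open_bases r U \<and> U \<noteq> {} \<and>
       (\<forall>x\<in>U. \<exists>e. pseudo_weierstrass_basis r x (*) I (\<lambda>d. I \<inter> homog_part {1..r} d) m e \<and>
          e 1 1 \<in> homog_part {1..r} (int a) \<and>
          (\<forall>i\<in>{2..r}. \<forall>l\<in>{1..m i}. e i l \<in> homog_part {1..r} (int (n i l)))))"

end

theory Submission
  imports Defs "HOL-Algebra.Ring_Divisibility" "HOL-Computational_Algebra.Polynomial"
begin

text \<open>Let \<open>x\<^sub>1, \<dots>, x\<^sub>r\<close> be a basis of the linear forms for which \<open>I\<close> has a pseudo Weierstrass basis
  \<open>e\<^sup>i\<^sub>l\<close>. The theorem is read off from the kernel and the cokernel of \<open>\<times> x\<^sub>r\<close> on \<open>A = R/I\<close>.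

  For the kernel, consider the products \<open>x\<^sub>i' e\<^sup>j\<^sub>l\<close> with \<open>i' < j\<close>, on which the definition of a pseudo
  Weierstrass basis imposes its last condition. Modulo \<open>x\<^sub>r\<close> this condition makes the span of the
  last block \<open>e\<^sup>r\<^sub>l\<close> stable under multiplication by \<open>x\<^sub>1\<close>.
  A finite-dimensional space of polynomials with this property is zero, so
  \<open>e\<^sup>r\<^sub>l = x\<^sub>r g\<^sub>l\<close>, and the \<open>g\<^sub>l\<close> represent nonzero elements of the kernel. They span it: modulo \<open>x\<^sub>r I\<close>,
  an element \<open>x\<^sub>r f\<close> of \<open>I\<close> is a combination of the other blocks with coefficients in
  \<open>k[x\<^sub>i, \<dots>, x\<^sub>r\<^sub>-\<^sub>1]\<close> plus a combination of the \<open>e\<^sup>r\<^sub>l\<close> over \<open>k\<close>. As \<open>A\<close> is Artinian, a power of \<open>x\<^sub>r\<^sub>-\<^sub>1\<close>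
  carries the quotient by \<open>x\<^sub>r\<close> of the first combination into \<open>I\<close>, and uniqueness of coefficients
  forces that combination to vanish (\<open>combination_not_divisible\<close>). Hence \<open>\<times> x\<^sub>r\<close> is injective from
  degree \<open>d\<close> to degree \<open>d + 1\<close> if and only if no \<open>n\<^sup>r\<^sub>l\<close> equals \<open>d + 1\<close> (\<open>mult_var_injective_iff\<close>).

  The cokernel is the quotient of \<open>k[x\<^sub>1, \<dots>, x\<^sub>r\<^sub>-\<^sub>1]\<close> by the image of \<open>I\<close>. The same argument shows that
  this image inherits the blocks with \<open>i < r\<close> (\<open>drop_last_variable\<close>), so the description of the
  kernel applies to \<open>x\<^sub>r\<^sub>-\<^sub>1\<close> on it. The highest nonzero degree of the cokernel is killed by \<open>x\<^sub>r\<^sub>-\<^sub>1\<close>, so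
  the cokernel vanishes in degree \<open>d + 1\<close> if and only if all \<open>n\<^sup>r\<^sup>-\<^sup>1\<^sub>l\<close> are at most \<open>d + 1\<close>
  (\<open>mult_var_surjective_iff\<close>).

  Since \<open>A\<close> is nonzero and Artinian, both blocks are nonempty, and \<open>\<times> x\<^sub>r\<close> has maximal rank in every
  degree if and only if the smallest \<open>n\<^sup>r\<^sub>l\<close> is at least the largest \<open>n\<^sup>r\<^sup>-\<^sup>1\<^sub>l\<close>.

  It remains to compare \<open>x\<^sub>r\<close> with an arbitrary linear form.
  If some linear form \<open>l\<close> has maximal rank in a given degree, then so has \<open>x\<^sub>r + t l\<close> for
  all but finitely many \<open>t\<close>, by an eigenvalue argument (\<open>finite_noninjective_mod\<close>,
  \<open>finite_nonsurjective_mod\<close>), and the basis with \<open>x\<^sub>r + t l\<close> in place of \<open>x\<^sub>r\<close> stays in the open set of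
  general bases for all but finitely many \<open>t\<close> (\<open>finite_outside_zariski_open\<close>). As \<open>k\<close> is infinite, \<open>l\<close>
  may be replaced by the last member of a general basis.

  Two reductions make this precise. The substitution \<open>y\<^sub>i \<mapsto> x\<^sub>i\<close> reduces to the case where the basis
  consists of the variables (\<open>weierstrass_ideal_in_coordinates\<close>), so that \<open>k[x\<^sub>i, \<dots>, x\<^sub>r]\<close> becomes visible on
  terms. And the hypothesis on the Krull dimension is turned into the statement that \<open>I\<close> contains all
  terms of large degree (\<open>power_of_variable_mem\<close>, \<open>homog_part_large_degree_subset\<close>).\<close>

section \<open>Terms, degrees and homogeneous components\<close>

definition var :: "'v \<Rightarrow> ('v, 'k::zero_neq_one) mpoly" where
  "var j = Poly_Mapping.single (Poly_Mapping.single j 1) 1"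

lemma sum_of_terms: "p = (\<Sum>t\<in>Poly_Mapping.keys p. Poly_Mapping.single t (Poly_Mapping.lookup p t))"
proof (rule poly_mapping_eqI)
  fix t
  show "Poly_Mapping.lookup p t =
      Poly_Mapping.lookup (\<Sum>t\<in>Poly_Mapping.keys p. Poly_Mapping.single t (Poly_Mapping.lookup p t)) t"
    by (simp add: lookup_sum lookup_single when_def in_keys_iff)
qed

text \<open>Homogeneous components and the substitution of \<open>0\<close> for a variable both keep the terms with
  a given property and discard the others.\<close>

definition restrict_terms ::
    "(('v \<Rightarrow>\<^sub>0 nat) \<Rightarrow> bool) \<Rightarrow> ('v, 'k::zero) mpoly \<Rightarrow> ('v, 'k) mpoly" where
  "restrict_terms P p = Poly_Mapping.mapp (\<lambda>t c. c when P t) p"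

lemma lookup_restrict_terms:
  "Poly_Mapping.lookup (restrict_terms P p) t = (Poly_Mapping.lookup p t when P t)"
  by (auto simp: restrict_terms_def lookup_mapp when_def in_keys_iff)

lemma keys_restrict_terms: "Poly_Mapping.keys (restrict_terms P p) = {t \<in> Poly_Mapping.keys p. P t}"
  by (auto simp: in_keys_iff lookup_restrict_terms when_def split: if_splits)

lemma restrict_terms_add:
  fixes p q :: "('v, 'k::monoid_add) mpoly"
  shows "restrict_terms P (p + q) = restrict_terms P p + restrict_terms P q"
  by (rule poly_mapping_eqI) (simp add: lookup_restrict_terms lookup_add when_add_distrib)

lemma restrict_terms_diff:
  fixes p q :: "('v, 'k::ab_group_add) mpoly"
  shows "restrict_terms P (p - q) = restrict_terms P p - restrict_terms P q"
  by (rule poly_mapping_eqI) (simp add: lookup_restrict_terms lookup_minus when_def)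

lemma restrict_terms_0 [simp]: "restrict_terms P 0 = 0"
  by (rule poly_mapping_eqI) (simp add: lookup_restrict_terms)

lemma restrict_terms_sum:
  fixes f :: "'i \<Rightarrow> ('v, 'k::comm_monoid_add) mpoly"
  shows "restrict_terms P (\<Sum>i\<in>A. f i) = (\<Sum>i\<in>A. restrict_terms P (f i))"
  by (induction A rule: infinite_finite_induct) (auto simp: restrict_terms_add)

lemma restrict_terms_id: "(\<And>t. t \<in> Poly_Mapping.keys p \<Longrightarrow> P t) \<Longrightarrow> restrict_terms P p = p"
  by (rule poly_mapping_eqI) (auto simp: lookup_restrict_terms when_def in_keys_iff)

lemma restrict_terms_eq_0: "(\<And>t. t \<in> Poly_Mapping.keys p \<Longrightarrow> \<not> P t) \<Longrightarrow> restrict_terms P p = 0"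
  by (rule poly_mapping_eqI) (auto simp: lookup_restrict_terms when_def in_keys_iff)

lemma restrict_terms_polys_in: "p \<in> polys_in V \<Longrightarrow> restrict_terms P p \<in> polys_in V"
  by (auto simp: polys_in_def keys_restrict_terms)

lemma total_deg_superset:
  assumes "finite A" "Poly_Mapping.keys t \<subseteq> A"
  shows "total_deg t = (\<Sum>v\<in>A. Poly_Mapping.lookup t v)"
  unfolding total_deg_def using assms by (intro sum.mono_neutral_left) (auto simp: in_keys_iff)

lemma total_deg_add: "total_deg (s + t) = total_deg s + total_deg t"
proof -
  let ?A = "Poly_Mapping.keys s \<union> Poly_Mapping.keys t"
  have "Poly_Mapping.keys (s + t) \<subseteq> ?A"
    by (rule keys_add)
  then show ?thesis
    using total_deg_superset[of ?A s] total_deg_superset[of ?A t] total_deg_superset[of ?A "s + t"]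
    by (simp add: lookup_add sum.distrib)
qed

lemma total_deg_single [simp]: "total_deg (Poly_Mapping.single v n) = n"
  by (simp add: total_deg_def)

lemma total_deg_0 [simp]: "total_deg 0 = 0"
  by (simp add: total_deg_def)

lemma keys_mult_subset:
  fixes p q :: "('v, 'k::semiring_0) mpoly"
  assumes "t \<in> Poly_Mapping.keys (p * q)"
  obtains u v where "u \<in> Poly_Mapping.keys p" "v \<in> Poly_Mapping.keys q" "t = u + v"
  using keys_mult[of p q] assms by auto

lemma homog_part_0 [simp]: "0 \<in> homog_part V d"
  by (simp add: homog_part_def polys_in_def)

lemma homog_part_polys_in: "p \<in> homog_part V d \<Longrightarrow> p \<in> polys_in V"
  by (simp add: homog_part_def)

lemma homog_part_mono: "V \<subseteq> W \<Longrightarrow> p \<in> homog_part V d \<Longrightarrow> p \<in> homog_part W d"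
  by (auto simp: homog_part_def polys_in_def)

lemma polys_in_mono: "V \<subseteq> W \<Longrightarrow> p \<in> polys_in V \<Longrightarrow> p \<in> polys_in W"
  by (auto simp: polys_in_def)

lemma homog_part_add:
  "p \<in> homog_part V d \<Longrightarrow> q \<in> homog_part V d \<Longrightarrow> p + q \<in> homog_part V d"
  using keys_add[of p q] by (auto simp: homog_part_def polys_in_add)

lemma homog_part_uminus:
  fixes p :: "('v, 'k::ab_group_add) mpoly"
  shows "p \<in> homog_part V d \<Longrightarrow> - p \<in> homog_part V d"
  by (auto simp: homog_part_def polys_in_uminus in_keys_iff)

lemma homog_part_diff:
  fixes p :: "('v, 'k::ab_group_add) mpoly"
  shows "p \<in> homog_part V d \<Longrightarrow> q \<in> homog_part V d \<Longrightarrow> p - q \<in> homog_part V d"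
  using homog_part_add[of p V d "- q"] homog_part_uminus[of q V d] by simp

lemma homog_part_sum:
  "(\<And>i. i \<in> A \<Longrightarrow> f i \<in> homog_part V d) \<Longrightarrow> (\<Sum>i\<in>A. f i) \<in> homog_part V d"
  by (induction A rule: infinite_finite_induct) (auto simp: homog_part_add)

lemma homog_part_mult:
  fixes p q :: "('v, 'k::comm_ring_1) mpoly"
  assumes "p \<in> homog_part V d" "q \<in> homog_part V e"
  shows "p * q \<in> homog_part V (d + e)"
  using assms by (auto simp: homog_part_def polys_in_mult total_deg_add elim!: keys_mult_subset)

lemma polys_in_diff:
  fixes p :: "('v, 'k::ab_group_add) mpoly"
  shows "p \<in> polys_in V \<Longrightarrow> q \<in> polys_in V \<Longrightarrow> p - q \<in> polys_in V"
  using polys_in_add[of p V "- q"] polys_in_uminus[of q V] by simp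

lemma polys_in_sum:
  "(\<And>i. i \<in> A \<Longrightarrow> f i \<in> polys_in V) \<Longrightarrow> (\<Sum>i\<in>A. f i) \<in> polys_in V"
  by (induction A rule: infinite_finite_induct) (auto simp: polys_in_add polys_in_0)

lemma polys_in_power:
  fixes p :: "('v, 'k::comm_ring_1) mpoly"
  shows "p \<in> polys_in V \<Longrightarrow> p ^ n \<in> polys_in V"
  by (induction n) (auto simp: polys_in_mult polys_in_1)

lemma homog_part_const [simp]: "const c \<in> homog_part V 0"
  by (auto simp: homog_part_def polys_in_def)

lemma homog_part_var: "j \<in> V \<Longrightarrow> var j \<in> homog_part V 1"
  by (auto simp: var_def homog_part_def polys_in_def)

lemma homog_part_power:
  fixes p :: "('v, 'k::comm_ring_1) mpoly"
  assumes "p \<in> homog_part V d"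
  shows "p ^ n \<in> homog_part V (int n * d)"
proof (induction n)
  case 0
  then show ?case
    by (simp add: homog_part_def polys_in_def)
next
  case (Suc n)
  then show ?case
    using homog_part_mult[OF assms Suc] by (simp add: algebra_simps)
qed

lemma homog_part_neg: "d < 0 \<Longrightarrow> p \<in> homog_part V d \<Longrightarrow> p = 0"
  by (auto simp: homog_part_def simp flip: keys_eq_empty)

abbreviation hcomp :: "int \<Rightarrow> ('v, 'k::zero) mpoly \<Rightarrow> ('v, 'k) mpoly" where
  "hcomp d \<equiv> restrict_terms (\<lambda>t. int (total_deg t) = d)"

lemma hcomp_homog: "p \<in> polys_in V \<Longrightarrow> hcomp d p \<in> homog_part V d"
  by (auto simp: homog_part_def restrict_terms_polys_in keys_restrict_terms)

lemma hcomp_id: "p \<in> homog_part V d \<Longrightarrow> hcomp d p = p"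
  by (rule restrict_terms_id) (auto simp: homog_part_def)

lemma hcomp_eq_0: "p \<in> homog_part V e \<Longrightarrow> e \<noteq> d \<Longrightarrow> hcomp d p = 0"
  by (rule restrict_terms_eq_0) (auto simp: homog_part_def)

lemma sum_hcomp:
  fixes p :: "('v, 'k::comm_monoid_add) mpoly"
  obtains D where "finite D" "p = (\<Sum>d\<in>D. hcomp d p)"
proof
  let ?D = "(\<lambda>t. int (total_deg t)) ` Poly_Mapping.keys p"
  show "finite ?D"
    by simp
  show "p = (\<Sum>d\<in>?D. hcomp d p)"
    by (rule poly_mapping_eqI) (auto simp: lookup_sum lookup_restrict_terms when_def in_keys_iff)
qed

lemma hcomp_mult:
  fixes p q :: "('v, 'k::comm_ring_1) mpoly"
  assumes "q \<in> homog_part V e"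
  shows "hcomp d (p * q) = hcomp (d - e) p * q"
proof -
  obtain D where D: "finite D" "p = (\<Sum>c\<in>D. hcomp c p)"
    by (rule sum_hcomp[of p])
  have q: "q \<in> homog_part UNIV e"
    by (rule homog_part_mono[OF subset_UNIV assms])
  have p: "hcomp c p \<in> homog_part UNIV c" for c
    by (rule hcomp_homog) (simp add: polys_in_def)
  have "hcomp d (p * q) = (\<Sum>c\<in>D. hcomp d (hcomp c p * q))"
    by (subst D(2)) (simp add: sum_distrib_right restrict_terms_sum)
  also have "\<dots> = (\<Sum>c\<in>D. if c = d - e then hcomp c p * q else 0)"
  proof (rule sum.cong[OF refl])
    fix c
    show "hcomp d (hcomp c p * q) = (if c = d - e then hcomp c p * q else 0)"
      using hcomp_id[OF homog_part_mult[OF p[of c] q]] hcomp_eq_0[OF homog_part_mult[OF p q], of c d]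
      by (cases "c = d - e") auto
  qed
  also have "\<dots> = (\<Sum>c\<in>D. if c = d - e then hcomp c p else 0) * q"
    by (simp add: sum_distrib_right if_distrib[of "\<lambda>x. x * q"] cong: if_cong)
  also have "(\<Sum>c\<in>D. if c = d - e then hcomp c p else 0) = hcomp (d - e) (\<Sum>c\<in>D. hcomp c p)"
    unfolding restrict_terms_sum
  proof (rule sum.cong[OF refl])
    fix c
    show "(if c = d - e then hcomp c p else 0) = hcomp (d - e) (hcomp c p)"
      using hcomp_id[OF p] hcomp_eq_0[OF p, of c "d - e"] by (cases "c = d - e") auto
  qed
  finally show ?thesis
    using D(2) by simp
qed


section \<open>Setting a variable to zero\<close>

abbreviation drop_var :: "'v \<Rightarrow> ('v, 'k::zero) mpoly \<Rightarrow> ('v, 'k) mpoly" where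
  "drop_var j \<equiv> restrict_terms (\<lambda>t. j \<notin> Poly_Mapping.keys t)"

lemma drop_var_polys_in: "p \<in> polys_in V \<Longrightarrow> drop_var j p \<in> polys_in (V - {j})"
  by (auto simp: polys_in_def keys_restrict_terms)

lemma drop_var_homog: "p \<in> homog_part V d \<Longrightarrow> drop_var j p \<in> homog_part (V - {j}) d"
  by (auto simp: homog_part_def drop_var_polys_in keys_restrict_terms)

lemma drop_var_id: "p \<in> polys_in V \<Longrightarrow> j \<notin> V \<Longrightarrow> drop_var j p = p"
  by (rule restrict_terms_id) (auto simp: polys_in_def)

lemma drop_var_hcomp: "drop_var j (hcomp d p) = hcomp d (drop_var j p)"
  by (rule poly_mapping_eqI) (simp add: lookup_restrict_terms when_def)

lemma keys_add_nat:
  fixes s t :: "'v \<Rightarrow>\<^sub>0 nat"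
  shows "Poly_Mapping.keys (s + t) = Poly_Mapping.keys s \<union> Poly_Mapping.keys t"
  by (auto simp: in_keys_iff lookup_add)

text \<open>Setting a variable to \<open>0\<close> is a ring homomorphism: the discarded terms are those divisible by
  the variable, and their combinations absorb products.\<close>

lemma drop_var_mult:
  fixes p q :: "('v, 'k::comm_ring_1) mpoly"
  shows "drop_var j (p * q) = drop_var j p * drop_var j q"
proof -
  have involved: "j \<in> Poly_Mapping.keys t"
    if "t \<in> Poly_Mapping.keys (u - drop_var j u)" for t and u :: "('v, 'k) mpoly"
    using that by (auto simp: in_keys_iff lookup_minus lookup_restrict_terms when_def split: if_splits)
  have 1: "drop_var j ((u - drop_var j u) * w) = 0" for u w :: "('v, 'k) mpoly"
  proof (rule restrict_terms_eq_0)
    fix t assume "t \<in> Poly_Mapping.keys ((u - drop_var j u) * w)"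
    then obtain a b where "a \<in> Poly_Mapping.keys (u - drop_var j u)" "t = a + b"
      by (rule keys_mult_subset)
    then show "\<not> j \<notin> Poly_Mapping.keys t"
      using involved[of a u] by (simp add: keys_add_nat)
  qed
  then have 2: "drop_var j (w * (u - drop_var j u)) = 0" for u w :: "('v, 'k) mpoly"
    by (metis mult.commute)
  have 3: "drop_var j (drop_var j p * drop_var j q) = drop_var j p * drop_var j q"
    by (rule restrict_terms_id) (auto elim!: keys_mult_subset simp: keys_add_nat keys_restrict_terms)
  have "p * q = drop_var j p * drop_var j q
      + ((p - drop_var j p) * q + drop_var j p * (q - drop_var j q))"
    by (simp add: algebra_simps)
  then show ?thesis
    using 1[of p q] 2[of "drop_var j p" q] 3 by (simp only: restrict_terms_add) simp
qed

lemma drop_var_var: "drop_var j (var j * p) = (0 :: ('v, 'k::comm_ring_1) mpoly)"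
  by (rule restrict_terms_eq_0) (auto elim!: keys_mult_subset simp: keys_add_nat var_def)

lemma drop_var_self: "drop_var j (var j) = (0 :: ('v, 'k::comm_ring_1) mpoly)"
  using drop_var_var[of j 1] by simp

lemma var_neq_0: "var j \<noteq> (0 :: ('v, 'k::zero_neq_one) mpoly)"
  by (metis var_def keys_single keys_zero empty_not_insert zero_neq_one)

lemma var_mult_eq_0:
  fixes p :: "(nat, 'k::field) mpoly"
  shows "var j * p = 0 \<longleftrightarrow> p = 0"
  by (simp add: var_neq_0)

text \<open>Equations between coefficients are exploited in this way: one side lies in a polynomial
  ring without the variable \<open>j\<close>, the other is a multiple of that variable.\<close>

lemma not_involved_multiple_of_var:
  fixes p q :: "(nat, 'k::field) mpoly"
  assumes "p \<in> polys_in V" "j \<notin> V" "p = var j * q"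
  shows "p = 0"
  using drop_var_id[OF assms(1,2)] drop_var_var[of j q] assms(3) by simp

lemma split_off_var:
  fixes p :: "('v, 'k::comm_ring_1) mpoly"
  assumes "p \<in> polys_in V"
  obtains q where "q \<in> polys_in V" "p = drop_var j p + var j * q"
    "\<And>d. p \<in> homog_part V d \<Longrightarrow> q \<in> homog_part V (d - 1)"
proof
  define u where "u = Poly_Mapping.single j (1::nat)"
  define K where "K = {t \<in> Poly_Mapping.keys p. j \<in> Poly_Mapping.keys t}"
  define q where "q = (\<Sum>t\<in>K. Poly_Mapping.single (t - u) (Poly_Mapping.lookup p t))"
  have K: "t = u + (t - u)" if "t \<in> K" for t
    using that by (intro poly_mapping_eqI)
      (auto simp: u_def K_def lookup_add lookup_minus lookup_single when_def in_keys_iff)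
  have keys: "\<exists>t\<in>K. s = t - u" if "s \<in> Poly_Mapping.keys q" for s
  proof (rule ccontr)
    assume "\<not> (\<exists>t\<in>K. s = t - u)"
    then have "Poly_Mapping.lookup q s = 0"
      unfolding q_def lookup_sum by (intro sum.neutral) (auto simp: lookup_single when_def)
    then show False
      using that by (simp add: in_keys_iff)
  qed
  have sub: "Poly_Mapping.keys (t - u) \<subseteq> Poly_Mapping.keys t" for t
    by (auto simp: in_keys_iff lookup_minus)
  show "q \<in> polys_in V"
    using assms sub by (fastforce simp: polys_in_def K_def dest: keys)
  have "var j * q = (\<Sum>t\<in>K. Poly_Mapping.single t (Poly_Mapping.lookup p t))"
    unfolding q_def sum_distrib_left
    by (rule sum.cong[OF refl]) (use K in \<open>simp add: mult_single u_def var_def\<close>)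
  also have "\<dots> = p - drop_var j p"
    by (rule poly_mapping_eqI)
      (auto simp: K_def lookup_sum lookup_minus lookup_restrict_terms lookup_single when_def in_keys_iff)
  finally show "p = drop_var j p + var j * q"
    by simp
  fix d assume d: "p \<in> homog_part V d"
  have "int (total_deg (t - u)) = d - 1" if "t \<in> K" for t
  proof -
    have "total_deg t = total_deg u + total_deg (t - u)"
      using K[OF that] total_deg_add by metis
    then show ?thesis
      using d that by (auto simp: u_def K_def homog_part_def)
  qed
  then show "q \<in> homog_part V (d - 1)"
    using \<open>q \<in> polys_in V\<close> by (auto simp: homog_part_def dest: keys)
qed

section \<open>Weierstrass bases with respect to the variables\<close>

lemma polys_in_empty: "p \<in> polys_in {} \<Longrightarrow> p \<in> homog_part V 0"
  by (auto simp: homog_part_def polys_in_def)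

text \<open>For a graded ideal, a finite-dimensional quotient amounts to containing all polynomials of
  some degree; this is the form of the Artinian condition that the arguments use.\<close>

locale artinian_graded_ideal =
  fixes s :: nat and J :: "(nat, 'k::field) mpoly set"
  assumes J_subset: "J \<subseteq> polys_in {1..s}"
    and J_zero: "0 \<in> J"
    and J_add: "p \<in> J \<Longrightarrow> q \<in> J \<Longrightarrow> p + q \<in> J"
    and J_mult: "p \<in> polys_in {1..s} \<Longrightarrow> q \<in> J \<Longrightarrow> p * q \<in> J"
    and J_hcomp: "p \<in> J \<Longrightarrow> hcomp d p \<in> J"
    and J_cofinite: "\<exists>N. homog_part {1..s} (int N) \<subseteq> J"
begin

lemma J_sum: "(\<And>i. i \<in> A \<Longrightarrow> f i \<in> J) \<Longrightarrow> (\<Sum>i\<in>A. f i) \<in> J"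
  by (induction A rule: infinite_finite_induct) (auto simp: J_zero J_add)

text \<open>A term of degree \<open>d + 1\<close> is a variable times a term of degree \<open>d\<close>.\<close>

lemma homog_part_ge:
  assumes d: "homog_part {1..s} d \<subseteq> J" "0 \<le> d" "d \<le> d'"
  shows "homog_part {1..s} d' \<subseteq> J"
  using d(3)
proof (induction d' rule: int_ge_induct)
  case base
  then show ?case
    using d(1) by simp
next
  case (step i)
  have term_mem: "Poly_Mapping.single t c \<in> J"
    if t: "Poly_Mapping.keys t \<subseteq> {1..s}" "int (total_deg t) = i + 1" for t and c :: 'k
  proof -
    have "t \<noteq> 0"
      using t(2) step(1) d(2) by auto
    then have "Poly_Mapping.keys t \<noteq> {}"
      by simp
    then obtain v where v: "v \<in> Poly_Mapping.keys t"
      by blast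
    define t' where "t' = t - Poly_Mapping.single v 1"
    have t': "t = Poly_Mapping.single v 1 + t'"
      using v by (intro poly_mapping_eqI)
        (auto simp: t'_def lookup_add lookup_minus lookup_single when_def in_keys_iff)
    have "total_deg t = 1 + total_deg t'"
      using total_deg_add[of "Poly_Mapping.single v 1" t'] t' by simp
    then have "Poly_Mapping.single t' c \<in> homog_part {1..s} i"
      using t t' by (auto simp: homog_part_def polys_in_def keys_add_nat)
    then have "var v * Poly_Mapping.single t' c \<in> J"
      using step(2) v t(1) homog_part_var[of v "{1..s}"] by (intro J_mult) (auto simp: homog_part_def)
    then show ?thesis
      by (simp add: var_def mult_single t'[symmetric, simplified])
  qed
  show ?case
  proof
    fix p :: "(nat, 'k) mpoly"
    assume p: "p \<in> homog_part {1..s} (i + 1)"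
    have keys_p: "Poly_Mapping.keys t \<subseteq> {1..s}" "int (total_deg t) = i + 1"
      if "t \<in> Poly_Mapping.keys p" for t
      using p that unfolding homog_part_def polys_in_def by blast+
    have "Poly_Mapping.single t (Poly_Mapping.lookup p t) \<in> J" if "t \<in> Poly_Mapping.keys p" for t
      using keys_p[OF that] by (rule term_mem)
    then show "p \<in> J"
      by (subst sum_of_terms) (rule J_sum)
  qed
qed

end

text \<open>Multiplication by a variable raises the degree, so no nonzero finite-dimensional space of
  polynomials is stable under it. The elements of \<open>polys_in {}\<close> are the constants.\<close>

lemma no_finite_invariant_family:
  fixes u :: "'i \<Rightarrow> (nat, 'k::field) mpoly"
  assumes A: "finite A"
    and inv: "\<And>l. l \<in> A \<Longrightarrow> \<exists>c. (\<forall>k\<in>A. c k \<in> polys_in {}) \<and> var v * u l = (\<Sum>k\<in>A. c k * u k)"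
    and l: "l \<in> A"
  shows "u l = 0"
proof (rule ccontr)
  assume "u l \<noteq> 0"
  define K where "K = (\<Union>k\<in>A. Poly_Mapping.keys (u k))"
  have K: "finite K" "K \<noteq> {}"
    using A l \<open>u l \<noteq> 0\<close> by (auto simp: K_def)
  \<comment> \<open>A term of maximal degree in the family; multiplied by the variable it would exceed the maximum.\<close>
  define D where "D = Max (total_deg ` K)"
  have "D \<in> total_deg ` K"
    unfolding D_def using K by (intro Max_in) auto
  then obtain t k where t: "t \<in> Poly_Mapping.keys (u k)" "k \<in> A" "total_deg t = D"
    by (auto simp: K_def)
  have max: "total_deg t' \<le> D" if "t' \<in> K" for t'
    unfolding D_def using K that by (intro Max_ge) auto
  obtain c where c: "\<And>k. k \<in> A \<Longrightarrow> c k \<in> polys_in {}" "var v * u k = (\<Sum>k\<in>A. c k * u k)"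
    using inv[OF t(2)] by blast
  have comp: "hcomp (int D + 1) (c k * u k) = 0" if "k \<in> A" for k
  proof (rule restrict_terms_eq_0)
    fix t' assume "t' \<in> Poly_Mapping.keys (c k * u k)"
    then obtain a b where ab: "a \<in> Poly_Mapping.keys (c k)" "b \<in> Poly_Mapping.keys (u k)" "t' = a + b"
      by (rule keys_mult_subset)
    moreover have "a = 0"
      using ab(1) c(1)[OF that] by (auto simp: polys_in_def)
    ultimately have "t' \<in> K"
      using that by (auto simp: K_def)
    then show "int (total_deg t') \<noteq> int D + 1"
      using max by force
  qed
  have "hcomp (int D + 1) (u k * var v) = hcomp (int D) (u k) * var v"
    using hcomp_mult[OF homog_part_var[of v UNIV], of "int D + 1" "u k"] by simp
  moreover have "hcomp (int D + 1) (u k * var v) = 0"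
    using comp by (simp add: mult.commute[of "u k"] c(2) restrict_terms_sum)
  ultimately have "hcomp (int D) (u k) = 0"
    using var_mult_eq_0[of v "hcomp (int D) (u k)"] by (simp only: mult.commute[of _ "var v"])
  moreover have "t \<in> Poly_Mapping.keys (hcomp (int D) (u k))"
    using t by (simp add: keys_restrict_terms)
  ultimately show False
    by simp
qed

text \<open>The decomposition \<open>J = \<Oplus> k[y\<^sub>i, \<dots>, y\<^sub>s] e\<^sub>i\<^sub>l\<close> for the variables \<open>y\<^sub>1, \<dots>, y\<^sub>s\<close> themselves. The
  assumption \<open>transition\<close> is the condition on the products \<open>y\<^sub>i' e\<^sub>j\<^sub>l\<close> for \<open>i' = 1\<close>, with \<open>w\<close> ranging over all
  polynomials: in this form it passes to \<open>s - 1\<close> variables when the last one is set to \<open>0\<close>.\<close>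

locale weierstrass_ideal = artinian_graded_ideal s J
  for s :: nat and J :: "(nat, 'k::field) mpoly set" +
  fixes m :: "nat \<Rightarrow> nat" and n :: "nat \<Rightarrow> nat \<Rightarrow> nat" and e :: "nat \<Rightarrow> nat \<Rightarrow> (nat, 'k) mpoly"
  assumes s: "s \<ge> 2"
    and e_mem: "i \<in> {1..s} \<Longrightarrow> l \<in> {1..m i} \<Longrightarrow> e i l \<in> J"
    and e_homog: "i \<in> {1..s} \<Longrightarrow> l \<in> {1..m i} \<Longrightarrow> e i l \<in> homog_part {1..s} (int (n i l))"
    and spanning: "p \<in> J \<Longrightarrow> \<exists>c. (\<forall>i\<in>{1..s}. \<forall>l\<in>{1..m i}. c i l \<in> polys_in {i..s}) \<and>
      p = (\<Sum>i\<in>{1..s}. \<Sum>l\<in>{1..m i}. c i l * e i l)"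
    and unique: "(\<And>i l. i \<in> {1..s} \<Longrightarrow> l \<in> {1..m i} \<Longrightarrow> c i l \<in> polys_in {i..s}) \<Longrightarrow>
      (\<Sum>i\<in>{1..s}. \<Sum>l\<in>{1..m i}. c i l * e i l) = 0 \<Longrightarrow>
      i \<in> {1..s} \<Longrightarrow> l \<in> {1..m i} \<Longrightarrow> c i l = 0"
    and transition: "j \<in> {2..s} \<Longrightarrow> l \<in> {1..m j} \<Longrightarrow>
      \<exists>w c. (\<forall>i\<in>{j..s}. \<forall>l\<in>{1..m i}. c i l \<in> polys_in {i..s}) \<and>
        var 1 * e j l = (\<Sum>h\<in>{j..s}. var h * w h) + (\<Sum>i\<in>{j..s}. \<Sum>l\<in>{1..m i}. c i l * e i l)"
begin

lemma drop_var_1: "drop_var s (var 1) = (var 1 :: (nat, 'k) mpoly)"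
  using drop_var_id[OF homog_part_polys_in[OF homog_part_var[of 1 "{1::nat}"]], of s] s by simp

text \<open>With \<open>y\<^sub>s = 0\<close>, the transition condition turns the last block into a finite family whose span
  is stable under \<open>y\<^sub>1\<close>. Here \<open>s \<ge> 2\<close> enters: \<open>y\<^sub>1\<close> must survive.\<close>

lemma e_divisible:
  assumes "l \<in> {1..m s}"
  shows "drop_var s (e s l) = 0"
proof (rule no_finite_invariant_family[where A = "{1..m s}" and u = "\<lambda>l. drop_var s (e s l)"])
  fix l assume "l \<in> {1..m s}"
  then obtain w c where c: "\<forall>i\<in>{s..s}. \<forall>l\<in>{1..m i}. c i l \<in> polys_in {i..s}"
    "var 1 * e s l = (\<Sum>h\<in>{s..s}. var h * w h) + (\<Sum>i\<in>{s..s}. \<Sum>l\<in>{1..m i}. c i l * e i l)"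
    using transition[of s l] s by auto
  have "drop_var s (var 1 * e s l) = var 1 * drop_var s (e s l)"
    by (simp only: drop_var_mult drop_var_1)
  then have "var 1 * drop_var s (e s l) = (\<Sum>k\<in>{1..m s}. drop_var s (c s k) * drop_var s (e s k))"
    unfolding c(2) by (simp add: restrict_terms_add restrict_terms_sum drop_var_self drop_var_mult)
  moreover have "drop_var s (c s k) \<in> polys_in {}" if "k \<in> {1..m s}" for k
    using drop_var_polys_in[of "c s k" "{s..s}" s] c(1) that by simp
  ultimately show "\<exists>c. (\<forall>k\<in>{1..m s}. c k \<in> polys_in {}) \<and>
      var 1 * drop_var s (e s l) = (\<Sum>k\<in>{1..m s}. c k * drop_var s (e s k))"
    by (intro exI[of _ "\<lambda>k. drop_var s (c s k)"] conjI ballI)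
qed (use assms in simp_all)

lemma unique_eq:
  assumes "\<And>i l. i \<in> {1..s} \<Longrightarrow> l \<in> {1..m i} \<Longrightarrow> c i l \<in> polys_in {i..s}"
    and "\<And>i l. i \<in> {1..s} \<Longrightarrow> l \<in> {1..m i} \<Longrightarrow> c' i l \<in> polys_in {i..s}"
    and "(\<Sum>i\<in>{1..s}. \<Sum>l\<in>{1..m i}. c i l * e i l) = (\<Sum>i\<in>{1..s}. \<Sum>l\<in>{1..m i}. c' i l * e i l)"
    and "i \<in> {1..s}" "l \<in> {1..m i}"
  shows "c i l = c' i l"
proof -
  have "(\<Sum>i\<in>{1..s}. \<Sum>l\<in>{1..m i}. (c i l - c' i l) * e i l) = 0"
    using assms(3) by (simp add: left_diff_distrib sum_subtractf)
  then have "c i l - c' i l = 0"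
    using assms by (intro unique[of "\<lambda>i l. c i l - c' i l"]) (auto intro!: polys_in_diff)
  then show ?thesis
    by simp
qed

lemma polys_tail: "i \<in> {1..s} \<Longrightarrow> p \<in> polys_in {i..s} \<Longrightarrow> p \<in> polys_in {1..s}"
  by (erule polys_in_mono[rotated]) auto

text \<open>A power of \<open>y = y\<^sub>s\<^sub>-\<^sub>1\<close> carries \<open>f\<close> into \<open>J\<close>. Expanding \<open>f y\<^sup>N\<close> there and comparing coefficients
  gives \<open>y\<^sup>N c = y\<^sub>s q\<close> with a left-hand side free of \<open>y\<^sub>s\<close>. In other words, \<open>y\<close> acts injectively on
  the blocks below the last one modulo \<open>y\<^sub>s\<close>, because each of the rings \<open>k[y\<^sub>i, \<dots>, y\<^sub>s\<^sub>-\<^sub>1]\<close> with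
  \<open>i < s\<close> contains \<open>y\<close>.\<close>

lemma combination_not_divisible:
  assumes f: "f \<in> polys_in {1..s}"
    and c: "\<And>i l. i \<in> {1..<s} \<Longrightarrow> l \<in> {1..m i} \<Longrightarrow> c i l \<in> polys_in {i..<s}"
    and eq: "var s * f = (\<Sum>i\<in>{1..<s}. \<Sum>l\<in>{1..m i}. c i l * e i l)"
    and il: "i \<in> {1..<s}" "l \<in> {1..m i}"
  shows "c i l = 0"
proof -
  let ?y = "var (s - 1) :: (nat, 'k) mpoly"
  obtain N where N: "homog_part {1..s} (int N) \<subseteq> J"
    using J_cofinite by blast
  have "s - 1 \<in> {1..s}"
    using s by auto
  then have "?y ^ N \<in> homog_part {1..s} (int N)"
    using homog_part_power[OF homog_part_var, of "s - 1" "{1..s}" N] by simp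
  then have "f * ?y ^ N \<in> J"
    using N by (intro J_mult f) auto
  then obtain q where q: "\<forall>i\<in>{1..s}. \<forall>l\<in>{1..m i}. q i l \<in> polys_in {i..s}"
    "f * ?y ^ N = (\<Sum>i\<in>{1..s}. \<Sum>l\<in>{1..m i}. q i l * e i l)"
    using spanning by blast
  \<comment> \<open>Extended by \<open>0\<close> to the last block, which does not occur on the right-hand side.\<close>
  define c' where "c' i l = (if i < s then ?y ^ N * c i l else 0)" for i l
  have y_tail: "?y ^ N \<in> polys_in {i..<s}" if "i \<in> {1..<s}" for i
    using that by (intro polys_in_power homog_part_polys_in[OF homog_part_var]) auto
  have c': "c' i l \<in> polys_in {i..<s}" if "i \<in> {1..s}" "l \<in> {1..m i}" for i l
    using that c y_tail by (auto simp: c'_def polys_in_0 intro!: polys_in_mult)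
  have "(\<Sum>i\<in>{1..s}. \<Sum>l\<in>{1..m i}. c' i l * e i l) = (\<Sum>i\<in>{1..<s}. \<Sum>l\<in>{1..m i}. c' i l * e i l)"
    by (rule sum.mono_neutral_right) (auto simp: c'_def)
  also have "\<dots> = ?y ^ N * (\<Sum>i\<in>{1..<s}. \<Sum>l\<in>{1..m i}. c i l * e i l)"
    by (simp add: c'_def sum_distrib_left mult.assoc)
  also have "\<dots> = var s * (f * ?y ^ N)"
    unfolding eq[symmetric] by (simp only: ac_simps)
  also have "\<dots> = (\<Sum>i\<in>{1..s}. \<Sum>l\<in>{1..m i}. (var s * q i l) * e i l)"
    unfolding q(2) by (simp add: sum_distrib_left mult.assoc)
  finally have "c' i l = var s * q i l"
  proof (rule unique_eq[rotated 2])
    show "c' i l \<in> polys_in {i..s}" if "i \<in> {1..s}" "l \<in> {1..m i}" for i l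
      by (rule polys_in_mono[OF _ c'[OF that]]) auto
    show "var s * q i l \<in> polys_in {i..s}" if "i \<in> {1..s}" "l \<in> {1..m i}" for i l
      using that q(1) by (intro polys_in_mult homog_part_polys_in[OF homog_part_var]) auto
  qed (use il in auto)
  then have "c' i l = 0"
    using il by (intro not_involved_multiple_of_var[OF c']) auto
  then show ?thesis
    using il var_neq_0[of "s - 1"] by (auto simp: c'_def)
qed

text \<open>If the quotient \<open>g\<close> of \<open>e s l\<close> by \<open>y\<^sub>s\<close> were in \<open>J\<close>, then \<open>e s l\<close> would be a combination of the
  generators with all coefficients divisible by \<open>y\<^sub>s\<close>, against uniqueness. Thus \<open>g\<close> represents a
  nonzero element of the kernel of \<open>y\<^sub>s\<close>, in degree one less than \<open>e s l\<close>.\<close>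

lemma quotient_generator:
  assumes "l \<in> {1..m s}"
  obtains g where "e s l = var s * g" "g \<in> homog_part {1..s} (int (n s l) - 1)" "g \<notin> J"
proof -
  have e: "e s l \<in> homog_part {1..s} (int (n s l))"
    using e_homog[of s l] s assms by simp
  obtain g where g: "e s l = var s * g" "g \<in> homog_part {1..s} (int (n s l) - 1)"
    using split_off_var[OF homog_part_polys_in[OF e]] e e_divisible[OF assms] by (metis add_0)
  have "g \<notin> J"
  proof
    assume "g \<in> J"
    then obtain c where c: "\<forall>i\<in>{1..s}. \<forall>l\<in>{1..m i}. c i l \<in> polys_in {i..s}"
      "g = (\<Sum>i\<in>{1..s}. \<Sum>l\<in>{1..m i}. c i l * e i l)"
      using spanning by blast
    have *: "(\<Sum>i\<in>{1..s}. \<Sum>k\<in>{1..m i}. (if i = s \<and> k = l then 1 else 0) * e i k) = e s l"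
    proof -
      have delta: "(if P then 1 else 0) * p = (if P then p else 0)" for P and p :: "(nat, 'k) mpoly"
        by simp
      have "(\<Sum>i\<in>{1..s}. \<Sum>k\<in>{1..m i}. (if i = s \<and> k = l then 1 else 0) * e i k)
          = (\<Sum>i\<in>{1..s}. if i = s then (\<Sum>k\<in>{1..m i}. if k = l then e i k else 0) else 0)"
        by (intro sum.cong refl) (auto simp: delta)
      also have "\<dots> = e s l"
        using s assms by simp
      finally show ?thesis .
    qed
    have "(\<Sum>i\<in>{1..s}. \<Sum>k\<in>{1..m i}. (if i = s \<and> k = l then 1 else 0) * e i k)
        = (\<Sum>i\<in>{1..s}. \<Sum>k\<in>{1..m i}. (var s * c i k) * e i k)"
      unfolding * g(1) c(2) by (simp add: sum_distrib_left mult.assoc)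
    then have "(if s = s \<and> l = l then 1 else 0) = var s * c s l"
    proof (rule unique_eq[rotated 2, where i = s and l = l])
      show "var s * c i l \<in> polys_in {i..s}" if "i \<in> {1..s}" "l \<in> {1..m i}" for i l
        using that c(1) by (intro polys_in_mult homog_part_polys_in[OF homog_part_var]) auto
    qed (use s assms in \<open>auto simp: polys_in_0 polys_in_1\<close>)
    then have "(1 :: (nat, 'k) mpoly) = var s * c s l"
      by simp
    then have "(1 :: (nat, 'k) mpoly) = 0"
      by (rule not_involved_multiple_of_var[OF polys_in_1[of "{}"], rotated]) simp
    then show False
      by simp
  qed
  with g that show ?thesis
    by blast
qed

text \<open>The quotients \<open>g\<close> of the last block by \<open>y\<^sub>s\<close> span the kernel of \<open>y\<^sub>s\<close>: split every coefficient
  of \<open>y\<^sub>s f\<close> into its part without \<open>y\<^sub>s\<close> and a multiple of \<open>y\<^sub>s\<close>. The multiples contribute an element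
  of \<open>J\<close> to \<open>f\<close>, the constant parts in the last block contribute a combination of the \<open>g\<close>, and
  \<open>combination_not_divisible\<close> excludes anything else.\<close>

lemma mult_var_injective:
  assumes f: "f \<in> homog_part {1..s} d" and mem: "var s * f \<in> J"
    and d: "\<And>l. l \<in> {1..m s} \<Longrightarrow> int (n s l) \<noteq> d + 1"
  shows "f \<in> J"
proof -
  obtain c where c: "\<forall>i\<in>{1..s}. \<forall>l\<in>{1..m i}. c i l \<in> polys_in {i..s}"
    "var s * f = (\<Sum>i\<in>{1..s}. \<Sum>l\<in>{1..m i}. c i l * e i l)"
    using spanning[OF mem] by blast
  have "\<exists>q\<in>polys_in {i..s}. c i l = drop_var s (c i l) + var s * q"
    if "i \<in> {1..s}" "l \<in> {1..m i}" for i l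
    using split_off_var[of "c i l" "{i..s}" s] c(1) that by metis
  then obtain q where q: "\<And>i l. i \<in> {1..s} \<Longrightarrow> l \<in> {1..m i} \<Longrightarrow> q i l \<in> polys_in {i..s}"
    "\<And>i l. i \<in> {1..s} \<Longrightarrow> l \<in> {1..m i} \<Longrightarrow> c i l = drop_var s (c i l) + var s * q i l"
    by metis
  define c0 where "c0 i l = drop_var s (c i l)" for i l
  have c0: "c0 i l \<in> polys_in {i..<s}" if "i \<in> {1..s}" "l \<in> {1..m i}" for i l
    using drop_var_polys_in[of "c i l" "{i..s}" s] c(1) that
    by (auto simp: c0_def elim!: polys_in_mono[rotated])
  obtain g where g: "\<And>l. l \<in> {1..m s} \<Longrightarrow> e s l = var s * g l"
    "\<And>l. l \<in> {1..m s} \<Longrightarrow> g l \<in> homog_part {1..s} (int (n s l) - 1)"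
  proof -
    have "\<exists>g. e s l = var s * g \<and> g \<in> homog_part {1..s} (int (n s l) - 1)" if "l \<in> {1..m s}" for l
      using quotient_generator[OF that] by blast
    then show thesis
      using that by metis
  qed
  define j where "j = (\<Sum>i\<in>{1..s}. \<Sum>l\<in>{1..m i}. q i l * e i l)"
  define h where "h = f - j - (\<Sum>l\<in>{1..m s}. c0 s l * g l)"
  have j: "j \<in> J"
    unfolding j_def using q(1) polys_tail e_mem by (intro J_sum J_mult) auto
  have c0_s: "c0 s l \<in> homog_part {1..s} 0" if "l \<in> {1..m s}" for l
    using c0[of s l] that s by (auto intro!: polys_in_empty)
  have "(\<Sum>i\<in>{1..s}. \<Sum>l\<in>{1..m i}. c i l * e i l)
      = (\<Sum>i\<in>{1..s}. \<Sum>l\<in>{1..m i}. c0 i l * e i l + var s * (q i l * e i l))"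
    by (intro sum.cong refl) (subst q(2), auto simp: c0_def algebra_simps)
  then have "var s * f = (\<Sum>i\<in>{1..s}. \<Sum>l\<in>{1..m i}. c0 i l * e i l) + var s * j"
    by (simp add: c(2) j_def sum.distrib sum_distrib_left)
  moreover have "(\<Sum>i\<in>{1..s}. \<Sum>l\<in>{1..m i}. c0 i l * e i l)
      = (\<Sum>i\<in>{1..<s}. \<Sum>l\<in>{1..m i}. c0 i l * e i l) + (\<Sum>l\<in>{1..m s}. c0 s l * e s l)"
  proof -
    have "{1..s} = insert s {1..<s}"
      using s by auto
    then show ?thesis
      by (simp add: add.commute)
  qed
  moreover have "(\<Sum>l\<in>{1..m s}. c0 s l * e s l) = var s * (\<Sum>l\<in>{1..m s}. c0 s l * g l)"
    unfolding sum_distrib_left by (intro sum.cong refl) (simp add: g(1) algebra_simps)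
  ultimately have h: "var s * h = (\<Sum>i\<in>{1..<s}. \<Sum>l\<in>{1..m i}. c0 i l * e i l)"
    by (simp add: h_def algebra_simps)
  have "h \<in> polys_in {1..s}"
    unfolding h_def using f j J_subset c0_s g(2)
    by (intro polys_in_diff polys_in_sum polys_in_mult) (auto simp: homog_part_def)
  then have "c0 i l = 0" if "i \<in> {1..<s}" "l \<in> {1..m i}" for i l
    using combination_not_divisible[OF _ _ h] that c0 by auto
  then have "var s * h = 0"
    unfolding h by simp
  then have "h = 0"
    by (simp only: var_mult_eq_0)
  then have "f = j + (\<Sum>l\<in>{1..m s}. c0 s l * g l)"
    by (simp add: h_def algebra_simps)
  moreover have "hcomp d (c0 s l * g l) = 0" if l: "l \<in> {1..m s}" for l
    using d[OF l] by (intro hcomp_eq_0[OF homog_part_mult[OF c0_s[OF l] g(2)[OF l]]]) auto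
  ultimately have "hcomp d f = hcomp d j"
    by (simp add: restrict_terms_add restrict_terms_sum)
  then show ?thesis
    using hcomp_id[OF f] J_hcomp[OF j, of d] by simp
qed

text \<open>The highest nonzero degree of the quotient is killed by \<open>y\<^sub>s\<close>, so it is one less than the
  largest degree in the last block.\<close>

lemma homog_part_subset_iff:
  assumes "0 \<le> d"
  shows "homog_part {1..s} d \<subseteq> J \<longleftrightarrow> (\<forall>l\<in>{1..m s}. int (n s l) \<le> d)"
proof
  assume d: "homog_part {1..s} d \<subseteq> J"
  show "\<forall>l\<in>{1..m s}. int (n s l) \<le> d"
  proof (rule ballI, rule ccontr)
    fix l assume l: "l \<in> {1..m s}" "\<not> int (n s l) \<le> d"
    then have "homog_part {1..s} (int (n s l) - 1) \<subseteq> J"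
      by (intro homog_part_ge[OF d assms]) auto
    then show False
      using quotient_generator[OF l(1)] by blast
  qed
next
  assume n: "\<forall>l\<in>{1..m s}. int (n s l) \<le> d"
  obtain N where N: "homog_part {1..s} (int N) \<subseteq> J"
    using J_cofinite by blast
  \<comment> \<open>Descending from a degree where everything lies in \<open>J\<close>: no generator can block the step.\<close>
  have "homog_part {1..s} d' \<subseteq> J" if "d' \<le> max d (int N)" "d \<le> d'" for d'
    using that
  proof (induction d' rule: int_le_induct)
    case base
    show ?case
      by (rule homog_part_ge[OF N]) auto
  next
    case (step i)
    show ?case
    proof
      fix f :: "(nat, 'k) mpoly" assume f: "f \<in> homog_part {1..s} (i - 1)"
      have "var s * f \<in> homog_part {1..s} i"
        using homog_part_mult[OF homog_part_var f, of s] s by simp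
      then have "var s * f \<in> J"
        using step by auto
      then show "f \<in> J"
        by (rule mult_var_injective[OF f]) (use n step in fastforce)
    qed
  qed
  then show "homog_part {1..s} d \<subseteq> J"
    by simp
qed


text \<open>Setting \<open>y\<^sub>s = 0\<close> kills the last block, since it is divisible by \<open>y\<^sub>s\<close>. The other blocks remain
  independent because a dependence would be a combination divisible by \<open>y\<^sub>s\<close>.\<close>

lemma drop_last_variable:
  assumes "s \<ge> 3"
  shows "weierstrass_ideal (s - 1) (drop_var s ` J) m n (\<lambda>i l. drop_var s (e i l))"
proof unfold_locales
  have drop: "{i..s} - {s} = {i..s - 1}" for i
    using s by auto
  have drop_mem: "drop_var s p \<in> polys_in {i..s - 1}" if "p \<in> polys_in {i..s}" for i and p :: "(nat, 'k) mpoly"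
    using drop_var_polys_in[OF that, of s] by (simp add: drop)
  have drop_id: "drop_var s p = p" if "p \<in> polys_in {i..s - 1}" for i and p :: "(nat, 'k) mpoly"
    using s by (intro drop_var_id[OF that]) auto
  have widen: "p \<in> polys_in {i..s}" if "p \<in> polys_in {i..s - 1}" for i and p :: "(nat, 'k) mpoly"
    by (rule polys_in_mono[OF _ that]) auto
  have last: "(\<Sum>i\<in>{j..s}. f i) = (\<Sum>i\<in>{j..s - 1}. f i) + f s" if "j \<le> s"
    for j and f :: "nat \<Rightarrow> (nat, 'k) mpoly"
  proof -
    have *: "{j..s} = insert s {j..s - 1}" "s \<notin> {j..s - 1}"
      using that s by auto
    show ?thesis
      unfolding *(1) sum.insert[OF finite_atLeastAtMost *(2)] by (rule add.commute)
  qed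
  have last_block: "drop_var s (\<Sum>i\<in>{j..s}. \<Sum>l\<in>{1..m i}. c i l * e i l)
      = (\<Sum>i\<in>{j..s - 1}. \<Sum>l\<in>{1..m i}. drop_var s (c i l) * drop_var s (e i l))"
    if "j \<le> s" for j c
    using last[OF that] e_divisible by (simp add: restrict_terms_add restrict_terms_sum drop_var_mult)
  show "s - 1 \<ge> 2"
    using assms by simp
  show "drop_var s ` J \<subseteq> polys_in {1..s - 1}"
    using J_subset drop_mem by blast
  show "0 \<in> drop_var s ` J"
    using J_zero by force
  show "p + q \<in> drop_var s ` J" if "p \<in> drop_var s ` J" "q \<in> drop_var s ` J" for p q
    using that by (auto simp: J_add simp flip: restrict_terms_add)
  show "p * q \<in> drop_var s ` J" if "p \<in> polys_in {1..s - 1}" "q \<in> drop_var s ` J" for p q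
    using that J_mult[OF widen[OF that(1)]] drop_id[OF that(1)] by (force simp: drop_var_mult)
  show "hcomp d p \<in> drop_var s ` J" if "p \<in> drop_var s ` J" for p d
    using that by (auto simp: J_hcomp simp flip: drop_var_hcomp)
  show "\<exists>N. homog_part {1..s - 1} (int N) \<subseteq> drop_var s ` J"
  proof -
    obtain N where N: "homog_part {1..s} (int N) \<subseteq> J"
      using J_cofinite by blast
    have "p \<in> drop_var s ` J" if "p \<in> homog_part {1..s - 1} (int N)" for p
    proof
      show "p = drop_var s p"
        using drop_id[OF homog_part_polys_in[OF that]] by simp
      show "p \<in> J"
        using N homog_part_mono[OF _ that, of "{1..s}"] by auto
    qed
    then show ?thesis
      by blast
  qed
  show "drop_var s (e i l) \<in> drop_var s ` J" if "i \<in> {1..s - 1}" "l \<in> {1..m i}" for i l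
    using e_mem that by auto
  show "drop_var s (e i l) \<in> homog_part {1..s - 1} (int (n i l))"
    if "i \<in> {1..s - 1}" "l \<in> {1..m i}" for i l
    using drop_var_homog[OF e_homog[of i l], of s] that by (auto simp: drop)
  show "\<exists>c. (\<forall>i\<in>{1..s - 1}. \<forall>l\<in>{1..m i}. c i l \<in> polys_in {i..s - 1}) \<and>
      p = (\<Sum>i\<in>{1..s - 1}. \<Sum>l\<in>{1..m i}. c i l * drop_var s (e i l))"
    if p: "p \<in> drop_var s ` J" for p
  proof -
    obtain q where q: "q \<in> J" "p = drop_var s q"
      using p by blast
    obtain c where c: "\<forall>i\<in>{1..s}. \<forall>l\<in>{1..m i}. c i l \<in> polys_in {i..s}"
      "q = (\<Sum>i\<in>{1..s}. \<Sum>l\<in>{1..m i}. c i l * e i l)"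
      using spanning[OF q(1)] by blast
    have "p = (\<Sum>i\<in>{1..s - 1}. \<Sum>l\<in>{1..m i}. drop_var s (c i l) * drop_var s (e i l))"
      unfolding q(2) c(2) using s by (intro last_block) simp
    moreover have "\<forall>i\<in>{1..s - 1}. \<forall>l\<in>{1..m i}. drop_var s (c i l) \<in> polys_in {i..s - 1}"
      using c(1) drop_mem by auto
    ultimately show ?thesis
      by (intro exI[of _ "\<lambda>i l. drop_var s (c i l)"]) auto
  qed
  show "c i l = 0"
    if c: "\<And>i l. i \<in> {1..s - 1} \<Longrightarrow> l \<in> {1..m i} \<Longrightarrow> c i l \<in> polys_in {i..s - 1}"
      and eq: "(\<Sum>i\<in>{1..s - 1}. \<Sum>l\<in>{1..m i}. c i l * drop_var s (e i l)) = 0"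
      and il: "i \<in> {1..s - 1}" "l \<in> {1..m i}" for c i l
  proof -
    let ?p = "\<Sum>i\<in>{1..<s}. \<Sum>l\<in>{1..m i}. c i l * e i l"
    have interval: "{i..<s} = {i..s - 1}" for i
      using s by auto
    have drop_p: "drop_var s ?p = (\<Sum>i\<in>{1..s - 1}. \<Sum>l\<in>{1..m i}. c i l * drop_var s (e i l))"
      unfolding interval restrict_terms_sum drop_var_mult
      by (intro sum.cong refl) (simp add: drop_id[OF c])
    have "?p \<in> polys_in {1..s}"
    proof (intro polys_in_sum polys_in_mult)
      fix i l assume il: "i \<in> {1..<s}" "l \<in> {1..m i}"
      show "c i l \<in> polys_in {1..s}"
        by (rule polys_tail[OF _ widen[OF c]]) (use il in auto)
      show "e i l \<in> polys_in {1..s}"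
        by (rule subsetD[OF J_subset e_mem]) (use il in auto)
    qed
    then obtain q where q: "q \<in> polys_in {1..s}" "?p = drop_var s ?p + var s * q"
      by (rule split_off_var[of _ _ s])
    have q': "var s * q = ?p"
      using q(2) unfolding drop_p eq add_0 by (rule sym)
    show ?thesis
      by (rule combination_not_divisible[OF q(1) _ q']) (use c il in \<open>auto simp: interval\<close>)
  qed
  show "\<exists>w c. (\<forall>i\<in>{j..s - 1}. \<forall>l\<in>{1..m i}. c i l \<in> polys_in {i..s - 1}) \<and>
      var 1 * drop_var s (e j l) = (\<Sum>h\<in>{j..s - 1}. var h * w h) +
        (\<Sum>i\<in>{j..s - 1}. \<Sum>l\<in>{1..m i}. c i l * drop_var s (e i l))"
    if jl: "j \<in> {2..s - 1}" "l \<in> {1..m j}" for j l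
  proof -
    have js: "j \<in> {2..s}"
      using jl(1) unfolding atLeastAtMost_iff by arith
    obtain w c where wc: "\<forall>i\<in>{j..s}. \<forall>l\<in>{1..m i}. c i l \<in> polys_in {i..s}"
      "var 1 * e j l = (\<Sum>h\<in>{j..s}. var h * w h) + (\<Sum>i\<in>{j..s}. \<Sum>l\<in>{1..m i}. c i l * e i l)"
      using transition[OF js jl(2)] by auto
    have js: "j \<le> s"
      using js by simp
    have var_id: "drop_var s (var h) = (var h :: (nat, 'k) mpoly)" if "h \<in> {j..s - 1}" for h
      by (rule drop_id[OF homog_part_polys_in[OF homog_part_var[OF that]]])
    have "drop_var s (\<Sum>h\<in>{j..s}. var h * w h) = (\<Sum>h\<in>{j..s - 1}. var h * drop_var s (w h))"
      unfolding last[OF js] restrict_terms_add restrict_terms_sum drop_var_mult drop_var_self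
        mult_zero_left add_0_right
      by (rule sum.cong[OF refl]) (simp only: var_id)
    then have "var 1 * drop_var s (e j l) = (\<Sum>h\<in>{j..s - 1}. var h * drop_var s (w h)) +
        (\<Sum>i\<in>{j..s - 1}. \<Sum>l\<in>{1..m i}. drop_var s (c i l) * drop_var s (e i l))"
      using arg_cong[OF wc(2), of "drop_var s"]
      unfolding restrict_terms_add last_block[OF js] drop_var_mult drop_var_1 by simp
    moreover have "\<forall>i\<in>{j..s - 1}. \<forall>l\<in>{1..m i}. drop_var s (c i l) \<in> polys_in {i..s - 1}"
      using wc(1) drop_mem by auto
    ultimately show ?thesis
      by (intro exI[of _ "\<lambda>h. drop_var s (w h)"] exI[of _ "\<lambda>i l. drop_var s (c i l)"]) auto
  qed
qed

lemma mult_var_injective_iff: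
  "(\<forall>f\<in>homog_part {1..s} d. var s * f \<in> J \<longrightarrow> f \<in> J) \<longleftrightarrow> (\<forall>l\<in>{1..m s}. int (n s l) \<noteq> d + 1)"
proof
  assume inj: "\<forall>f\<in>homog_part {1..s} d. var s * f \<in> J \<longrightarrow> f \<in> J"
  show "\<forall>l\<in>{1..m s}. int (n s l) \<noteq> d + 1"
  proof (intro ballI notI)
    fix l assume l: "l \<in> {1..m s}" "int (n s l) = d + 1"
    obtain g where g: "e s l = var s * g" "g \<in> homog_part {1..s} (int (n s l) - 1)" "g \<notin> J"
      using quotient_generator[OF l(1)] .
    then have "var s * g \<in> J"
      using e_mem[of s l] l s by simp
    then show False
      using inj g(2,3) l(2) by simp
  qed
qed (use mult_var_injective in blast)

text \<open>The cokernel of \<open>y\<^sub>s\<close> is the quotient of \<open>k[y\<^sub>1, \<dots>, y\<^sub>s\<^sub>-\<^sub>1]\<close> by the image of \<open>J\<close>, whose last block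
  has the index \<open>s - 1\<close>.\<close>

lemma mult_var_surjective_iff:
  assumes "s \<ge> 3" "0 \<le> d"
  shows "(\<forall>q\<in>homog_part {1..s} d. \<exists>f\<in>homog_part {1..s} (d - 1). q - var s * f \<in> J)
    \<longleftrightarrow> (\<forall>l\<in>{1..m (s - 1)}. int (n (s - 1) l) \<le> d)"
proof -
  interpret drop: weierstrass_ideal "s - 1" "drop_var s ` J" m n "\<lambda>i l. drop_var s (e i l)"
    by (rule drop_last_variable[OF assms(1)])
  have interval: "{1..s} - {s} = {1..s - 1}"
    using s by auto
  have "(\<forall>q\<in>homog_part {1..s} d. \<exists>f\<in>homog_part {1..s} (d - 1). q - var s * f \<in> J)
      \<longleftrightarrow> homog_part {1..s - 1} d \<subseteq> drop_var s ` J"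
  proof
    assume surj: "\<forall>q\<in>homog_part {1..s} d. \<exists>f\<in>homog_part {1..s} (d - 1). q - var s * f \<in> J"
    show "homog_part {1..s - 1} d \<subseteq> drop_var s ` J"
    proof
      fix q :: "(nat, 'k) mpoly" assume q: "q \<in> homog_part {1..s - 1} d"
      have "q \<in> homog_part {1..s} d"
        by (rule homog_part_mono[OF _ q]) auto
      then obtain f where "q - var s * f \<in> J"
        using surj by blast
      moreover have "drop_var s (q - var s * f) = q"
        using drop_var_id[OF homog_part_polys_in[OF q], of s] s
        by (simp add: restrict_terms_diff drop_var_var)
      ultimately show "q \<in> drop_var s ` J"
        by (metis imageI)
    qed
  next
    assume sub: "homog_part {1..s - 1} d \<subseteq> drop_var s ` J"
    show "\<forall>q\<in>homog_part {1..s} d. \<exists>f\<in>homog_part {1..s} (d - 1). q - var s * f \<in> J"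
    proof
      fix q :: "(nat, 'k) mpoly" assume q: "q \<in> homog_part {1..s} d"
      have "drop_var s q \<in> drop_var s ` J"
        using drop_var_homog[OF q, of s] sub unfolding interval by blast
      then obtain p where p: "p \<in> J" "drop_var s p = drop_var s q"
        by auto
      have p': "hcomp d p \<in> homog_part {1..s} d"
        using hcomp_homog J_subset p(1) by blast
      have "drop_var s (q - hcomp d p) = 0"
        unfolding restrict_terms_diff drop_var_hcomp p(2)
        using hcomp_id[OF drop_var_homog[OF q]] by (simp add: drop_var_hcomp)
      then obtain f where f: "q - hcomp d p = var s * f" "f \<in> homog_part {1..s} (d - 1)"
        using split_off_var[of "q - hcomp d p" "{1..s}" s] homog_part_diff[OF q p']
          homog_part_polys_in by (metis add_0)
      then have "q - var s * f = hcomp d p"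
        by (simp add: algebra_simps)
      then show "\<exists>f\<in>homog_part {1..s} (d - 1). q - var s * f \<in> J"
        using f(2) J_hcomp[OF p(1), of d] by metis
    qed
  qed
  then show ?thesis
    using drop.homog_part_subset_iff[OF assms(2)] by simp
qed

end

section \<open>Substitution\<close>

definition eval_term :: "('v \<Rightarrow> 's::comm_ring_1) \<Rightarrow> ('v \<Rightarrow>\<^sub>0 nat) \<Rightarrow> 's" where
  "eval_term x t = (\<Prod>v\<in>Poly_Mapping.keys t. x v ^ Poly_Mapping.lookup t v)"

lemma eval_term_superset:
  assumes "finite A" "Poly_Mapping.keys t \<subseteq> A"
  shows "eval_term x t = (\<Prod>v\<in>A. x v ^ Poly_Mapping.lookup t v)"
  unfolding eval_term_def using assms by (intro prod.mono_neutral_left) (auto simp: in_keys_iff)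

lemma eval_term_add: "eval_term x (s + t) = eval_term x s * eval_term x t"
  using eval_term_superset[of "Poly_Mapping.keys s \<union> Poly_Mapping.keys t" _ x]
  by (simp add: keys_add_nat lookup_add power_add prod.distrib)

lemma poly_eval_superset:
  assumes "finite A" "Poly_Mapping.keys p \<subseteq> A" "\<phi> 0 = 0"
  shows "poly_eval \<phi> x p = (\<Sum>t\<in>A. \<phi> (Poly_Mapping.lookup p t) * eval_term x t)"
  unfolding poly_eval_def eval_term_def using assms
  by (intro sum.mono_neutral_left) (auto simp: in_keys_iff)

locale coefficient_map =
  fixes \<phi> :: "'k::comm_ring_1 \<Rightarrow> 's::comm_ring_1"
  assumes map_zero: "\<phi> 0 = 0" and map_one: "\<phi> 1 = 1"
    and map_add: "\<phi> (a + b) = \<phi> a + \<phi> b" and map_mult: "\<phi> (a * b) = \<phi> a * \<phi> b"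
begin

lemma poly_eval_add: "poly_eval \<phi> x (p + q) = poly_eval \<phi> x p + poly_eval \<phi> x q"
  using poly_eval_superset[of "Poly_Mapping.keys p \<union> Poly_Mapping.keys q" _ \<phi> x] keys_add[of p q]
  by (simp add: map_zero lookup_add map_add distrib_right sum.distrib)

lemma poly_eval_single: "poly_eval \<phi> x (Poly_Mapping.single t c) = \<phi> c * eval_term x t"
  using poly_eval_superset[of "{t}" "Poly_Mapping.single t c" \<phi> x] by (simp add: map_zero)

lemma poly_eval_0 [simp]: "poly_eval \<phi> x 0 = 0"
  by (simp add: poly_eval_def)

lemma poly_eval_1 [simp]: "poly_eval \<phi> x 1 = 1"
  using poly_eval_single[of x 0 1] by (simp add: map_one eval_term_def)

lemma poly_eval_var [simp]: "poly_eval \<phi> x (var v) = x v"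
  unfolding var_def poly_eval_single by (simp add: map_one eval_term_def)

lemma poly_eval_sum: "poly_eval \<phi> x (\<Sum>i\<in>A. f i) = (\<Sum>i\<in>A. poly_eval \<phi> x (f i))"
  by (induction A rule: infinite_finite_induct) (auto simp: poly_eval_add)

lemma poly_eval_mult: "poly_eval \<phi> x (p * q) = poly_eval \<phi> x p * poly_eval \<phi> x q"
proof -
  let ?P = "\<lambda>t. Poly_Mapping.single t (Poly_Mapping.lookup p t)"
  let ?Q = "\<lambda>t. Poly_Mapping.single t (Poly_Mapping.lookup q t)"
  have "p * q = (\<Sum>s\<in>Poly_Mapping.keys p. ?P s) * (\<Sum>t\<in>Poly_Mapping.keys q. ?Q t)"
    by (simp flip: sum_of_terms)
  also have "\<dots> = (\<Sum>s\<in>Poly_Mapping.keys p. \<Sum>t\<in>Poly_Mapping.keys q. ?P s * ?Q t)"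
    by (rule sum_product)
  finally have "poly_eval \<phi> x (p * q)
      = (\<Sum>s\<in>Poly_Mapping.keys p. \<Sum>t\<in>Poly_Mapping.keys q. poly_eval \<phi> x (?P s) * poly_eval \<phi> x (?Q t))"
    by (simp add: poly_eval_sum mult_single poly_eval_single map_mult eval_term_add algebra_simps)
  also have "\<dots> = poly_eval \<phi> x (\<Sum>s\<in>Poly_Mapping.keys p. ?P s) * poly_eval \<phi> x (\<Sum>t\<in>Poly_Mapping.keys q. ?Q t)"
    by (simp add: poly_eval_sum sum_product)
  finally show ?thesis
    by (simp flip: sum_of_terms)
qed

lemma poly_eval_power: "poly_eval \<phi> x (p ^ n) = poly_eval \<phi> x p ^ n"
  by (induction n) (auto simp: poly_eval_mult)

lemma poly_eval_prod: "poly_eval \<phi> x (\<Prod>i\<in>A. f i) = (\<Prod>i\<in>A. poly_eval \<phi> x (f i))"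
  by (induction A rule: infinite_finite_induct) (auto simp: poly_eval_mult)

end

interpretation const: coefficient_map "const :: 'k::comm_ring_1 \<Rightarrow> ('v, 'k) mpoly"
  by unfold_locales (simp_all add: single_add mult_single)

abbreviation subst :: "('v \<Rightarrow> ('w, 'k::comm_ring_1) mpoly) \<Rightarrow> ('v, 'k) mpoly \<Rightarrow> ('w, 'k) mpoly" where
  "subst \<equiv> poly_eval const"

lemma subst_const: "subst x (const c) = const c"
  by (simp add: const.poly_eval_single eval_term_def)

lemma var_power:
  "var v ^ i = (Poly_Mapping.single (Poly_Mapping.single v i) 1 :: ('v, 'k::comm_ring_1) mpoly)"
  by (induction i) (simp_all add: var_def mult_single flip: single_add)

lemma eval_term_var: "eval_term var t = (Poly_Mapping.single t 1 :: ('v, 'k::comm_ring_1) mpoly)"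
proof -
  have "(\<Prod>v\<in>A. var v ^ f v)
      = (Poly_Mapping.single (\<Sum>v\<in>A. Poly_Mapping.single v (f v)) 1 :: ('v, 'k) mpoly)"
    if "finite A" for A and f :: "'v \<Rightarrow> nat"
    using that by (induction A rule: finite_induct) (simp_all add: var_power mult_single)
  moreover have "(\<Sum>v\<in>Poly_Mapping.keys t. Poly_Mapping.single v (Poly_Mapping.lookup t v)) = t"
    by (rule poly_mapping_eqI) (simp add: lookup_sum lookup_single when_def in_keys_iff)
  ultimately show ?thesis
    by (simp add: eval_term_def)
qed

lemma subst_identity:
  assumes "p \<in> polys_in V" "\<And>v. v \<in> V \<Longrightarrow> x v = var v"
  shows "subst x p = p"
proof -
  have "eval_term x t = Poly_Mapping.single t 1" if "t \<in> Poly_Mapping.keys p" for t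
  proof -
    have "v \<in> V" if "v \<in> Poly_Mapping.keys t" for v
      using assms(1) \<open>t \<in> Poly_Mapping.keys p\<close> that unfolding polys_in_def by blast
    then have "eval_term x t = eval_term var t"
      unfolding eval_term_def by (intro prod.cong refl) (simp add: assms(2))
    then show ?thesis
      by (simp add: eval_term_var)
  qed
  then have "subst x p = (\<Sum>t\<in>Poly_Mapping.keys p. Poly_Mapping.single t (Poly_Mapping.lookup p t))"
    using poly_eval_superset[of "Poly_Mapping.keys p" p const x] by (simp add: mult_single)
  then show ?thesis
    by (simp flip: sum_of_terms)
qed

lemma subst_subst: "subst x (subst z p) = subst (\<lambda>v. subst x (z v)) p"
  unfolding poly_eval_def[of const z] const.poly_eval_sum const.poly_eval_mult const.poly_eval_prod
    const.poly_eval_power subst_const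
  by (simp add: poly_eval_def)

lemma homog_part_prod:
  fixes f :: "'i \<Rightarrow> ('v, 'k::comm_ring_1) mpoly"
  assumes "finite A" "\<And>i. i \<in> A \<Longrightarrow> f i \<in> homog_part V (d i)"
  shows "(\<Prod>i\<in>A. f i) \<in> homog_part V (\<Sum>i\<in>A. d i)"
  using assms
  by (induction A rule: finite_induct)
    (simp_all add: homog_part_mult, simp add: homog_part_def polys_in_1)

lemma subst_homog:
  assumes p: "p \<in> homog_part V d" and x: "\<And>v. v \<in> V \<Longrightarrow> x v \<in> homog_part W 1"
  shows "subst x p \<in> homog_part W d"
  unfolding poly_eval_def
proof (rule homog_part_sum)
  fix t assume t: "t \<in> Poly_Mapping.keys p"
  have "(\<Prod>v\<in>Poly_Mapping.keys t. x v ^ Poly_Mapping.lookup t v)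
      \<in> homog_part W (\<Sum>v\<in>Poly_Mapping.keys t. int (Poly_Mapping.lookup t v) * 1)"
    using t p x by (intro homog_part_prod homog_part_power) (auto simp: homog_part_def polys_in_def)
  moreover have "(\<Sum>v\<in>Poly_Mapping.keys t. int (Poly_Mapping.lookup t v) * 1) = d"
    using p t by (auto simp: homog_part_def total_deg_def)
  ultimately show "const (Poly_Mapping.lookup p t)
      * (\<Prod>v\<in>Poly_Mapping.keys t. x v ^ Poly_Mapping.lookup t v) \<in> homog_part W d"
    using homog_part_mult[OF homog_part_const] by fastforce
qed

lemma subst_hcomp:
  assumes p: "p \<in> polys_in V" and x: "\<And>v. v \<in> V \<Longrightarrow> x v \<in> homog_part W 1"
  shows "subst x (hcomp d p) = hcomp d (subst x p)"
proof -
  obtain D where D: "finite D" "p = (\<Sum>c\<in>D. hcomp c p)"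
    by (rule sum_hcomp[of p])
  have h: "hcomp c p \<in> homog_part V c" for c
    by (rule hcomp_homog[OF p])
  have hx: "subst x (hcomp c p) \<in> homog_part W c" for c
    by (rule subst_homog[OF h x])
  have part: "hcomp d (subst x (hcomp c p)) = (if c = d then subst x (hcomp c p) else 0)" for c
    using hcomp_id[OF hx[of d]] hcomp_eq_0[OF hx[of c], of d] by auto
  have "hcomp d (hcomp c p) = (if c = d then hcomp c p else 0)" for c
    using hcomp_id[OF h[of d]] hcomp_eq_0[OF h[of c], of d] by auto
  then have "hcomp d p = (\<Sum>c\<in>D. if c = d then hcomp c p else 0)"
    by (subst D(2)) (simp only: restrict_terms_sum)
  then have "subst x (hcomp d p) = subst x (\<Sum>c\<in>D. if c = d then hcomp c p else 0)"
    by (rule arg_cong)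
  also have "\<dots> = (\<Sum>c\<in>D. if c = d then subst x (hcomp c p) else 0)"
    unfolding const.poly_eval_sum by (intro sum.cong refl) simp
  also have "\<dots> = hcomp d (subst x p)"
    by (subst (2) D(2)) (simp only: restrict_terms_sum const.poly_eval_sum part)
  finally show ?thesis .
qed

lemma subst_polys_in:
  assumes p: "p \<in> polys_in V" and x: "\<And>v. v \<in> V \<Longrightarrow> x v \<in> polys_in W"
  shows "subst x p \<in> polys_in W"
  unfolding poly_eval_def
proof (intro polys_in_sum polys_in_mult)
  fix t assume t: "t \<in> Poly_Mapping.keys p"
  show "const (Poly_Mapping.lookup p t) \<in> polys_in W"
    by (rule homog_part_polys_in[OF homog_part_const])
  have "(\<Prod>v\<in>A. x v ^ Poly_Mapping.lookup t v) \<in> polys_in W" if "A \<subseteq> V" for A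
    using that
    by (induction A rule: infinite_finite_induct)
      (auto intro!: polys_in_mult polys_in_power x simp: polys_in_1)
  then show "(\<Prod>v\<in>Poly_Mapping.keys t. x v ^ Poly_Mapping.lookup t v) \<in> polys_in W"
    using p t by (auto simp: polys_in_def)
qed


section \<open>Changing the basis of the linear forms\<close>

lemma total_deg_eq_1: "total_deg t = 1 \<Longrightarrow> \<exists>v. t = Poly_Mapping.single v 1"
proof -
  assume "total_deg t = 1"
  then have "(\<Sum>v\<in>Poly_Mapping.keys t. Poly_Mapping.lookup t v) = Suc 0"
    by (simp add: total_deg_def)
  then obtain v where v: "v \<in> Poly_Mapping.keys t" "Poly_Mapping.lookup t v = Suc 0"
    "\<forall>w\<in>Poly_Mapping.keys t. v \<noteq> w \<longrightarrow> Poly_Mapping.lookup t w = 0"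
    unfolding sum_eq_Suc0_iff[OF finite_keys] by blast
  have "t = Poly_Mapping.single v 1"
    by (rule poly_mapping_eqI) (use v in \<open>auto simp: lookup_single when_def in_keys_iff\<close>)
  then show ?thesis ..
qed

lemma linear_form_expand:
  fixes p :: "('v, 'k::comm_ring_1) mpoly"
  assumes p: "p \<in> homog_part V 1" and V: "finite V"
  shows "p = (\<Sum>v\<in>V. const (Poly_Mapping.lookup p (Poly_Mapping.single v 1)) * var v)"
proof (rule poly_mapping_eqI)
  fix t
  have inj: "Poly_Mapping.single v (1::nat) = Poly_Mapping.single w 1 \<longleftrightarrow> v = w" for v w :: 'v
    by (metis inj_onD keys_single singleton_inject zero_neq_one)
  have "Poly_Mapping.lookup (\<Sum>v\<in>V. const (Poly_Mapping.lookup p (Poly_Mapping.single v 1)) * var v) t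
      = (\<Sum>v\<in>V. if Poly_Mapping.single v 1 = t then Poly_Mapping.lookup p (Poly_Mapping.single v 1) else 0)"
    by (simp add: lookup_sum var_def mult_single lookup_single when_def del: One_nat_def)
  also have "\<dots> = Poly_Mapping.lookup p t"
  proof (cases "t \<in> Poly_Mapping.keys p")
    case True
    then have t: "total_deg t = 1" "Poly_Mapping.keys t \<subseteq> V"
      using p by (auto simp: homog_part_def polys_in_def)
    obtain w where w: "t = Poly_Mapping.single w 1"
      using total_deg_eq_1[OF t(1)] by blast
    moreover have "w \<in> V"
      using t(2) by (simp add: w)
    ultimately show ?thesis
      using V by (simp only: inj) simp
  next
    case False
    then show ?thesis
      by (auto simp: in_keys_iff intro: sum.neutral)
  qed
  finally show "Poly_Mapping.lookup p t = Poly_Mapping.lookup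
      (\<Sum>v\<in>V. const (Poly_Mapping.lookup p (Poly_Mapping.single v 1)) * var v) t" ..
qed

lemma linear_basis_homog: "linear_basis r x \<Longrightarrow> i \<in> {1..r} \<Longrightarrow> x i \<in> homog_part {1..r} 1"
  unfolding linear_basis_def by (metis coeffs.span_base imageI)

lemma linear_basis_unique:
  assumes x: "linear_basis r x" and eq: "(\<Sum>i\<in>{1..r}. const (c i) * x i) = 0" and i: "i \<in> {1..r}"
  shows "c i = 0"
proof -
  have inj: "inj_on x {1..r}" and ind: "coeffs.independent (x ` {1..r})"
    using x by (simp_all add: linear_basis_def)
  have "(\<Sum>v\<in>x ` {1..r}. scale (c (the_inv_into {1..r} x v)) v) = 0"
    using eq by (simp add: sum.reindex[OF inj] the_inv_into_f_f[OF inj] scale_def del: One_nat_def)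
  then have "c (the_inv_into {1..r} x (x i)) = 0"
    using coeffs.independentD[OF ind _ subset_refl, of "\<lambda>v. c (the_inv_into {1..r} x v)" "x i"] i
    by simp
  then show ?thesis
    by (simp only: the_inv_into_f_f[OF inj i])
qed

lemma linear_basis_expand:
  assumes x: "linear_basis r x" and p: "p \<in> homog_part {1..r} 1"
  obtains c where "p = (\<Sum>i\<in>{1..r}. const (c i) * x i)"
proof -
  have inj: "inj_on x {1..r}" and "p \<in> coeffs.span (x ` {1..r})"
    using x p by (simp_all add: linear_basis_def)
  then obtain u where "p = (\<Sum>v\<in>x ` {1..r}. scale (u v) v)"
    by (auto simp: coeffs.span_finite)
  then have "p = (\<Sum>i\<in>{1..r}. const (u (x i)) * x i)"
    by (simp add: sum.reindex[OF inj] scale_def del: One_nat_def)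
  then show ?thesis
    by (rule that)
qed

text \<open>The substitution \<open>z\<close> expresses the variables through the basis \<open>x\<close>. It is inverse to \<open>x\<close> on
  both sides because substituting \<open>x\<close> is injective on linear forms.\<close>

lemma inverse_substitution:
  fixes x :: "nat \<Rightarrow> (nat, 'k::field) mpoly"
  assumes x: "linear_basis r x"
  shows "\<exists>z. \<forall>i\<in>{1..r}. z i \<in> homog_part {1..r} 1 \<and> subst x (z i) = var i \<and> subst z (x i) = var i"
proof -
  have "\<exists>c. var j = (\<Sum>i\<in>{1..r}. const (c i) * x i)" if "j \<in> {1..r}" for j
    using linear_basis_expand[OF x homog_part_var[OF that]] by blast
  then obtain b where b: "\<And>j. j \<in> {1..r} \<Longrightarrow> var j = (\<Sum>i\<in>{1..r}. const (b j i) * x i)"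
    by metis
  define z where "z j = (\<Sum>i\<in>{1..r}. const (b j i) * (var i :: (nat, 'k) mpoly))" for j
  have z: "z j \<in> homog_part {1..r} 1" for j
    unfolding z_def
    by (rule homog_part_sum) (metis add_0 homog_part_mult homog_part_const homog_part_var)
  have xz: "subst x (z j) = var j" if "j \<in> {1..r}" for j
    unfolding z_def const.poly_eval_sum const.poly_eval_mult subst_const const.poly_eval_var
    by (rule b[OF that, symmetric])
  have inj: "p = 0" if p: "p \<in> homog_part {1..r} 1" "subst x p = 0" for p
  proof -
    let ?c = "\<lambda>i. Poly_Mapping.lookup p (Poly_Mapping.single i 1)"
    have e: "p = (\<Sum>i\<in>{1..r}. const (?c i) * var i)"
      by (rule linear_form_expand[OF p(1)]) simp
    have "(\<Sum>i\<in>{1..r}. const (?c i) * x i) = subst x (\<Sum>i\<in>{1..r}. const (?c i) * var i)"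
      unfolding const.poly_eval_sum const.poly_eval_mult subst_const const.poly_eval_var ..
    then have "(\<Sum>i\<in>{1..r}. const (?c i) * x i) = 0"
      using p(2) e by simp
    then have "?c i = 0" if "i \<in> {1..r}" for i
      using that by (rule linear_basis_unique[OF x])
    then show "p = 0"
      by (intro trans[OF e] sum.neutral) simp
  qed
  have zx: "subst z (x i) = var i" if i: "i \<in> {1..r}" for i
  proof -
    have "subst x (subst z (x i)) = x i"
      unfolding subst_subst
      by (rule subst_identity[OF homog_part_polys_in[OF linear_basis_homog[OF x i]] xz])
    then have "subst x (subst z (x i) - var i) + subst x (var i) = x i"
      unfolding const.poly_eval_add[symmetric] by simp
    then have "subst x (subst z (x i) - var i) = 0"
      by simp
    then show ?thesis
      using inj[OF homog_part_diff[OF subst_homog[OF linear_basis_homog[OF x i] z] homog_part_var[OF i]]]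
      by simp
  qed
  show ?thesis
    by (intro exI[of _ z] ballI conjI z xz zx)
qed

section \<open>Pseudo Weierstrass bases in coordinates\<close>

lemma tail_combination:
  fixes x :: "nat \<Rightarrow> (nat, 'k::field) mpoly"
  assumes q: "q \<in> blocks (*) (tail_alg r x) m e {j..r + 1}" and m: "m (r + 1) = 0" and j: "j \<le> r"
  obtains c where "\<forall>i\<in>{j..r}. \<forall>l\<in>{1..m i}. c i l \<in> polys_in {i..r}"
    "q = (\<Sum>i\<in>{j..r}. \<Sum>l\<in>{1..m i}. subst x (c i l) * e i l)"
proof -
  obtain u where u: "q = (\<Sum>i\<in>{j..r + 1}. u i)"
    "\<forall>i\<in>{j..r + 1}. u i \<in> block (*) (tail_alg r x) m e i"
    using q unfolding blocks_def by blast
  have "\<exists>c. (\<forall>l\<in>{1..m i}. c l \<in> polys_in {i..r}) \<and> u i = (\<Sum>l\<in>{1..m i}. subst x (c l) * e i l)"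
    if i: "i \<in> {j..r}" for i
  proof -
    have "u i \<in> block (*) (tail_alg r x) m e i"
      using u(2) i by simp
    then obtain d where d: "u i = (\<Sum>l = 1..m i. d l * e i l)" "\<forall>l\<in>{1..m i}. d l \<in> tail_alg r x i"
      unfolding block_def by blast
    have "\<forall>l\<in>{1..m i}. \<exists>c. c \<in> polys_in {i..r} \<and> d l = subst x c"
      using d(2) unfolding tail_alg_def by blast
    then obtain c where c: "\<forall>l\<in>{1..m i}. c l \<in> polys_in {i..r} \<and> d l = subst x (c l)"
      by metis
    then have "u i = (\<Sum>l\<in>{1..m i}. subst x (c l) * e i l)"
      unfolding d(1) by (intro sum.cong refl) simp
    with c show ?thesis
      by blast
  qed
  then have "\<forall>i\<in>{j..r}. \<exists>c. (\<forall>l\<in>{1..m i}. c l \<in> polys_in {i..r}) \<and>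
      u i = (\<Sum>l\<in>{1..m i}. subst x (c l) * e i l)"
    by (rule ballI)
  from bchoice[OF this] obtain c where c: "\<forall>i\<in>{j..r}. (\<forall>l\<in>{1..m i}. c i l \<in> polys_in {i..r}) \<and>
      u i = (\<Sum>l\<in>{1..m i}. subst x (c i l) * e i l)"
    by (elim exE)
  have "u (r + 1) \<in> block (*) (tail_alg r x) m e (r + 1)"
    using u(2) j by simp
  then have "u (r + 1) = 0"
    using m by (auto simp: block_def)
  then have "q = (\<Sum>i\<in>{j..r}. u i)"
    using u(1) j by simp
  also have "\<dots> = (\<Sum>i\<in>{j..r}. \<Sum>l\<in>{1..m i}. subst x (c i l) * e i l)"
    by (rule sum.cong[OF refl]) (use c in \<open>simp only:\<close>)
  finally have "q = (\<Sum>i\<in>{j..r}. \<Sum>l\<in>{1..m i}. subst x (c i l) * e i l)" .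
  with c show ?thesis
    by (intro that[of c] ballI) (blast, assumption)
qed

lemma pseudo_weierstrass_basis_unique:
  fixes x :: "nat \<Rightarrow> (nat, 'k::field) mpoly"
  assumes P: "pseudo_weierstrass_basis r x (*) E G m e" and m: "m (r + 1) = 0"
    and c: "\<And>i l. i \<in> {1..r} \<Longrightarrow> l \<in> {1..m i} \<Longrightarrow> c i l \<in> tail_alg r x i"
    and eq: "(\<Sum>i\<in>{1..r}. \<Sum>l\<in>{1..m i}. c i l * e i l) = 0"
    and il: "i \<in> {1..r}" "l \<in> {1..m i}"
  shows "c i l = 0"
proof -
  have free: "\<forall>i\<in>{1..r+1}. \<forall>l\<in>{1..m i}. \<forall>c\<in>tail_alg r x i. c * e i l = 0 \<longrightarrow> c = 0"
    and direct_l: "\<forall>i\<in>{1..r+1}. direct_sum (\<lambda>l. {c * e i l | c. c \<in> tail_alg r x i}) {1..m i}"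
    and direct_i: "\<forall>j\<in>{1..r+1}. direct_sum (block (*) (tail_alg r x) m e) {j..r+1}"
    using P unfolding pseudo_weierstrass_basis_def Let_def by blast+
  define u where "u i = (\<Sum>l\<in>{1..m i}. c i l * e i l)" for i
  have block: "u i \<in> block (*) (tail_alg r x) m e i" if "i \<in> {1..r + 1}" for i
  proof -
    have "\<forall>l\<in>{1..m i}. c i l \<in> tail_alg r x i"
      using c that m by (cases "i = r + 1") auto
    then show ?thesis
      unfolding block_def u_def by blast
  qed
  moreover have "(\<Sum>i\<in>{1..r + 1}. u i) = 0"
    using eq m by (simp add: u_def)
  moreover have "direct_sum (block (*) (tail_alg r x) m e) {1..r + 1}"
    using direct_i by simp
  ultimately have "u i = 0"
    using il(1) unfolding direct_sum_def by simp
  moreover have "direct_sum (\<lambda>l. {c * e i l | c. c \<in> tail_alg r x i}) {1..m i}"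
    using direct_l il(1) by simp
  ultimately have "c i l * e i l = 0"
    using c[OF il(1)] il(2) unfolding direct_sum_def u_def by fast
  moreover have "i \<in> {1..r + 1}"
    using il(1) by simp
  ultimately show ?thesis
    using free il(2) c[OF il] by blast
qed

text \<open>The substitution of \<open>x\<^sub>i\<close> for the \<open>i\<close>-th variable is a graded automorphism that maps the
  polynomials in the last variables onto \<open>k[x\<^sub>i, \<dots>, x\<^sub>r]\<close>. Pulling \<open>I\<close> and its generators back along
  it reduces an arbitrary basis of the linear forms to the variables.\<close>

lemma weierstrass_ideal_in_coordinates:
  fixes x :: "nat \<Rightarrow> (nat, 'k::field) mpoly"
  assumes r: "r \<ge> 2" and x: "linear_basis r x"
    and z: "\<And>i. i \<in> {1..r} \<Longrightarrow> z i \<in> homog_part {1..r} 1"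
      "\<And>i. i \<in> {1..r} \<Longrightarrow> subst x (z i) = var i" "\<And>i. i \<in> {1..r} \<Longrightarrow> subst z (x i) = var i"
    and I: "artinian_graded_ideal r I"
    and m: "m (r + 1) = 0"
    and P: "pseudo_weierstrass_basis r x (*) I G m e"
    and e: "\<And>i l. i \<in> {1..r} \<Longrightarrow> l \<in> {1..m i} \<Longrightarrow> e i l \<in> homog_part {1..r} (int (n i l))"
  shows "weierstrass_ideal r {p \<in> polys_in {1..r}. subst x p \<in> I} m n (\<lambda>i l. subst z (e i l))"
proof -
  interpret I: artinian_graded_ideal r I
    by (rule I)
  note x_homog = linear_basis_homog[OF x]
  have x_in: "x i \<in> polys_in {1..r}" if "i \<in> {1..r}" for i
    by (rule homog_part_polys_in[OF x_homog[OF that]])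
  have z_in: "z i \<in> polys_in {1..r}" if "i \<in> {1..r}" for i
    by (rule homog_part_polys_in[OF z(1)[OF that]])
  have xz: "subst x (subst z p) = p" if "p \<in> polys_in {1..r}" for p
    unfolding subst_subst using that by (rule subst_identity) (rule z(2))
  have zx: "subst z (subst x p) = p" if "p \<in> polys_in {1..r}" for p
    unfolding subst_subst using that by (rule subst_identity) (rule z(3))
  have tail: "p \<in> polys_in {1..r}" if "p \<in> polys_in {i..r}" "1 \<le> i" for i p
    by (rule polys_in_mono[OF _ that(1)]) (use that(2) in auto)
  have subst_comb: "subst z (\<Sum>i\<in>{j..r}. \<Sum>l\<in>{1..m i}. subst x (c i l) * e i l)
      = (\<Sum>i\<in>{j..r}. \<Sum>l\<in>{1..m i}. c i l * subst z (e i l))"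
    if "\<forall>i\<in>{j..r}. \<forall>l\<in>{1..m i}. c i l \<in> polys_in {i..r}" "1 \<le> j" for j c
    unfolding const.poly_eval_sum const.poly_eval_mult
  proof (intro sum.cong refl arg_cong2[where f = "(*)"] zx)
    fix i l assume "i \<in> {j..r}" "l \<in> {1..m i}"
    then show "c i l \<in> polys_in {1..r}"
      using that by (intro tail[of "c i l" i]) auto
  qed
  note parts = P[unfolded pseudo_weierstrass_basis_def Let_def]
  have e_mem: "\<forall>i\<in>{1..r+1}. \<forall>l\<in>{1..m i}. e i l \<in> I \<and> (\<exists>d. e i l \<in> G d)"
    using parts by (elim conjE)
  have I_eq: "I = blocks (*) (tail_alg r x) m e {1..r+1}"
    using parts by (elim conjE)
  have trans: "\<forall>j\<in>{1..r+1}. \<forall>i'\<in>{1..<j}. \<forall>l\<in>{1..m j}.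
            \<exists>w v. (\<forall>h\<in>{j..r}. w h \<in> blocks (*) (tail_alg r x) m e {1..j-1}) \<and>
                  v \<in> blocks (*) (tail_alg r x) m e {j..r+1} \<and>
                  x i' * e j l = (\<Sum>h = j..r. x h * w h) + v"
    using parts by (elim conjE)
  let ?J = "{p \<in> polys_in {1..r}. subst x p \<in> I}"
  show ?thesis
  proof unfold_locales
    show "2 \<le> r"
      by (rule r)
    show "?J \<subseteq> polys_in {1..r}"
      by blast
    show "0 \<in> ?J"
      by (simp add: polys_in_0 I.J_zero)
    show "p + q \<in> ?J" if "p \<in> ?J" "q \<in> ?J" for p q
      using that by (simp add: polys_in_add const.poly_eval_add I.J_add)
    show "p * q \<in> ?J" if "p \<in> polys_in {1..r}" "q \<in> ?J" for p q
      using that I.J_mult[OF subst_polys_in[OF that(1) x_in]]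
      by (simp add: polys_in_mult const.poly_eval_mult)
    show "hcomp d p \<in> ?J" if "p \<in> ?J" for p d
    proof -
      have "subst x (hcomp d p) = hcomp d (subst x p)"
        by (rule subst_hcomp[OF _ x_homog]) (use that in auto)
      then show ?thesis
        using that by (simp add: restrict_terms_polys_in I.J_hcomp)
    qed
    show "\<exists>N. homog_part {1..r} (int N) \<subseteq> ?J"
    proof -
      obtain N where N: "homog_part {1..r} (int N) \<subseteq> I"
        using I.J_cofinite by blast
      have "p \<in> ?J" if "p \<in> homog_part {1..r} (int N)" for p
        using homog_part_polys_in[OF that] subsetD[OF N subst_homog[OF that x_homog]] by simp
      then show ?thesis
        by blast
    qed
    show "subst z (e i l) \<in> homog_part {1..r} (int (n i l))" if "i \<in> {1..r}" "l \<in> {1..m i}" for i l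
      by (rule subst_homog[OF e[OF that] z(1)])
    show "subst z (e i l) \<in> ?J" if "i \<in> {1..r}" "l \<in> {1..m i}" for i l
    proof -
      have e_in: "e i l \<in> polys_in {1..r}"
        by (rule homog_part_polys_in[OF e[OF that]])
      show ?thesis
        using e_mem that subst_polys_in[OF e_in z_in] xz[OF e_in] by simp
    qed
    show "\<exists>c. (\<forall>i\<in>{1..r}. \<forall>l\<in>{1..m i}. c i l \<in> polys_in {i..r}) \<and>
        p = (\<Sum>i\<in>{1..r}. \<Sum>l\<in>{1..m i}. c i l * subst z (e i l))" if p: "p \<in> ?J" for p
    proof -
      have "subst x p \<in> blocks (*) (tail_alg r x) m e {1..r + 1}"
        using p I_eq by simp
      then obtain c where c: "\<forall>i\<in>{1..r}. \<forall>l\<in>{1..m i}. c i l \<in> polys_in {i..r}"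
        "subst x p = (\<Sum>i\<in>{1..r}. \<Sum>l\<in>{1..m i}. subst x (c i l) * e i l)"
        by (rule tail_combination[where r = r and m = m, OF _ m]) (use r in auto)
      have "p = subst z (subst x p)"
        using p zx by simp
      also have "\<dots> = (\<Sum>i\<in>{1..r}. \<Sum>l\<in>{1..m i}. c i l * subst z (e i l))"
        unfolding c(2) by (rule subst_comb[OF c(1)]) simp
      finally show ?thesis
        using c(1) by (intro exI[of _ c] conjI)
    qed
    show "c i l = 0"
      if c: "\<And>i l. i \<in> {1..r} \<Longrightarrow> l \<in> {1..m i} \<Longrightarrow> c i l \<in> polys_in {i..r}"
        and eq: "(\<Sum>i\<in>{1..r}. \<Sum>l\<in>{1..m i}. c i l * subst z (e i l)) = 0"
        and il: "i \<in> {1..r}" "l \<in> {1..m i}" for c i l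
    proof -
      have "(\<Sum>i\<in>{1..r}. \<Sum>l\<in>{1..m i}. subst x (c i l) * e i l)
          = subst x (\<Sum>i\<in>{1..r}. \<Sum>l\<in>{1..m i}. c i l * subst z (e i l))"
        unfolding const.poly_eval_sum const.poly_eval_mult
        by (intro sum.cong refl arg_cong2[where f = "(*)"] xz[symmetric] homog_part_polys_in[OF e])
      then have zero: "(\<Sum>i\<in>{1..r}. \<Sum>l\<in>{1..m i}. subst x (c i l) * e i l) = 0"
        unfolding eq const.poly_eval_0 .
      have "subst x (c i l) \<in> tail_alg r x i" if "i \<in> {1..r}" "l \<in> {1..m i}" for i l
        unfolding tail_alg_def by (rule imageI[OF c[OF that]])
      then have "subst x (c i l) = 0"
        by (rule pseudo_weierstrass_basis_unique[OF P m, where c = "\<lambda>i l. subst x (c i l)", OF _ zero il])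
      then have "subst z (subst x (c i l)) = 0"
        by simp
      then show "c i l = 0"
        using zx[OF tail[OF c[OF il]]] il by simp
    qed
    show "\<exists>w c. (\<forall>i\<in>{j..r}. \<forall>l\<in>{1..m i}. c i l \<in> polys_in {i..r}) \<and>
        var 1 * subst z (e j l) = (\<Sum>h\<in>{j..r}. var h * w h) +
          (\<Sum>i\<in>{j..r}. \<Sum>l\<in>{1..m i}. c i l * subst z (e i l))"
      if jl: "j \<in> {2..r}" "l \<in> {1..m j}" for j l
    proof -
      have "j \<in> {1..r + 1}" "1 \<in> {1..<j}"
        using jl(1) by auto
      then obtain w v where wv: "v \<in> blocks (*) (tail_alg r x) m e {j..r + 1}"
        "x 1 * e j l = (\<Sum>h = j..r. x h * w h) + v"
        using trans jl(2) by blast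
      obtain c where c: "\<forall>i\<in>{j..r}. \<forall>l\<in>{1..m i}. c i l \<in> polys_in {i..r}"
        "v = (\<Sum>i\<in>{j..r}. \<Sum>l\<in>{1..m i}. subst x (c i l) * e i l)"
        by (rule tail_combination[OF wv(1) m]) (use jl in auto)
      have "subst z (\<Sum>h = j..r. x h * w h) = (\<Sum>h\<in>{j..r}. var h * subst z (w h))"
        unfolding const.poly_eval_sum const.poly_eval_mult
        using jl by (intro sum.cong refl arg_cong2[where f = "(*)"] z(3)) auto
      moreover have "subst z (x 1 * e j l) = var 1 * subst z (e j l)"
        unfolding const.poly_eval_mult using r by (subst z(3)) auto
      moreover have "subst z v = (\<Sum>i\<in>{j..r}. \<Sum>l\<in>{1..m i}. c i l * subst z (e i l))"
        unfolding c(2) by (rule subst_comb[OF c(1)]) (use jl in auto)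
      ultimately have "var 1 * subst z (e j l) = (\<Sum>h\<in>{j..r}. var h * subst z (w h)) +
          (\<Sum>i\<in>{j..r}. \<Sum>l\<in>{1..m i}. c i l * subst z (e i l))"
        using arg_cong[OF wv(2), of "subst z"] by (simp only: const.poly_eval_add)
      with c(1) show ?thesis
        by (intro exI[of _ "\<lambda>h. subst z (w h)"] exI[of _ c] conjI)
    qed
  qed
qed

section \<open>Pencils of linear maps\<close>

context vector_space
begin

lemma eigenvectors_independent:
  assumes T: "Vector_Spaces.linear scale scale T" and "finite S"
    and v: "\<And>t. t \<in> S \<Longrightarrow> v t \<noteq> 0 \<and> T (v t) = t *s v t"
    and eq: "(\<Sum>t\<in>S. a t *s v t) = 0" and t: "t \<in> S"
  shows "a t = 0"
  using \<open>finite S\<close> v eq t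
proof (induction S arbitrary: a t rule: finite_induct)
  case (insert u S)
  interpret T: Vector_Spaces.linear scale scale T
    by (rule T)
  have sum0: "a u *s v u + (\<Sum>t\<in>S. a t *s v t) = 0"
    using insert by simp
  then have "T (a u *s v u + (\<Sum>t\<in>S. a t *s v t)) = 0"
    by (simp add: T.zero)
  then have "a u *s (u *s v u) + (\<Sum>t\<in>S. a t *s (t *s v t)) = 0"
    using insert.prems(1) by (simp add: T.add T.sum T.scale)
  moreover have "u *s (a u *s v u + (\<Sum>t\<in>S. a t *s v t)) = 0"
    by (simp add: sum0)
  ultimately have "(\<Sum>t\<in>S. a t *s (t *s v t)) - (\<Sum>t\<in>S. u *s (a t *s v t)) = 0"
    by (simp add: scale_right_distrib scale_sum_right mult.commute[of u] add_eq_0_iff)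
  moreover have "(\<Sum>t\<in>S. (a t * (t - u)) *s v t)
      = (\<Sum>t\<in>S. a t *s (t *s v t)) - (\<Sum>t\<in>S. u *s (a t *s v t))"
    unfolding sum_subtractf[symmetric]
    by (intro sum.cong refl) (simp add: scale_left_diff_distrib right_diff_distrib mult.commute)
  ultimately have "(\<Sum>t\<in>S. (a t * (t - u)) *s v t) = 0"
    by simp
  then have "a t * (t - u) = 0" if "t \<in> S" for t
    using insert.IH[of "\<lambda>t. a t * (t - u)"] insert.prems(1) that by blast
  then have S: "a t = 0" if "t \<in> S" for t
    using that insert.hyps(2) by force
  then have "a u *s v u = 0"
    using sum0 by simp
  then have "a u = 0"
    using insert.prems(1)[of u] by simp
  then show ?case
    using S insert.prems(3) by blast
qed simp

lemma finite_eigenvalues: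
  assumes T: "Vector_Spaces.linear scale scale T" and B: "finite B"
  shows "finite {t. \<exists>v\<in>span B. v \<noteq> 0 \<and> T v = t *s v}"
proof (rule ccontr)
  assume "infinite {t. \<exists>v\<in>span B. v \<noteq> 0 \<and> T v = t *s v}"
  then obtain S where S: "finite S" "card S = Suc (card B)"
    "S \<subseteq> {t. \<exists>v\<in>span B. v \<noteq> 0 \<and> T v = t *s v}"
    by (meson infinite_arbitrarily_large)
  then have "\<forall>t\<in>S. \<exists>v. v \<in> span B \<and> v \<noteq> 0 \<and> T v = t *s v"
    by blast
  from bchoice[OF this] obtain v
    where "\<forall>t\<in>S. v t \<in> span B \<and> v t \<noteq> 0 \<and> T (v t) = t *s v t" ..
  then have v: "\<And>t. t \<in> S \<Longrightarrow> v t \<in> span B" "\<And>t. t \<in> S \<Longrightarrow> v t \<noteq> 0 \<and> T (v t) = t *s v t"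
    by blast+
  have inj: "inj_on v S"
  proof (rule inj_onI)
    fix s t assume "s \<in> S" "t \<in> S" "v s = v t"
    then have "s *s v s = t *s v s" "v s \<noteq> 0"
      using v(2) by metis+
    then show "s = t"
      by simp
  qed
  have "independent (v ` S)"
  proof (rule independent_if_scalars_zero)
    fix f u assume f: "(\<Sum>u\<in>v ` S. f u *s u) = 0" and u: "u \<in> v ` S"
    obtain t where t: "t \<in> S" "u = v t"
      using u by blast
    have "(\<Sum>t\<in>S. f (v t) *s v t) = 0"
      using f by (simp add: sum.reindex[OF inj])
    then show "f u = 0"
      using eigenvectors_independent[OF T S(1) v(2), of "\<lambda>t. f (v t)" t] t by simp
  qed (simp add: S(1))
  then have "card (v ` S) \<le> card B"
    using independent_span_bound[OF B] v(1) by blast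
  then show False
    using card_image[OF inj] S(2) by simp
qed

lemma injective_imp_surjective_on_span:
  assumes T: "Vector_Spaces.linear scale scale T" and B: "finite B"
    and sub: "T ` span B \<subseteq> span B" and inj: "inj_on T (span B)"
  shows "T ` span B = span B"
proof
  interpret T: Vector_Spaces.linear scale scale T
    by (rule T)
  obtain C where C: "C \<subseteq> B" "independent C" "span C = span B"
    using maximal_independent_subset[of B] span_minimal span_superset
    by (metis span_eq span_mono subset_trans order.refl subspace_span)
  have finC: "finite C"
    using C(1) B finite_subset by blast
  have "independent (T ` C)"
    using T.independent_inj_on_image[OF C(2)] inj C(3) by simp
  have card: "card (T ` C) = card C"
    using inj C(3) span_superset by (intro card_image) (metis inj_on_subset)
  show "span B \<subseteq> T ` span B"
  proof (rule ccontr)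
    assume "\<not> span B \<subseteq> T ` span B"
    then obtain w where w: "w \<in> span B" "w \<notin> T ` span B"
      by blast
    then have "w \<notin> span (T ` C)"
      using T.span_image[of C] C(3) by simp
    then have "w \<notin> T ` C"
      using span_base by blast
    moreover have "independent (insert w (T ` C))"
      by (rule independent_insertI) fact+
    moreover have "insert w (T ` C) \<subseteq> span C"
      using w(1) sub C(3) span_superset by blast
    ultimately have "card (insert w (T ` C)) \<le> card C"
      using independent_span_bound[OF finC] by blast
    with \<open>w \<notin> T ` C\<close> show False
      using finC card by simp
  qed
qed (rule sub)

text \<open>With a left inverse \<open>g\<close> of \<open>S\<close>, a vector in the kernel of \<open>T + t S\<close> is an eigenvector of
  \<open>g T\<close> for the eigenvalue \<open>- t\<close>.\<close>

lemma finite_noninjective_pencil: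
  assumes S: "Vector_Spaces.linear scale scale S" and T: "Vector_Spaces.linear scale scale T"
    and B: "finite B" and inj: "inj_on S (span B)"
  shows "finite {t. \<not> inj_on (\<lambda>v. T v + t *s S v) (span B)}"
proof -
  interpret vector_space_pair scale scale
    by unfold_locales
  interpret S: Vector_Spaces.linear scale scale S
    by (rule S)
  interpret T: Vector_Spaces.linear scale scale T
    by (rule T)
  obtain g where g: "Vector_Spaces.linear scale scale g" "\<forall>v\<in>span B. g (S v) = v"
    using linear_exists_left_inverse_on[OF S subspace_span inj] by blast
  interpret g: Vector_Spaces.linear scale scale g
    by (rule g(1))
  let ?E = "{t. \<exists>v\<in>span B. v \<noteq> 0 \<and> (g \<circ> T) v = t *s v}"
  have fin: "finite ?E"
    by (intro finite_eigenvalues B Vector_Spaces.linear_compose[OF T g(1)])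
  have eigen: "- t \<in> ?E" if t: "\<not> inj_on (\<lambda>v. T v + t *s S v) (span B)" for t
  proof -
    obtain v w where vw: "v \<in> span B" "w \<in> span B" "v \<noteq> w" "T v + t *s S v = T w + t *s S w"
      using t unfolding inj_on_def by blast
    let ?u = "v - w"
    have u: "?u \<in> span B" "?u \<noteq> 0"
      using vw span_diff by auto
    have "T ?u + t *s S ?u = 0"
      using vw(4) by (simp add: T.diff S.diff scale_right_diff_distrib algebra_simps)
    then have "g (T ?u + t *s S ?u) = 0"
      by (simp add: g.zero)
    then have "g (T ?u) = - t *s ?u"
      using g(2) u(1) by (simp add: g.add g.scale add_eq_0_iff)
    then show ?thesis
      using u by (auto intro!: bexI[of _ ?u])
  qed
  have "{t. \<not> inj_on (\<lambda>v. T v + t *s S v) (span B)} \<subseteq> uminus ` ?E"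
  proof
    fix t assume "t \<in> {t. \<not> inj_on (\<lambda>v. T v + t *s S v) (span B)}"
    then have "- t \<in> ?E"
      using eigen by blast
    then show "t \<in> uminus ` ?E"
      by (rule rev_image_eqI) simp
  qed
  then show ?thesis
    using finite_imageI[OF fin] by (rule finite_subset)
qed

text \<open>With a right inverse \<open>h\<close> of \<open>S\<close>, the composition of \<open>T + t S\<close> with \<open>h\<close> is \<open>T h + t\<close>. It is an
  injective, hence surjective, endomorphism of the target unless \<open>- t\<close> is an eigenvalue of \<open>T h\<close>.\<close>

lemma finite_nonsurjective_pencil:
  assumes S: "Vector_Spaces.linear scale scale S" and T: "Vector_Spaces.linear scale scale T"
    and C: "finite C" and surj: "S ` span B = span C" and sub: "T ` span B \<subseteq> span C"
  shows "finite {t. (\<lambda>v. T v + t *s S v) ` span B \<noteq> span C}"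
proof -
  interpret vector_space_pair scale scale
    by unfold_locales
  interpret S: Vector_Spaces.linear scale scale S
    by (rule S)
  interpret T: Vector_Spaces.linear scale scale T
    by (rule T)
  obtain h where h: "range h \<subseteq> span B" "Vector_Spaces.linear scale scale h" "\<forall>w\<in>S ` span B. S (h w) = w"
    using linear_exists_right_inverse_on[OF S subspace_span] by blast
  have Sh: "S (h w) = w" if "w \<in> span C" for w
    using h(3) surj that by simp
  let ?E = "{t. \<exists>v\<in>span C. v \<noteq> 0 \<and> (T \<circ> h) v = t *s v}"
  have fin: "finite ?E"
    by (intro finite_eigenvalues C Vector_Spaces.linear_compose[OF h(2) T])
  have eigen: "- t \<in> ?E" if t: "(\<lambda>v. T v + t *s S v) ` span B \<noteq> span C" for t
  proof (rule ccontr)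
    assume E: "- t \<notin> ?E"
    let ?F = "\<lambda>w. T (h w) + t *s w"
    have F: "Vector_Spaces.linear scale scale ?F"
      using linear_compose_add[OF Vector_Spaces.linear_compose[OF h(2) T] linear_scale_self[of t]]
      by (simp add: o_def)
    interpret F: Vector_Spaces.linear scale scale ?F
      by (rule F)
    have "inj_on ?F (span C)"
    proof (rule inj_onI)
      fix v w assume vw: "v \<in> span C" "w \<in> span C" "?F v = ?F w"
      then have "?F (v - w) = 0"
        unfolding F.diff by simp
      then have "(T \<circ> h) (v - w) = - t *s (v - w)"
        by (simp add: add_eq_0_iff2)
      then show "v = w"
        using E vw span_diff[of v C w] by auto
    qed
    moreover have Th: "T (h w) \<in> span C" for w
      using h(1) sub by blast
    then have "?F ` span C \<subseteq> span C"
      by (auto intro!: span_add span_scale)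
    ultimately have "?F ` span C = span C"
      by (intro injective_imp_surjective_on_span F C)
    have "span C \<subseteq> (\<lambda>v. T v + t *s S v) ` span B"
    proof
      fix w assume "w \<in> span C"
      then obtain u where u: "u \<in> span C" "w = T (h u) + t *s u"
        using \<open>?F ` span C = span C\<close> by blast
      then have "w = T (h u) + t *s S (h u)"
        using Sh by simp
      then show "w \<in> (\<lambda>v. T v + t *s S v) ` span B"
        using h(1) by blast
    qed
    moreover have "(\<lambda>v. T v + t *s S v) ` span B \<subseteq> span C"
      using surj sub by (auto intro!: span_add span_scale)
    ultimately show False
      using t by blast
  qed
  have "{t. (\<lambda>v. T v + t *s S v) ` span B \<noteq> span C} \<subseteq> uminus ` ?E"
  proof
    fix t assume "t \<in> {t. (\<lambda>v. T v + t *s S v) ` span B \<noteq> span C}"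
    then have "- t \<in> ?E"
      using eigen by blast
    then show "t \<in> uminus ` ?E"
      by (rule rev_image_eqI) simp
  qed
  then show ?thesis
    using finite_imageI[OF fin] by (rule finite_subset)
qed

end

section \<open>Multiplication by a linear form modulo an ideal\<close>

text \<open>Injectivity and surjectivity of \<open>\<times> l : [R/I]\<^sub>d \<rightarrow> [R/I]\<^sub>d\<^sub>+\<^sub>1\<close>, expressed on representatives.\<close>

definition injective_mod ::
    "nat \<Rightarrow> (nat, 'k::field) mpoly set \<Rightarrow> int \<Rightarrow> (nat, 'k) mpoly \<Rightarrow> bool" where
  "injective_mod r I d l \<longleftrightarrow> (\<forall>f\<in>homog_part {1..r} d. l * f \<in> I \<longrightarrow> f \<in> I)"

definition surjective_mod ::
    "nat \<Rightarrow> (nat, 'k::field) mpoly set \<Rightarrow> int \<Rightarrow> (nat, 'k) mpoly \<Rightarrow> bool" where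
  "surjective_mod r I d l \<longleftrightarrow>
     (\<forall>q\<in>homog_part {1..r} (d + 1). \<exists>f\<in>homog_part {1..r} d. q - l * f \<in> I)"

lemma finite_terms_of_degree:
  "finite {t :: nat \<Rightarrow>\<^sub>0 nat. Poly_Mapping.keys t \<subseteq> {1..r} \<and> int (total_deg t) = d}"
proof (rule finite_imageD)
  let ?K = "{t :: nat \<Rightarrow>\<^sub>0 nat. Poly_Mapping.keys t \<subseteq> {1..r} \<and> int (total_deg t) = d}"
  let ?F = "{f. \<forall>v. (v \<in> {1..r} \<longrightarrow> f v \<in> {0..nat d}) \<and> (v \<notin> {1..r} \<longrightarrow> f v = 0)}"
  have "Poly_Mapping.lookup t \<in> ?F" if t: "t \<in> ?K" for t
  proof -
    have "nat d = total_deg t"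
      using t by auto
    also have "\<dots> = (\<Sum>v\<in>{1..r}. Poly_Mapping.lookup t v)"
      using t by (intro total_deg_superset) auto
    finally have "Poly_Mapping.lookup t v \<le> nat d" if "v \<in> {1..r}" for v
      using that member_le_sum[of v "{1..r}" "Poly_Mapping.lookup t"] by simp
    moreover have "Poly_Mapping.lookup t v = 0" if "v \<notin> {1..r}" for v
      using t that by (auto simp: in_keys_iff)
    ultimately show ?thesis
      by auto
  qed
  then have "Poly_Mapping.lookup ` ?K \<subseteq> ?F"
    by (rule image_subsetI)
  moreover have "finite ?F"
    by (rule finite_set_of_finite_funs) auto
  ultimately show "finite (Poly_Mapping.lookup ` ?K)"
    by (rule finite_subset)
  show "inj_on Poly_Mapping.lookup ?K"
    by (rule inj_onI) (rule poly_mapping_eqI, simp)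
qed

lemma scale_single: "scale c (Poly_Mapping.single t b) = Poly_Mapping.single t (c * b)"
  by (simp add: scale_def mult_single)

lemma subspace_homog_part: "coeffs.subspace (homog_part V d :: ('v, 'k::field) mpoly set)"
proof (rule coeffs.subspaceI)
  fix c :: 'k and p :: "('v, 'k) mpoly" assume "p \<in> homog_part V d"
  then show "scale c p \<in> homog_part V d"
    using homog_part_mult[OF homog_part_const[of c V], of p d] by (simp add: scale_def)
qed (auto simp: homog_part_add)

lemma homog_part_finite_span:
  obtains B :: "(nat, 'k::field) mpoly set"
  where "finite B" "coeffs.span B = homog_part {1..r} d"
proof
  let ?K = "{t :: nat \<Rightarrow>\<^sub>0 nat. Poly_Mapping.keys t \<subseteq> {1..r} \<and> int (total_deg t) = d}"
  let ?B = "(\<lambda>t. Poly_Mapping.single t (1::'k)) ` ?K"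
  show "finite ?B"
    using finite_terms_of_degree by (rule finite_imageI)
  show "coeffs.span ?B = homog_part {1..r} d"
  proof
    show "coeffs.span ?B \<subseteq> homog_part {1..r} d"
      by (rule coeffs.span_minimal[OF _ subspace_homog_part])
        (auto simp: homog_part_def polys_in_def)
    show "homog_part {1..r} d \<subseteq> coeffs.span ?B"
    proof
      fix p :: "(nat, 'k) mpoly" assume p: "p \<in> homog_part {1..r} d"
      have "Poly_Mapping.single t (Poly_Mapping.lookup p t) \<in> coeffs.span ?B"
        if "t \<in> Poly_Mapping.keys p" for t
      proof -
        have "Poly_Mapping.single t (1::'k) \<in> ?B"
          using p that unfolding homog_part_def polys_in_def by blast
        then have "scale (Poly_Mapping.lookup p t) (Poly_Mapping.single t 1) \<in> coeffs.span ?B"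
          by (intro coeffs.span_scale coeffs.span_base)
        then show ?thesis
          by (simp add: scale_single)
      qed
      then show "p \<in> coeffs.span ?B"
        by (subst sum_of_terms) (rule coeffs.span_sum)
    qed
  qed
qed

abbreviation linear_map :: "(('v, 'k::field) mpoly \<Rightarrow> ('w, 'k) mpoly) \<Rightarrow> bool" where
  "linear_map \<equiv> Vector_Spaces.linear scale scale"

lemma linear_map_mult: "linear_map (\<lambda>p. l * p)"
  by unfold_locales (simp_all add: scale_def algebra_simps)

context artinian_graded_ideal
begin

lemma scale_mem: "p \<in> J \<Longrightarrow> scale c p \<in> J"
  unfolding scale_def by (rule J_mult[OF homog_part_polys_in[OF homog_part_const]])

text \<open>The map \<open>\<pi>\<close> realises the quotient by \<open>J\<close> as a space of polynomials, to which the results on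
  pencils of linear maps apply.\<close>

lemma linear_normal_form:
  "\<exists>\<pi>. linear_map \<pi> \<and> (\<forall>p. p - \<pi> p \<in> J) \<and> (\<forall>p. \<pi> p = 0 \<longleftrightarrow> p \<in> J)"
proof -
  interpret vector_space_pair "scale :: 'k \<Rightarrow> (nat, 'k) mpoly \<Rightarrow> _" "scale :: 'k \<Rightarrow> (nat, 'k) mpoly \<Rightarrow> _"
    by unfold_locales
  have "coeffs.subspace J"
    by (rule coeffs.subspaceI) (auto simp: J_zero J_add scale_mem)
  then obtain g where g: "range g \<subseteq> J" "linear_map g" "\<forall>p\<in>J. g (id p) = p"
    using linear_exists_left_inverse_on[OF coeffs.linear_id, of J] by auto
  show ?thesis
  proof (intro exI[of _ "\<lambda>p. p - g p"] conjI allI)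
    show "linear_map (\<lambda>p. p - g p)"
      by (rule linear_compose_sub[OF coeffs.linear_ident g(2)])
    show "p - (p - g p) \<in> J" for p
      using g(1) by auto
    show "p - g p = 0 \<longleftrightarrow> p \<in> J" for p
      using g(1,3) by auto
  qed
qed

lemma finite_noninjective_mod:
  assumes l: "l \<in> polys_in {1..s}" "h \<in> polys_in {1..s}" and inj: "injective_mod s J d l"
  shows "finite {t. \<not> injective_mod s J d (h + scale t l)}"
proof -
  obtain \<pi> where "linear_map \<pi> \<and> (\<forall>p. p - \<pi> p \<in> J) \<and> (\<forall>p. \<pi> p = 0 \<longleftrightarrow> p \<in> J)"
    using linear_normal_form ..
  then have pi: "linear_map \<pi>" "\<And>p. p - \<pi> p \<in> J" "\<And>p. \<pi> p = 0 \<longleftrightarrow> p \<in> J"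
    by simp_all
  interpret pi: Vector_Spaces.linear scale scale \<pi>
    by (rule pi(1))
  obtain B :: "(nat, 'k) mpoly set" where B: "finite B" "coeffs.span B = homog_part {1..s} d"
    by (rule homog_part_finite_span)
  have span: "coeffs.span (\<pi> ` B) = \<pi> ` homog_part {1..s} d"
    using pi.span_image[of B] B(2) by simp
  have absorb: "\<pi> (k * \<pi> f) = \<pi> (k * f)" if "k \<in> polys_in {1..s}" for k f
  proof -
    have "k * (f - \<pi> f) \<in> J"
      by (rule J_mult[OF that pi(2)])
    then have "\<pi> (k * f - k * \<pi> f) = 0"
      by (simp add: pi(3) algebra_simps)
    then show ?thesis
      by (simp add: pi.diff)
  qed
  let ?S = "\<lambda>p. \<pi> (l * p)" and ?T = "\<lambda>p. \<pi> (h * p)"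
  have lin: "linear_map ?S" "linear_map ?T"
    using Vector_Spaces.linear_compose[OF linear_map_mult pi(1)] by (auto simp: o_def)
  have "inj_on ?S (coeffs.span (\<pi> ` B))"
  proof (rule inj_onI)
    fix u v assume "u \<in> coeffs.span (\<pi> ` B)" "v \<in> coeffs.span (\<pi> ` B)" and eq: "?S u = ?S v"
    then obtain f g where fg: "f \<in> homog_part {1..s} d" "g \<in> homog_part {1..s} d" "u = \<pi> f" "v = \<pi> g"
      unfolding span by blast
    then have "\<pi> (l * (f - g)) = 0"
      using eq by (simp add: absorb[OF l(1)] right_diff_distrib pi.diff)
    then have "f - g \<in> J"
      using inj homog_part_diff[OF fg(1,2)] by (simp add: pi(3) injective_mod_def)
    then show "u = v"
      using pi(3)[of "f - g"] fg by (simp add: pi.diff)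
  qed
  then have "finite {t. \<not> inj_on (\<lambda>p. ?T p + scale t (?S p)) (coeffs.span (\<pi> ` B))}"
    using lin B(1) by (intro coeffs.finite_noninjective_pencil finite_imageI)
  moreover have "injective_mod s J d (h + scale t l)"
    if t: "inj_on (\<lambda>p. ?T p + scale t (?S p)) (coeffs.span (\<pi> ` B))" for t
    unfolding injective_mod_def
  proof (intro ballI impI)
    fix f assume f: "f \<in> homog_part {1..s} d" and mem: "(h + scale t l) * f \<in> J"
    have "?T (\<pi> f) + scale t (?S (\<pi> f)) = \<pi> ((h + scale t l) * f)"
    proof -
      have "(h + scale t l) * f = h * f + scale t (l * f)"
        by (simp add: scale_def algebra_simps)
      then show ?thesis
        by (simp only: absorb[OF l(1)] absorb[OF l(2)] pi.add pi.scale)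
    qed
    also have "\<dots> = 0"
      using mem by (simp add: pi(3))
    finally have "?T (\<pi> f) + scale t (?S (\<pi> f)) = ?T 0 + scale t (?S 0)"
      by (simp add: pi.zero)
    moreover have "\<pi> f \<in> coeffs.span (\<pi> ` B)"
      unfolding span by (rule imageI[OF f])
    ultimately have "\<pi> f = 0"
      by (rule inj_onD[OF t _ _ coeffs.span_zero])
    then show "f \<in> J"
      by (simp add: pi(3))
  qed
  then have "{t. \<not> injective_mod s J d (h + scale t l)}
      \<subseteq> {t. \<not> inj_on (\<lambda>p. ?T p + scale t (?S p)) (coeffs.span (\<pi> ` B))}"
    by blast
  ultimately show ?thesis
    using finite_subset by blast
qed

lemma finite_nonsurjective_mod:
  assumes l: "l \<in> homog_part {1..s} 1" "h \<in> homog_part {1..s} 1" and surj: "surjective_mod s J d l"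
  shows "finite {t. \<not> surjective_mod s J d (h + scale t l)}"
proof -
  obtain \<pi> where "linear_map \<pi> \<and> (\<forall>p. p - \<pi> p \<in> J) \<and> (\<forall>p. \<pi> p = 0 \<longleftrightarrow> p \<in> J)"
    using linear_normal_form ..
  then have pi: "linear_map \<pi>" "\<And>p. p - \<pi> p \<in> J" "\<And>p. \<pi> p = 0 \<longleftrightarrow> p \<in> J"
    by simp_all
  interpret pi: Vector_Spaces.linear scale scale \<pi>
    by (rule pi(1))
  obtain B :: "(nat, 'k) mpoly set" where B: "finite B" "coeffs.span B = homog_part {1..s} d"
    by (rule homog_part_finite_span)
  obtain C :: "(nat, 'k) mpoly set" where C: "finite C" "coeffs.span C = homog_part {1..s} (d + 1)"
    by (rule homog_part_finite_span)
  have span: "coeffs.span (\<pi> ` B) = \<pi> ` homog_part {1..s} d"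
    "coeffs.span (\<pi> ` C) = \<pi> ` homog_part {1..s} (d + 1)"
    using pi.span_image[of B] B(2) pi.span_image[of C] C(2) by simp_all
  have absorb: "\<pi> (k * \<pi> f) = \<pi> (k * f)" if "k \<in> homog_part {1..s} 1" for k f
  proof -
    have "k * (f - \<pi> f) \<in> J"
      by (rule J_mult[OF homog_part_polys_in[OF that] pi(2)])
    then have "\<pi> (k * f - k * \<pi> f) = 0"
      by (simp add: pi(3) algebra_simps)
    then show ?thesis
      by (simp add: pi.diff)
  qed
  let ?S = "\<lambda>p. \<pi> (l * p)" and ?T = "\<lambda>p. \<pi> (h * p)"
  have lin: "linear_map ?S" "linear_map ?T"
    using Vector_Spaces.linear_compose[OF linear_map_mult pi(1)] by (auto simp: o_def)
  have sub: "(\<lambda>p. \<pi> (k * p)) ` coeffs.span (\<pi> ` B) \<subseteq> coeffs.span (\<pi> ` C)"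
    if k: "k \<in> homog_part {1..s} 1" for k
    unfolding span
  proof clarify
    fix f :: "(nat, 'k) mpoly" assume f: "f \<in> homog_part {1..s} d"
    have "k * f \<in> homog_part {1..s} (d + 1)"
      using homog_part_mult[OF k f] by (simp add: add.commute)
    then show "\<pi> (k * \<pi> f) \<in> \<pi> ` homog_part {1..s} (d + 1)"
      unfolding absorb[OF k] by (rule imageI)
  qed
  have "?S ` coeffs.span (\<pi> ` B) = coeffs.span (\<pi> ` C)"
  proof (rule equalityI[OF sub[OF l(1)]], rule subsetI)
    fix u assume "u \<in> coeffs.span (\<pi> ` C)"
    then obtain q where q: "q \<in> homog_part {1..s} (d + 1)" "u = \<pi> q"
      unfolding span by blast
    obtain f where f: "f \<in> homog_part {1..s} d" "q - l * f \<in> J"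
      using surj q(1) unfolding surjective_mod_def by blast
    have "u = \<pi> (l * \<pi> f)"
      using f(2) q(2) pi(3)[of "q - l * f"] by (simp add: absorb[OF l(1)] pi.diff)
    then show "u \<in> ?S ` coeffs.span (\<pi> ` B)"
      unfolding span using f(1) by blast
  qed
  then have "finite {t. (\<lambda>p. ?T p + scale t (?S p)) ` coeffs.span (\<pi> ` B) \<noteq> coeffs.span (\<pi> ` C)}"
    using lin C(1) sub[OF l(2)] by (intro coeffs.finite_nonsurjective_pencil finite_imageI)
  moreover have "surjective_mod s J d (h + scale t l)"
    if t: "(\<lambda>p. ?T p + scale t (?S p)) ` coeffs.span (\<pi> ` B) = coeffs.span (\<pi> ` C)" for t
    unfolding surjective_mod_def
  proof
    fix q :: "(nat, 'k) mpoly" assume q: "q \<in> homog_part {1..s} (d + 1)"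
    then have "\<pi> q \<in> (\<lambda>p. ?T p + scale t (?S p)) ` coeffs.span (\<pi> ` B)"
      unfolding t span(2) by (rule imageI)
    then obtain f where f: "f \<in> homog_part {1..s} d" "\<pi> q = ?T (\<pi> f) + scale t (?S (\<pi> f))"
      unfolding span by blast
    have "?T (\<pi> f) + scale t (?S (\<pi> f)) = \<pi> ((h + scale t l) * f)"
    proof -
      have "(h + scale t l) * f = h * f + scale t (l * f)"
        by (simp add: scale_def algebra_simps)
      then show ?thesis
        by (simp only: absorb[OF l(1)] absorb[OF l(2)] pi.add pi.scale)
    qed
    then have "q - (h + scale t l) * f \<in> J"
      using f(2) pi(3)[of "q - (h + scale t l) * f"] by (simp add: pi.diff)
    then show "\<exists>f\<in>homog_part {1..s} d. q - (h + scale t l) * f \<in> J"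
      using f(1) by blast
  qed
  then have "{t. \<not> surjective_mod s J d (h + scale t l)}
      \<subseteq> {t. (\<lambda>p. ?T p + scale t (?S p)) ` coeffs.span (\<pi> ` B) \<noteq> coeffs.span (\<pi> ` C)}"
    by blast
  ultimately show ?thesis
    using finite_subset by blast
qed

end


section \<open>General bases\<close>

lemma linear_basisI:
  fixes x :: "nat \<Rightarrow> (nat, 'k::field) mpoly"
  assumes x: "\<And>i. i \<in> {1..r} \<Longrightarrow> x i \<in> homog_part {1..r} 1"
    and unique: "\<And>c i. (\<Sum>i\<in>{1..r}. const (c i) * x i) = 0 \<Longrightarrow> i \<in> {1..r} \<Longrightarrow> c i = 0"
    and expand: "\<And>p. p \<in> homog_part {1..r} 1 \<Longrightarrow> \<exists>c. p = (\<Sum>i\<in>{1..r}. const (c i) * x i)"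
  shows "linear_basis r x"
proof -
  have inj: "inj_on x {1..r}"
  proof (rule inj_onI, rule ccontr)
    fix i j assume ij: "i \<in> {1..r}" "j \<in> {1..r}" "x i = x j" "i \<noteq> j"
    let ?c = "\<lambda>k. if k = i then 1 else if k = j then - 1 else (0::'k)"
    have "(\<Sum>k\<in>{1..r}. const (?c k) * x k) = (\<Sum>k\<in>{i, j}. const (?c k) * x k)"
      using ij by (intro sum.mono_neutral_right) auto
    also have "\<dots> = 0"
      using ij by (simp add: single_uminus)
    finally have "?c i = 0"
      using ij(1) by (rule unique)
    then show False
      by simp
  qed
  have "coeffs.independent (x ` {1..r})"
  proof (rule coeffs.independent_if_scalars_zero)
    fix f v assume f: "(\<Sum>v\<in>x ` {1..r}. scale (f v) v) = 0" and v: "v \<in> x ` {1..r}"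
    obtain i where i: "i \<in> {1..r}" "v = x i"
      using v by blast
    have "(\<Sum>i\<in>{1..r}. const (f (x i)) * x i) = 0"
      using f by (simp add: sum.reindex[OF inj] scale_def del: One_nat_def)
    from unique[OF this i(1)] show "f v = 0"
      by (simp add: i(2))
  qed simp
  moreover have "coeffs.span (x ` {1..r}) = homog_part {1..r} 1"
  proof
    show "coeffs.span (x ` {1..r}) \<subseteq> homog_part {1..r} 1"
      using x by (intro coeffs.span_minimal subspace_homog_part) (rule image_subsetI)
    show "homog_part {1..r} 1 \<subseteq> coeffs.span (x ` {1..r})"
    proof
      fix p :: "(nat, 'k) mpoly" assume "p \<in> homog_part {1..r} 1"
      then obtain c where "p = (\<Sum>i\<in>{1..r}. const (c i) * x i)"
        using expand by blast
      then show "p \<in> coeffs.span (x ` {1..r})"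
        unfolding scale_def[symmetric]
        by (simp only:) (intro coeffs.span_sum coeffs.span_scale coeffs.span_base imageI)
    qed
  qed
  ultimately show ?thesis
    using inj by (simp add: linear_basis_def)
qed

text \<open>If \<open>l = \<Sum> c\<^sub>i x\<^sub>i\<close>, then \<open>x\<^sub>r + t l\<close> has the coefficient \<open>1 + t c\<^sub>r\<close> at \<open>x\<^sub>r\<close>, and the exchange of \<open>x\<^sub>r\<close>
  for it is invertible whenever this coefficient is nonzero.\<close>

lemma finite_bad_linear_bases:
  fixes x :: "nat \<Rightarrow> (nat, 'k::field) mpoly"
  assumes x: "linear_basis r x" and l: "l \<in> homog_part {1..r} 1" and r: "r \<ge> 1"
  shows "finite {t. \<not> linear_basis r (x(r := x r + scale t l))}"
proof -
  obtain c where c: "l = (\<Sum>i\<in>{1..r}. const (c i) * x i)"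
    by (rule linear_basis_expand[OF x l])
  have "linear_basis r (x(r := x r + scale t l))" if t: "1 + t * c r \<noteq> 0" for t
  proof (rule linear_basisI)
    let ?x = "x(r := x r + scale t l)"
    have comb: "(\<Sum>i\<in>{1..r}. const (a i) * ?x i) = (\<Sum>i\<in>{1..r}. const (a i + a r * t * c i) * x i)"
      for a
    proof -
      have "(\<Sum>i\<in>{1..r}. const (a i) * ?x i)
          = (\<Sum>i\<in>{1..r}. const (a i) * x i + (if i = r then const (a r) * scale t l else 0))"
        by (intro sum.cong refl) (auto simp: distrib_left)
      also have "\<dots> = (\<Sum>i\<in>{1..r}. const (a i) * x i) + const (a r) * scale t l"
        using r by (simp add: sum.distrib)
      also have "const (a r) * scale t l = (\<Sum>i\<in>{1..r}. const (a r * t * c i) * x i)"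
      proof -
        have "const (a r) * (const t * (const (c i) * x i)) = const (a r * t * c i) * x i" for i
          by (simp add: mult_single flip: mult.assoc)
        then show ?thesis
          unfolding c scale_def sum_distrib_left by (simp only:)
      qed
      finally show ?thesis
        by (simp add: sum.distrib single_add distrib_right)
    qed
    show "?x i \<in> homog_part {1..r} 1" if "i \<in> {1..r}" for i
      using linear_basis_homog[OF x] that l coeffs.subspace_scale[OF subspace_homog_part l]
      by (simp add: homog_part_add)
    show "a i = 0" if eq: "(\<Sum>i\<in>{1..r}. const (a i) * ?x i) = 0" and i: "i \<in> {1..r}" for a i
    proof -
      have zero: "a i + a r * t * c i = 0" if "i \<in> {1..r}" for i
        by (rule linear_basis_unique[OF x eq[unfolded comb] that])
      have "a r * (1 + t * c r) = 0"
        using zero[of r] r by (simp add: algebra_simps)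
      then show "a i = 0"
        using t zero[OF i] by simp
    qed
    show "\<exists>a. p = (\<Sum>i\<in>{1..r}. const (a i) * ?x i)" if p: "p \<in> homog_part {1..r} 1" for p
    proof -
      obtain b where b: "p = (\<Sum>i\<in>{1..r}. const (b i) * x i)"
        by (rule linear_basis_expand[OF x p])
      \<comment> \<open>The coefficient of the new last basis element; the other coefficients follow from it.\<close>
      define u where "u = b r / (1 + t * c r)"
      define a where "a i = b i - u * t * c i" for i
      have "b r = u * (1 + t * c r)"
        using t by (simp add: u_def)
      then have "a r = u"
        by (simp add: a_def algebra_simps)
      then have "(\<Sum>i\<in>{1..r}. const (a i) * ?x i) = p"
        unfolding comb b by (simp add: a_def)
      then show ?thesis
        by (intro exI[of _ a]) (rule sym)
    qed
  qed
  then have "{t. \<not> linear_basis r (x(r := x r + scale t l))} \<subseteq> {t. 1 + t * c r = 0}"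
    by blast
  moreover have "finite {t. 1 + t * c r = 0}"
  proof (rule finite_subset)
    show "{t. 1 + t * c r = 0} \<subseteq> {- 1 / c r}"
    proof
      fix t assume "t \<in> {t. 1 + t * c r = 0}"
      then have "t * c r = - 1"
        by (simp add: eq_neg_iff_add_eq_0 add.commute)
      moreover from this have "c r \<noteq> 0"
        by auto
      ultimately show "t \<in> {- 1 / c r}"
        by (metis nonzero_eq_divide_eq singleton_iff)
    qed
  qed simp
  ultimately show ?thesis
    by (rule finite_subset)
qed

lemma poly_poly_eval:
  "poly (poly_eval (\<lambda>c. [:c:]) u f) t = poly_eval id (\<lambda>v. poly (u v) t) f"
  by (simp add: poly_eval_def poly_sum poly_prod)

text \<open>A polynomial that does not vanish at \<open>x\<close> restricts to a nonzero polynomial in \<open>t\<close> on the line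
  \<open>x\<^sub>r + t l\<close>.\<close>

lemma finite_outside_zariski_open:
  fixes x :: "nat \<Rightarrow> (nat, 'k::field) mpoly"
  assumes U: "zariski_open_bases r U" and x: "x \<in> U" and l: "l \<in> homog_part {1..r} 1" and r: "r \<ge> 1"
  shows "finite {t. x(r := x r + scale t l) \<notin> U}"
proof -
  obtain F where U_eq: "U = {x. linear_basis r x \<and> (\<exists>f\<in>F. poly_eval id (basis_coord x) f \<noteq> 0)}"
    using U unfolding zariski_open_bases_def by blast
  obtain f where f: "f \<in> F" "poly_eval id (basis_coord x) f \<noteq> 0" and basis: "linear_basis r x"
    using x unfolding U_eq by blast
  define u where "u = (\<lambda>(i, j). [:basis_coord x (i, j),
    if i = r then Poly_Mapping.lookup l (Poly_Mapping.single j 1) else 0:])"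
  define q where "q = poly_eval (\<lambda>c. [:c:]) u f"
  have coord: "(\<lambda>v. poly (u v) t) = basis_coord (x(r := x r + scale t l))" for t
    by (rule ext) (auto simp: u_def basis_coord_def lookup_add scale_def
      mult_map_scale_conv_mult[symmetric] map.rep_eq when_def)
  have eval: "poly q t = poly_eval id (basis_coord (x(r := x r + scale t l))) f" for t
    unfolding q_def poly_poly_eval coord ..
  have "x(r := x r + scale 0 l) = x"
    by (simp add: scale_def)
  then have "poly q 0 \<noteq> 0"
    using f(2) eval[of 0] by simp
  then have "finite {t. poly q t = 0}"
    by (intro poly_roots_finite) auto
  moreover have "{t. x(r := x r + scale t l) \<notin> U}
      \<subseteq> {t. poly q t = 0} \<union> {t. \<not> linear_basis r (x(r := x r + scale t l))}"
    unfolding U_eq using f(1) by (auto simp: eval)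
  ultimately show ?thesis
    using finite_bad_linear_bases[OF basis l r] by (meson finite_Un finite_subset)
qed

section \<open>Rings of dimension zero\<close>

context cring
begin

lemma mem_add_cgenideal:
  assumes "ideal M R" "a \<in> carrier R"
  shows "x \<in> M <+>\<^bsub>R\<^esub> PIdl a \<longleftrightarrow> (\<exists>p\<in>M. \<exists>c\<in>carrier R. x = p \<oplus> c \<otimes> a)"
  unfolding set_add_def' cgenideal_def by blast

lemma ideal_add_cgenideal:
  assumes "ideal M R" "a \<in> carrier R"
  shows "ideal (M <+>\<^bsub>R\<^esub> PIdl a) R" "M \<subseteq> M <+>\<^bsub>R\<^esub> PIdl a" "a \<in> M <+>\<^bsub>R\<^esub> PIdl a"
proof -
  interpret M: ideal M R
    by (rule assms(1))
  show "ideal (M <+>\<^bsub>R\<^esub> PIdl a) R"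
    by (rule add_ideals[OF assms(1) cgenideal_ideal[OF assms(2)]])
  show "M \<subseteq> M <+>\<^bsub>R\<^esub> PIdl a"
  proof
    fix p assume p: "p \<in> M"
    then have "p = p \<oplus> \<zero> \<otimes> a"
      using assms(2) M.Icarr by simp
    then show "p \<in> M <+>\<^bsub>R\<^esub> PIdl a"
      unfolding mem_add_cgenideal[OF assms] using p by blast
  qed
  have "a = \<zero> \<oplus> \<one> \<otimes> a"
    using assms(2) by simp
  then show "a \<in> M <+>\<^bsub>R\<^esub> PIdl a"
    unfolding mem_add_cgenideal[OF assms] using M.zero_closed by blast
qed

text \<open>An ideal that is maximal among those avoiding \<open>S\<close> is prime: if it contained neither factor
  of a product that it contains, adding either factor would produce an element of \<open>S\<close>, and the
  product of these two elements of \<open>S\<close> would lie in the ideal.\<close>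

lemma exists_primeideal_avoiding:
  assumes J: "ideal J R" and S: "S \<subseteq> carrier R" "\<one> \<in> S" "\<And>a b. a \<in> S \<Longrightarrow> b \<in> S \<Longrightarrow> a \<otimes> b \<in> S"
    and disjoint: "J \<inter> S = {}"
  obtains P where "primeideal P R" "J \<subseteq> P" "P \<inter> S = {}"
proof -
  let ?F = "{I. ideal I R \<and> J \<subseteq> I \<and> I \<inter> S = {}}"
  have "\<exists>M\<in>?F. \<forall>X\<in>?F. M \<subseteq> X \<longrightarrow> X = M"
  proof (rule subset_Zorn_nonempty)
    show "?F \<noteq> {}"
      using J disjoint by blast
    fix C assume C: "C \<noteq> {}" "subset.chain ?F C"
    have sub: "C \<subseteq> ?F"
      using C(2) by (simp add: subset_chain_def)
    have "subset.chain {I. ideal I R} C"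
      using C(2) unfolding subset_chain_def by blast
    then have "ideal (\<Union>C) R"
      using chain_Union_is_ideal[of C] C(1) by simp
    then show "\<Union>C \<in> ?F"
      using sub C(1) by blast
  qed
  then obtain M where M_in: "M \<in> ?F" and M_max: "\<forall>X\<in>?F. M \<subseteq> X \<longrightarrow> X = M"
    by (elim bexE)
  have M: "ideal M R" "J \<subseteq> M" "M \<inter> S = {}"
    using M_in by simp_all
  have max: "X = M" if "ideal X R" "J \<subseteq> X" "X \<inter> S = {}" "M \<subseteq> X" for X
    using M_max that by simp
  interpret M: ideal M R
    by (rule M(1))
  have extend: "\<exists>s\<in>S. \<exists>p\<in>M. \<exists>c\<in>carrier R. s = p \<oplus> c \<otimes> a" if a: "a \<in> carrier R" "a \<notin> M" for a
  proof (rule ccontr)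
    assume "\<not> ?thesis"
    then have "(M <+>\<^bsub>R\<^esub> PIdl a) \<inter> S = {}"
      using mem_add_cgenideal[OF M(1) a(1)] by blast
    then have "M <+>\<^bsub>R\<^esub> PIdl a = M"
      using ideal_add_cgenideal[OF M(1) a(1)] M(2) by (intro max) auto
    then show False
      using ideal_add_cgenideal(3)[OF M(1) a(1)] a(2) by simp
  qed
  have "primeideal M R"
  proof (rule primeidealI[OF M(1) is_cring])
    show "carrier R \<noteq> M"
      using M(3) S(2) by blast
    fix a b assume ab: "a \<in> carrier R" "b \<in> carrier R" "a \<otimes> b \<in> M"
    show "a \<in> M \<or> b \<in> M"
    proof (rule ccontr)
      assume "\<not> (a \<in> M \<or> b \<in> M)"
      then obtain s p c s' p' c' where s: "s \<in> S" "p \<in> M" "c \<in> carrier R" "s = p \<oplus> c \<otimes> a"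
        and s': "s' \<in> S" "p' \<in> M" "c' \<in> carrier R" "s' = p' \<oplus> c' \<otimes> b"
        using extend[OF ab(1)] extend[OF ab(2)] by blast
      have carr: "p \<in> carrier R" "p' \<in> carrier R"
        using s(2) s'(2) M.Icarr by auto
      have "s \<otimes> s' = (s' \<otimes> p \<oplus> (c \<otimes> a) \<otimes> p') \<oplus> (c \<otimes> c') \<otimes> (a \<otimes> b)"
        unfolding s(4) s'(4) using carr ab(1,2) s(3) s'(3) by algebra
      also have "\<dots> \<in> M"
      proof (intro M.a_closed)
        show "s' \<otimes> p \<in> M"
          using s'(1) s(2) S(1) M.I_l_closed by blast
        show "(c \<otimes> a) \<otimes> p' \<in> M"
          using s(3) ab(1) s'(2) M.I_l_closed m_closed by blast
        show "(c \<otimes> c') \<otimes> (a \<otimes> b) \<in> M"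
          using s(3) s'(3) ab(3) M.I_l_closed m_closed by blast
      qed
      finally show False
        using S(3)[OF s(1) s'(1)] M(3) by blast
    qed
  qed
  then show ?thesis
    using M(2,3) by (rule that)
qed

text \<open>The elements \<open>x\<^sup>n (1 - x g)\<close> are closed under multiplication and include \<open>x\<close> and all \<open>1 - x g\<close>.
  If \<open>0\<close> were not among them, a prime ideal \<open>P\<close> avoiding them would not contain \<open>x\<close>, the ideal
  \<open>P + (x)\<close> would be proper, and \<open>P\<close> would begin a chain of two prime ideals.\<close>

lemma krull_dim_zero_power:
  assumes dim: "has_krull_dim R 0" and x: "x \<in> carrier R"
  obtains n :: nat and g where "g \<in> carrier R" "x [^] n \<otimes> (\<one> \<ominus> x \<otimes> g) = \<zero>"
proof (rule ccontr)
  assume none: "\<not> thesis"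
  define S where "S = {y. \<exists>(n::nat) g. g \<in> carrier R \<and> y = x [^] n \<otimes> (\<one> \<ominus> x \<otimes> g)}"
  have S_mem: "x [^] n \<otimes> (\<one> \<ominus> x \<otimes> g) \<in> S" if "g \<in> carrier R" for n :: nat and g
    unfolding S_def using that by blast
  have zero: "{\<zero>} \<inter> S = {}"
  proof -
    have "\<zero> \<notin> S"
    proof
      assume "\<zero> \<in> S"
      then obtain n :: nat and g where "g \<in> carrier R" "\<zero> = x [^] n \<otimes> (\<one> \<ominus> x \<otimes> g)"
        unfolding S_def by blast
      then have thesis
        using that[of g n] by simp
      then show False
        using none by contradiction
    qed
    then show ?thesis
      by simp
  qed
  have S_carrier: "S \<subseteq> carrier R"
    unfolding S_def using x by auto
  have "x [^] (0::nat) \<otimes> (\<one> \<ominus> x \<otimes> \<zero>) = \<one>"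
    using x by (simp add: minus_eq)
  then have S_one: "\<one> \<in> S"
    using S_mem[of \<zero> 0] by simp
  have S_mult: "a \<otimes> b \<in> S" if ab: "a \<in> S" "b \<in> S" for a b
  proof -
    obtain n g where a: "a = x [^] (n::nat) \<otimes> (\<one> \<ominus> x \<otimes> g)" "g \<in> carrier R"
      using ab(1) unfolding S_def by blast
    obtain k h where b: "b = x [^] (k::nat) \<otimes> (\<one> \<ominus> x \<otimes> h)" "h \<in> carrier R"
      using ab(2) unfolding S_def by blast
    have carr: "x [^] n \<in> carrier R" "x [^] k \<in> carrier R"
      using x by auto
    have "a \<otimes> b = (x [^] n \<otimes> x [^] k) \<otimes> (\<one> \<ominus> x \<otimes> (g \<oplus> h \<ominus> x \<otimes> (g \<otimes> h)))"
      unfolding a(1) b(1) using carr x a(2) b(2) by algebra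
    also have "x [^] n \<otimes> x [^] k = x [^] (n + k)"
      by (rule nat_pow_mult[OF x])
    finally show ?thesis
      using S_mem[of "g \<oplus> h \<ominus> x \<otimes> (g \<otimes> h)" "n + k"] x a(2) b(2) by simp
  qed
  obtain P where P: "primeideal P R" "P \<inter> S = {}"
    using exists_primeideal_avoiding[OF zeroideal S_carrier S_one S_mult zero] by blast
  interpret P: primeideal P R
    by (rule P(1))
  have "x [^] (1::nat) \<otimes> (\<one> \<ominus> x \<otimes> \<zero>) = x"
    using x by (simp add: minus_eq)
  then have "x \<in> S"
    using S_mem[of \<zero> 1] by simp
  then have x_P: "x \<notin> P"
    using P(2) by blast
  let ?Q = "P <+>\<^bsub>R\<^esub> PIdl x"
  have Q: "ideal ?Q R" "P \<subseteq> ?Q" "x \<in> ?Q"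
    using ideal_add_cgenideal[OF P.ideal_axioms x] by auto
  have "\<one> \<notin> ?Q"
  proof
    assume "\<one> \<in> ?Q"
    then obtain p c where pc: "p \<in> P" "c \<in> carrier R" "\<one> = p \<oplus> c \<otimes> x"
      using mem_add_cgenideal[OF P.ideal_axioms x] by blast
    have "p \<in> carrier R"
      using pc(1) P.Icarr by blast
    then have "p = \<one> \<ominus> x \<otimes> c"
      unfolding pc(3) using pc(2) x by algebra
    then have "p = x [^] (0::nat) \<otimes> (\<one> \<ominus> x \<otimes> c)"
      using pc(2) x by simp
    then have "p \<in> S"
      using S_mem[OF pc(2), of 0] by simp
    then show False
      using pc(1) P(2) by blast
  qed
  then obtain Q' where Q': "primeideal Q' R" "?Q \<subseteq> Q'"
    using exists_primeideal_avoiding[OF Q(1), of "{\<one>}"] by auto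
  have "prime_chain R (Suc 0) (\<lambda>i. if i = 0 then P else Q')"
    unfolding prime_chain_def using P(1) Q' Q(2,3) x_P by auto
  then show False
    using dim by (auto simp: has_krull_dim_def)
qed

end

section \<open>Artinian quotients of the polynomial ring\<close>

lemma poly_ring_simps:
  "carrier (poly_ring r) = polys_in {1..r}" "monoid.mult (poly_ring r) = (*)" "monoid.one (poly_ring r) = 1"
  "ring.zero (poly_ring r) = 0" "ring.add (poly_ring r) = (+)"
  by (simp_all add: poly_ring_def)

lemma poly_ring_uminus:
  assumes "p \<in> polys_in {1..r}"
  shows "\<ominus>\<^bsub>poly_ring r\<^esub> p = - (p :: (nat, 'k::field) mpoly)"
proof -
  interpret cring "poly_ring r :: (nat, 'k) mpoly ring"
    by (rule cring_poly_ring)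
  show ?thesis
    by (rule minus_equality) (use assms in \<open>auto simp: poly_ring_simps polys_in_uminus\<close>)
qed

lemma poly_ring_idealD:
  assumes "ideal I (poly_ring r)"
  shows "I \<subseteq> polys_in {1..r}" "0 \<in> I" "\<And>p q. p \<in> I \<Longrightarrow> q \<in> I \<Longrightarrow> p + q \<in> I"
    "\<And>p q. p \<in> polys_in {1..r} \<Longrightarrow> q \<in> I \<Longrightarrow> p * q \<in> I"
proof -
  interpret ideal I "poly_ring r"
    by (rule assms)
  show "I \<subseteq> polys_in {1..r}"
    using a_subset by (simp add: poly_ring_simps)
  show "0 \<in> I"
    using additive_subgroup.zero_closed[OF ideal.axioms(1)[OF assms]] by (simp add: poly_ring_simps)
  show "p + q \<in> I" if "p \<in> I" "q \<in> I" for p q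
    using additive_subgroup.a_closed[OF ideal.axioms(1)[OF assms] that] by (simp add: poly_ring_simps)
  show "p * q \<in> I" if "p \<in> polys_in {1..r}" "q \<in> I" for p q
    using I_l_closed[OF that(2), of p] that(1) by (simp add: poly_ring_simps)
qed

lemma poly_ring_idealI:
  fixes K :: "(nat, 'k::field) mpoly set"
  assumes "K \<subseteq> polys_in {1..r}" "0 \<in> K" "\<And>p q. p \<in> K \<Longrightarrow> q \<in> K \<Longrightarrow> p + q \<in> K"
    "\<And>p q. p \<in> polys_in {1..r} \<Longrightarrow> q \<in> K \<Longrightarrow> p * q \<in> K"
  shows "ideal K (poly_ring r)"
proof -
  interpret cring "poly_ring r :: (nat, 'k) mpoly ring"
    by (rule cring_poly_ring)
  have neg: "- p \<in> K" if "p \<in> K" for p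
    using assms(4)[OF polys_in_uminus[OF polys_in_1] that] by simp
  have mult_r: "q * p \<in> K" if "p \<in> polys_in {1..r}" "q \<in> K" for p q
    using assms(4)[OF that] by (simp add: mult.commute)
  show ?thesis
  proof (rule idealI[OF ring_axioms])
    show "subgroup K (add_monoid (poly_ring r))"
    proof (rule group.subgroupI[OF a_group])
      show "inv\<^bsub>add_monoid (poly_ring r)\<^esub> p \<in> K" if "p \<in> K" for p
        using poly_ring_uminus[of p r] neg[OF that] that assms(1) by (auto simp: a_inv_def)
    qed (use assms in \<open>auto simp: poly_ring_simps\<close>)
  qed (use assms(4) mult_r in \<open>auto simp: poly_ring_simps\<close>)
qed

text \<open>The polynomials all of whose components lie in \<open>I\<close> form an ideal that contains the
  homogeneous generators of \<open>I\<close>.\<close>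

lemma homogeneous_ideal_hcomp:
  fixes I :: "(nat, 'k::field) mpoly set"
  assumes I: "homogeneous_ideal r I" and p: "p \<in> I"
  shows "hcomp d p \<in> I"
proof -
  interpret cring "poly_ring r :: (nat, 'k) mpoly ring"
    by (rule cring_poly_ring)
  obtain H where id: "ideal I (poly_ring r)" and H: "H \<subseteq> (\<Union>d. homog_part {1..r} d)"
    and gen: "I = Idl\<^bsub>poly_ring r\<^esub> H"
    using I unfolding homogeneous_ideal_def by blast
  note I_props = poly_ring_idealD[OF id]
  have I_sum: "(\<Sum>i\<in>A. f i) \<in> I" if "\<And>i. i \<in> A \<Longrightarrow> f i \<in> I" for A and f :: "int \<Rightarrow> (nat, 'k) mpoly"
    using that by (induction A rule: infinite_finite_induct) (auto simp: I_props)
  define K where "K = {p \<in> polys_in {1..r}. \<forall>d. hcomp d p \<in> I}"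
  have "ideal K (poly_ring r)"
  proof (rule poly_ring_idealI)
    show "p + q \<in> K" if "p \<in> K" "q \<in> K" for p q
      using that by (simp add: K_def polys_in_add restrict_terms_add I_props)
    show "a * p \<in> K" if a: "a \<in> polys_in {1..r}" and p: "p \<in> K" for a p
    proof -
      obtain D where D: "finite D" "a = (\<Sum>c\<in>D. hcomp c a)"
        by (rule sum_hcomp[of a])
      have "hcomp d (a * p) \<in> I" for d
      proof -
        have "hcomp d (p * hcomp c a) \<in> I" for c
        proof -
          have "hcomp c a * hcomp (d - c) p \<in> I"
            using p by (intro I_props(4) restrict_terms_polys_in[OF a]) (auto simp: K_def)
          then show ?thesis
            using hcomp_mult[OF hcomp_homog[OF a], of d p c] by (simp add: mult.commute)
        qed
        moreover have "hcomp d (a * p) = (\<Sum>c\<in>D. hcomp d (p * hcomp c a))"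
          by (subst D(2)) (simp only: sum_distrib_left restrict_terms_sum mult.commute[of _ p])
        ultimately show ?thesis
          using I_sum by simp
      qed
      then show ?thesis
        using a p by (simp add: K_def polys_in_mult)
    qed
  qed (auto simp: K_def polys_in_0 I_props)
  moreover have "H \<subseteq> K"
  proof
    fix h assume h: "h \<in> H"
    obtain c where c: "h \<in> homog_part {1..r} c"
      using H h by blast
    have "h \<in> polys_in {1..r}"
      by (rule homog_part_polys_in[OF c])
    moreover have "h \<in> I"
      unfolding gen using genideal_self[of H] h H
      by (auto simp: poly_ring_simps homog_part_def)
    then have "hcomp d h \<in> I" for d
      using hcomp_id[OF c] hcomp_eq_0[OF c, of d] I_props(2) by (cases "c = d") auto
    ultimately show "h \<in> K"
      by (simp add: K_def)
  qed
  ultimately have "I \<subseteq> K"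
    unfolding gen by (rule genideal_minimal)
  then show ?thesis
    using p by (auto simp: K_def)
qed

lemma coset_eq_iff:
  fixes I :: "(nat, 'k::field) mpoly set"
  assumes I: "ideal I (poly_ring r)" and pq: "p \<in> polys_in {1..r}" "q \<in> polys_in {1..r}"
  shows "I +>\<^bsub>poly_ring r\<^esub> p = I +>\<^bsub>poly_ring r\<^esub> q \<longleftrightarrow> p - q \<in> I"
proof -
  note I_props = poly_ring_idealD[OF I]
  have coset: "I +>\<^bsub>poly_ring r\<^esub> p = {i + p | i. i \<in> I}" for p :: "(nat, 'k) mpoly"
    by (auto simp: a_r_coset_def' poly_ring_simps)
  have neg: "- i \<in> I" if "i \<in> I" for i
    using I_props(4)[OF polys_in_uminus[OF polys_in_1] that] by simp
  show ?thesis
  proof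
    assume eq: "I +>\<^bsub>poly_ring r\<^esub> p = I +>\<^bsub>poly_ring r\<^esub> q"
    have "p \<in> I +>\<^bsub>poly_ring r\<^esub> p"
      unfolding coset by (intro CollectI exI[of _ 0]) (simp add: I_props(2))
    then have "p \<in> {i + q | i. i \<in> I}"
      unfolding eq unfolding coset .
    then obtain i where "p = i + q" "i \<in> I"
      by blast
    then show "p - q \<in> I"
      by simp
  next
    assume mem: "p - q \<in> I"
    have sub: "{i + a | i. i \<in> I} \<subseteq> {i + b | i. i \<in> I}" if "a - b \<in> I" for a b
    proof
      fix u assume "u \<in> {i + a | i. i \<in> I}"
      then obtain i where i: "i \<in> I" "u = i + a"
        by blast
      have "i + (a - b) \<in> I" "u = (i + (a - b)) + b"
        using I_props(3)[OF i(1) that] i(2) by simp_all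
      then show "u \<in> {i + b | i. i \<in> I}"
        by blast
    qed
    show "I +>\<^bsub>poly_ring r\<^esub> p = I +>\<^bsub>poly_ring r\<^esub> q"
      unfolding coset using sub[OF mem] sub[of q p] neg[OF mem] by (intro equalityI) simp_all
  qed
qed

text \<open>Dimension zero gives \<open>y\<^sup>n (1 - y g) \<in> I\<close> for the variable \<open>y\<close>, and \<open>y\<^sup>n\<close> is the component of degree
  \<open>n\<close> of this element.\<close>

lemma power_of_variable_mem:
  fixes I :: "(nat, 'k::field) mpoly set"
  assumes I: "homogeneous_ideal r I" and dim: "has_krull_dim (poly_ring r Quot I) 0" and i: "i \<in> {1..r}"
  shows "\<exists>n. var i ^ n \<in> I"
proof -
  let ?R = "poly_ring r :: (nat, 'k) mpoly ring"
  have id: "ideal I ?R"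
    using I by (simp add: homogeneous_ideal_def)
  interpret I: ideal I ?R
    by (rule id)
  interpret A: cring "?R Quot I"
    by (rule I.quotient_is_cring[OF cring_poly_ring])
  interpret R: cring ?R
    by (rule cring_poly_ring)
  interpret h: ring_hom_ring ?R "?R Quot I" "(+>\<^bsub>?R\<^esub>) I"
    by (rule I.rcos_ring_hom_ring)
  have y: "var i \<in> carrier ?R"
    using homog_part_polys_in[OF homog_part_var[OF i]] by (simp add: poly_ring_simps)
  obtain n :: nat and G where G: "G \<in> carrier (?R Quot I)"
    "(I +>\<^bsub>?R\<^esub> var i) [^]\<^bsub>?R Quot I\<^esub> n \<otimes>\<^bsub>?R Quot I\<^esub>
      (\<one>\<^bsub>?R Quot I\<^esub> \<ominus>\<^bsub>?R Quot I\<^esub> (I +>\<^bsub>?R\<^esub> var i) \<otimes>\<^bsub>?R Quot I\<^esub> G) = \<zero>\<^bsub>?R Quot I\<^esub>"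
    by (rule A.krull_dim_zero_power[OF dim h.hom_closed[OF y]])
  obtain g where g: "g \<in> carrier ?R" "G = I +>\<^bsub>?R\<^esub> g"
    using G(1) unfolding FactRing_def A_RCOSETS_def' partial_object.simps by blast
  have minus: "a \<ominus>\<^bsub>?R\<^esub> b = a - b" if "b \<in> polys_in {1..r}" for a b
    by (simp add: a_minus_def poly_ring_uminus[OF that] poly_ring_simps)
  have hom_pow: "I +>\<^bsub>?R\<^esub> (var i [^]\<^bsub>?R\<^esub> k) = (I +>\<^bsub>?R\<^esub> var i) [^]\<^bsub>?R Quot I\<^esub> k"
    for k :: nat
    by (induction k) (simp_all add: y)
  have pow: "var i [^]\<^bsub>?R\<^esub> n = var i ^ n"
    by (induction n) (simp_all add: poly_ring_simps mult.commute)
  have "I +>\<^bsub>?R\<^esub> (var i [^]\<^bsub>?R\<^esub> n \<otimes>\<^bsub>?R\<^esub> (\<one>\<^bsub>?R\<^esub> \<ominus>\<^bsub>?R\<^esub> var i \<otimes>\<^bsub>?R\<^esub> g)) = I +>\<^bsub>?R\<^esub> \<zero>\<^bsub>?R\<^esub>"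
    using G(2) g y by (simp add: a_minus_def hom_pow)
  then have "I +>\<^bsub>?R\<^esub> (var i ^ n * (1 - var i * g)) = I +>\<^bsub>?R\<^esub> 0"
    using y g(1) by (simp add: pow minus poly_ring_simps polys_in_1 polys_in_mult)
  moreover have "var i ^ n * (1 - var i * g) \<in> polys_in {1..r}"
    using y g(1) by (intro polys_in_mult polys_in_power polys_in_diff polys_in_1) (auto simp: poly_ring_simps)
  ultimately have "var i ^ n * (1 - var i * g) \<in> I"
    using coset_eq_iff[OF id _ polys_in_0] by simp
  then have "hcomp (int n) (var i ^ n * (1 - var i * g)) \<in> I"
    by (rule homogeneous_ideal_hcomp[OF I])
  moreover have "hcomp (int n) (var i ^ n * (1 - var i * g)) = var i ^ n"
  proof -
    have yn: "(var i :: (nat, 'k) mpoly) ^ n \<in> homog_part {1..r} (int n)"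
      using homog_part_power[OF homog_part_var[OF i], of n] by simp
    have ySn: "(var i :: (nat, 'k) mpoly) ^ Suc n \<in> homog_part {1..r} (int n + 1)"
      using homog_part_power[OF homog_part_var[OF i], of "Suc n"] by (simp add: add.commute)
    have "hcomp (int n - (int n + 1)) g = 0"
      by (rule restrict_terms_eq_0) simp
    then have "hcomp (int n) (g * var i ^ Suc n) = 0"
      unfolding hcomp_mult[OF ySn] by simp
    moreover have "var i ^ n * (1 - var i * g) = var i ^ n - g * var i ^ Suc n"
      by (simp add: algebra_simps)
    ultimately show ?thesis
      by (simp only: restrict_terms_diff hcomp_id[OF yn]) simp
  qed
  ultimately show ?thesis
    by auto
qed

text \<open>Pigeonhole: a term whose degree is the sum of the \<open>n i\<close> has an exponent that is at least
  the corresponding \<open>n i\<close>.\<close>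

lemma homog_part_large_degree_subset:
  fixes I :: "(nat, 'k::field) mpoly set"
  assumes I: "ideal I (poly_ring r)" and r: "r \<ge> 1" and pow: "\<And>i. i \<in> {1..r} \<Longrightarrow> \<exists>n. var i ^ n \<in> I"
  shows "\<exists>N. homog_part {1..r} (int N) \<subseteq> I"
proof -
  note I_props = poly_ring_idealD[OF I]
  from bchoice[of "{1..r}" "\<lambda>i n. var i ^ n \<in> I"] pow
  obtain n where n: "\<forall>i\<in>{1..r}. var i ^ n i \<in> I"
    by blast
  let ?N = "\<Sum>i\<in>{1..r}. n i"
  have term_mem: "Poly_Mapping.single t c \<in> I"
    if t: "Poly_Mapping.keys t \<subseteq> {1..r}" "total_deg t = ?N" for t and c :: 'k
  proof -
    have "\<exists>i\<in>{1..r}. n i \<le> Poly_Mapping.lookup t i"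
    proof (rule ccontr)
      assume "\<not> ?thesis"
      then have "(\<Sum>i\<in>{1..r}. Poly_Mapping.lookup t i) < ?N"
        using r by (intro sum_strict_mono) (auto simp: not_le)
      then show False
        using total_deg_superset[OF _ t(1)] t(2) by simp
    qed
    then obtain i where i: "i \<in> {1..r}" "n i \<le> Poly_Mapping.lookup t i"
      by blast
    let ?u = "Poly_Mapping.single i (n i)"
    have t_eq: "t = (t - ?u) + ?u"
      by (rule poly_mapping_eqI) (use i(2) in \<open>auto simp: lookup_add lookup_minus lookup_single when_def\<close>)
    have "Poly_Mapping.keys (t - ?u) \<subseteq> {1..r}"
      using t(1) by (auto simp: in_keys_iff lookup_minus)
    then have "Poly_Mapping.single (t - ?u) c \<in> polys_in {1..r}"
      by (simp add: polys_in_def)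
    then have "Poly_Mapping.single (t - ?u) c * var i ^ n i \<in> I"
      using n i(1) I_props(4) by blast
    then have "Poly_Mapping.single ((t - ?u) + ?u) c \<in> I"
      by (simp add: var_power mult_single)
    then show ?thesis
      by (simp only: t_eq[symmetric])
  qed
  have "p \<in> I" if p: "p \<in> homog_part {1..r} (int ?N)" for p
  proof -
    have term_p: "Poly_Mapping.single t (Poly_Mapping.lookup p t) \<in> I" if "t \<in> Poly_Mapping.keys p" for t
    proof (rule term_mem)
      show "Poly_Mapping.keys t \<subseteq> {1..r}"
        using p that unfolding homog_part_def polys_in_def by blast
      show "total_deg t = ?N"
      proof -
        have "int (total_deg t) = int ?N"
          using p that unfolding homog_part_def by blast
        then show ?thesis
          by (simp only: of_nat_eq_iff)
      qed
    qed
    have "(\<Sum>t\<in>A. Poly_Mapping.single t (Poly_Mapping.lookup p t)) \<in> I"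
      if "A \<subseteq> Poly_Mapping.keys p" for A
      using that by (induction A rule: infinite_finite_induct) (auto simp: I_props(2) intro: I_props(3) term_p)
    from this[OF subset_refl] show ?thesis
      by (simp flip: sum_of_terms)
  qed
  then show ?thesis
    by (intro exI[of _ ?N] subsetI)
qed

lemma artinian_graded_idealI:
  fixes I :: "(nat, 'k::field) mpoly set"
  assumes I: "homogeneous_ideal r I" and dim: "has_krull_dim (poly_ring r Quot I) 0" and r: "r \<ge> 1"
  shows "artinian_graded_ideal r I"
proof -
  have id: "ideal I (poly_ring r)"
    using I by (simp add: homogeneous_ideal_def)
  show ?thesis
    using poly_ring_idealD[OF id] homogeneous_ideal_hcomp[OF I]
      homog_part_large_degree_subset[OF id r power_of_variable_mem[OF I dim]]
    by unfold_locales
qed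

lemma one_notin:
  fixes I :: "(nat, 'k::field) mpoly set"
  assumes I: "ideal I (poly_ring r)" and dim: "has_krull_dim (poly_ring r Quot I) 0"
  shows "1 \<notin> I"
proof
  assume one: "1 \<in> I"
  let ?R = "poly_ring r :: (nat, 'k) mpoly ring"
  interpret I: ideal I ?R
    by (rule I)
  obtain P where P: "primeideal P (?R Quot I)"
    using dim unfolding has_krull_dim_def prime_chain_def by blast
  interpret P: primeideal P "?R Quot I"
    by (rule P)
  have "\<one>\<^bsub>?R Quot I\<^esub> = I +>\<^bsub>?R\<^esub> 1" "\<zero>\<^bsub>?R Quot I\<^esub> = I"
    by (simp_all add: FactRing_def poly_ring_simps)
  moreover have "I +>\<^bsub>?R\<^esub> 1 = I"
    using one ring.a_rcos_zero[OF cring.axioms(1)[OF cring_poly_ring] I] by simp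
  ultimately have "\<one>\<^bsub>?R Quot I\<^esub> \<in> P"
    using additive_subgroup.zero_closed[OF ideal.axioms(1)[OF P.ideal_axioms]] by simp
  then show False
    using ideal.one_imp_carrier[OF P.ideal_axioms] P.I_notcarr by simp
qed

section \<open>The weak Lefschetz property\<close>

lemma weak_lefschetz_iff:
  fixes I :: "(nat, 'k::field) mpoly set"
  assumes I: "ideal I (poly_ring r)"
  shows "weak_lefschetz (poly_ring r Quot I) (quot_part r I) \<longleftrightarrow>
    (\<exists>l\<in>homog_part {1..r} 1. \<forall>d. injective_mod r I d l \<or> surjective_mod r I d l)"
proof -
  let ?c = "\<lambda>p. I +>\<^bsub>poly_ring r\<^esub> p"
  have eq_iff: "?c p = ?c q \<longleftrightarrow> p - q \<in> I" if "p \<in> homog_part {1..r} d" "q \<in> homog_part {1..r} e" for p q d e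
    by (rule coset_eq_iff[OF I homog_part_polys_in[OF that(1)] homog_part_polys_in[OF that(2)]])
  have mult: "?c l \<otimes>\<^bsub>poly_ring r Quot I\<^esub> ?c f = ?c (l * f)"
    if "l \<in> homog_part {1..r} 1" "f \<in> homog_part {1..r} d" for l f d
    using ideal.rcoset_mult_add[OF I, of l f] that
    by (simp add: FactRing_def poly_ring_simps homog_part_polys_in)
  have lf: "l * f \<in> homog_part {1..r} (d + 1)"
    if "l \<in> homog_part {1..r} 1" "f \<in> homog_part {1..r} d" for l f :: "(nat, 'k) mpoly" and d
    using homog_part_mult[OF that] by (simp add: add.commute)
  have inj: "inj_on (\<lambda>a. ?c l \<otimes>\<^bsub>poly_ring r Quot I\<^esub> a) (quot_part r I d) \<longleftrightarrow> injective_mod r I d l"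
    if l: "l \<in> homog_part {1..r} 1" for l d
  proof
    assume inj: "inj_on (\<lambda>a. ?c l \<otimes>\<^bsub>poly_ring r Quot I\<^esub> a) (quot_part r I d)"
    show "injective_mod r I d l"
      unfolding injective_mod_def
    proof (intro ballI impI)
      fix f assume f: "f \<in> homog_part {1..r} d" "l * f \<in> I"
      have "?c (l * f) = ?c (l * 0)"
        using f eq_iff[OF lf[OF l f(1)] homog_part_0] by simp
      then have "?c l \<otimes>\<^bsub>poly_ring r Quot I\<^esub> ?c f = ?c l \<otimes>\<^bsub>poly_ring r Quot I\<^esub> ?c 0"
        by (simp only: mult[OF l f(1)] mult[OF l homog_part_0[of _ d]])
      then have "?c f = ?c 0"
        by (rule inj_onD[OF inj]) (use f(1) in \<open>simp_all add: quot_part_def\<close>)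
      then show "f \<in> I"
        using eq_iff[OF f(1) homog_part_0] by simp
    qed
  next
    assume inj: "injective_mod r I d l"
    show "inj_on (\<lambda>a. ?c l \<otimes>\<^bsub>poly_ring r Quot I\<^esub> a) (quot_part r I d)"
    proof (rule inj_onI)
      fix a b assume "a \<in> quot_part r I d" "b \<in> quot_part r I d"
        and eq: "?c l \<otimes>\<^bsub>poly_ring r Quot I\<^esub> a = ?c l \<otimes>\<^bsub>poly_ring r Quot I\<^esub> b"
      then obtain f g where fg: "f \<in> homog_part {1..r} d" "a = ?c f" "g \<in> homog_part {1..r} d" "b = ?c g"
        unfolding quot_part_def by blast
      have "?c (l * f) = ?c (l * g)"
        using eq unfolding fg(2,4) mult[OF l fg(1)] mult[OF l fg(3)] .
      then have "l * (f - g) \<in> I"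
        using eq_iff[OF lf[OF l fg(1)] lf[OF l fg(3)]] by (simp add: right_diff_distrib)
      then have "f - g \<in> I"
        using inj homog_part_diff[OF fg(1,3)] unfolding injective_mod_def by blast
      then show "a = b"
        using eq_iff[OF fg(1,3)] fg(2,4) by simp
    qed
  qed
  have surj: "(\<lambda>a. ?c l \<otimes>\<^bsub>poly_ring r Quot I\<^esub> a) ` quot_part r I d = quot_part r I (d + 1)
      \<longleftrightarrow> surjective_mod r I d l"
    if l: "l \<in> homog_part {1..r} 1" for l d
  proof -
    have image: "(\<lambda>a. ?c l \<otimes>\<^bsub>poly_ring r Quot I\<^esub> a) ` quot_part r I d = (\<lambda>f. ?c (l * f)) ` homog_part {1..r} d"
      unfolding quot_part_def image_image by (rule image_cong[OF refl mult[OF l]])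
    have sub: "(\<lambda>f. ?c (l * f)) ` homog_part {1..r} d \<subseteq> quot_part r I (d + 1)"
      unfolding quot_part_def using lf[OF l] by (intro image_subsetI imageI)
    show ?thesis
    proof
      assume "(\<lambda>a. ?c l \<otimes>\<^bsub>poly_ring r Quot I\<^esub> a) ` quot_part r I d = quot_part r I (d + 1)"
      then have eq: "(\<lambda>f. ?c (l * f)) ` homog_part {1..r} d = quot_part r I (d + 1)"
        unfolding image .
      show "surjective_mod r I d l"
        unfolding surjective_mod_def
      proof
        fix q :: "(nat, 'k) mpoly" assume q: "q \<in> homog_part {1..r} (d + 1)"
        have "?c q \<in> (\<lambda>f. ?c (l * f)) ` homog_part {1..r} d"
          unfolding eq quot_part_def by (rule imageI[OF q])
        then obtain f where f: "f \<in> homog_part {1..r} d" "?c q = ?c (l * f)"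
          by blast
        then have "q - l * f \<in> I"
          using eq_iff[OF q lf[OF l f(1)]] by simp
        with f(1) show "\<exists>f\<in>homog_part {1..r} d. q - l * f \<in> I" ..
      qed
    next
      assume surj: "surjective_mod r I d l"
      have "quot_part r I (d + 1) \<subseteq> (\<lambda>f. ?c (l * f)) ` homog_part {1..r} d"
      proof
        fix a assume "a \<in> quot_part r I (d + 1)"
        then obtain q where q: "q \<in> homog_part {1..r} (d + 1)" "a = ?c q"
          unfolding quot_part_def by blast
        obtain f where f: "f \<in> homog_part {1..r} d" "q - l * f \<in> I"
          using surj q(1) unfolding surjective_mod_def by blast
        have "a = ?c (l * f)"
          unfolding q(2) eq_iff[OF q(1) lf[OF l f(1)]] by (rule f(2))
        then show "a \<in> (\<lambda>f. ?c (l * f)) ` homog_part {1..r} d"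
          using f(1) by (rule image_eqI)
      qed
      with sub show "(\<lambda>a. ?c l \<otimes>\<^bsub>poly_ring r Quot I\<^esub> a) ` quot_part r I d = quot_part r I (d + 1)"
        unfolding image by (rule equalityI)
    qed
  qed
  have "weak_lefschetz (poly_ring r Quot I) (quot_part r I) \<longleftrightarrow>
      (\<exists>l\<in>homog_part {1..r} 1. \<forall>d. maximal_rank (\<lambda>a. ?c l \<otimes>\<^bsub>poly_ring r Quot I\<^esub> a)
        (quot_part r I d) (quot_part r I (d + 1)))"
    unfolding weak_lefschetz_def by (simp add: quot_part_def[of r I 1] del: One_nat_def)
  also have "\<dots> \<longleftrightarrow> (\<exists>l\<in>homog_part {1..r} 1. \<forall>d. injective_mod r I d l \<or> surjective_mod r I d l)"
    unfolding maximal_rank_def by (intro bex_cong refl) (simp only: inj surj)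
  finally show ?thesis .
qed

text \<open>The map \<open>\<times> x\<^sub>r\<close> corresponds to multiplication by the last variable in the coordinates \<open>x\<close>.\<close>

lemma last_form_injective_surjective_iff:
  fixes x :: "nat \<Rightarrow> (nat, 'k::field) mpoly"
  assumes r: "r \<ge> 3" and x: "linear_basis r x" and I: "artinian_graded_ideal r I"
    and m: "m (r + 1) = 0" and P: "pseudo_weierstrass_basis r x (*) I G m e"
    and e: "\<And>i l. i \<in> {1..r} \<Longrightarrow> l \<in> {1..m i} \<Longrightarrow> e i l \<in> homog_part {1..r} (int (n i l))"
  shows "injective_mod r I d (x r) \<longleftrightarrow> (\<forall>l\<in>{1..m r}. int (n r l) \<noteq> d + 1)"
    and "- 1 \<le> d \<Longrightarrow> surjective_mod r I d (x r) \<longleftrightarrow> (\<forall>l\<in>{1..m (r - 1)}. int (n (r - 1) l) \<le> d + 1)"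
proof -
  obtain z where "\<forall>i\<in>{1..r}. z i \<in> homog_part {1..r} 1 \<and> subst x (z i) = var i \<and> subst z (x i) = var i"
    using inverse_substitution[OF x] ..
  then have z: "z i \<in> homog_part {1..r} 1" "subst x (z i) = var i" "subst z (x i) = var i"
    if "i \<in> {1..r}" for i
    using that by blast+
  let ?J = "{p \<in> polys_in {1..r}. subst x p \<in> I}"
  have r2: "r \<ge> 2"
    using r by simp
  interpret weierstrass_ideal r ?J m n "\<lambda>i l. subst z (e i l)"
    by (rule weierstrass_ideal_in_coordinates[OF r2 x z I m P e])
  have r_in: "r \<in> {1..r}"
    using r by simp
  have to_x: "subst x f \<in> homog_part {1..r} d" if "f \<in> homog_part {1..r} d" for f d
    by (rule subst_homog[OF that linear_basis_homog[OF x]])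
  have to_z: "subst z f \<in> homog_part {1..r} d" if "f \<in> homog_part {1..r} d" for f d
    by (rule subst_homog[OF that z(1)])
  have xz: "subst x (subst z f) = f" if "f \<in> homog_part {1..r} d" for f d
    unfolding subst_subst by (rule subst_identity[OF homog_part_polys_in[OF that] z(2)])
  have J_iff: "f \<in> ?J \<longleftrightarrow> subst x f \<in> I" if "f \<in> homog_part {1..r} d" for f d
    using homog_part_polys_in[OF that] by simp
  have var_f: "var r * f \<in> homog_part {1..r} (d + 1)" if "f \<in> homog_part {1..r} d"
    for f :: "(nat, 'k) mpoly" and d
    using homog_part_mult[OF homog_part_var[OF r_in] that] by (simp add: add.commute)
  have subst_var: "subst x (var r * f) = x r * subst x f" for f
    by (simp add: const.poly_eval_mult)
  have "injective_mod r I d (x r) \<longleftrightarrow> (\<forall>f\<in>homog_part {1..r} d. var r * f \<in> ?J \<longrightarrow> f \<in> ?J)"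
  proof
    assume inj: "injective_mod r I d (x r)"
    show "\<forall>f\<in>homog_part {1..r} d. var r * f \<in> ?J \<longrightarrow> f \<in> ?J"
    proof (intro ballI impI)
      fix f assume f: "f \<in> homog_part {1..r} d" "var r * f \<in> ?J"
      have "x r * subst x f \<in> I"
        using f(2) J_iff[OF var_f[OF f(1)]] by (simp only: subst_var)
      then show "f \<in> ?J"
        using inj to_x[OF f(1)] J_iff[OF f(1)] unfolding injective_mod_def by blast
    qed
  next
    assume inj: "\<forall>f\<in>homog_part {1..r} d. var r * f \<in> ?J \<longrightarrow> f \<in> ?J"
    show "injective_mod r I d (x r)"
      unfolding injective_mod_def
    proof (intro ballI impI)
      fix f assume f: "f \<in> homog_part {1..r} d" "x r * f \<in> I"
      have "var r * subst z f \<in> ?J"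
        unfolding J_iff[OF var_f[OF to_z[OF f(1)]]] subst_var xz[OF f(1)] by (rule f(2))
      then have "subst z f \<in> ?J"
        using inj to_z[OF f(1)] by blast
      then show "f \<in> I"
        unfolding J_iff[OF to_z[OF f(1)]] xz[OF f(1)] .
    qed
  qed
  then show "injective_mod r I d (x r) \<longleftrightarrow> (\<forall>l\<in>{1..m r}. int (n r l) \<noteq> d + 1)"
    unfolding mult_var_injective_iff .
  have subst_diff: "subst x (q - f) = subst x q - subst x f" for q f
    using const.poly_eval_add[of x "q - f" f] by (simp add: eq_diff_eq)
  have surj_iff: "surjective_mod r I d (x r) \<longleftrightarrow>
      (\<forall>q\<in>homog_part {1..r} (d + 1). \<exists>f\<in>homog_part {1..r} (d + 1 - 1). q - var r * f \<in> ?J)"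
    unfolding add_diff_cancel_right'
  proof
    assume surj: "surjective_mod r I d (x r)"
    show "\<forall>q\<in>homog_part {1..r} (d + 1). \<exists>f\<in>homog_part {1..r} d. q - var r * f \<in> ?J"
    proof
      fix q :: "(nat, 'k) mpoly" assume q: "q \<in> homog_part {1..r} (d + 1)"
      obtain f where f: "f \<in> homog_part {1..r} d" "subst x q - x r * f \<in> I"
        using surj to_x[OF q] unfolding surjective_mod_def by blast
      have "q - var r * subst z f \<in> ?J"
        unfolding J_iff[OF homog_part_diff[OF q var_f[OF to_z[OF f(1)]]]] subst_diff subst_var xz[OF f(1)]
        by (rule f(2))
      with to_z[OF f(1)] show "\<exists>f\<in>homog_part {1..r} d. q - var r * f \<in> ?J" ..
    qed
  next
    assume surj: "\<forall>q\<in>homog_part {1..r} (d + 1). \<exists>f\<in>homog_part {1..r} d. q - var r * f \<in> ?J"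
    show "surjective_mod r I d (x r)"
      unfolding surjective_mod_def
    proof
      fix q :: "(nat, 'k) mpoly" assume q: "q \<in> homog_part {1..r} (d + 1)"
      obtain f where f: "f \<in> homog_part {1..r} d" "subst z q - var r * f \<in> ?J"
        using surj to_z[OF q] by blast
      have "q - x r * subst x f \<in> I"
        using f(2) unfolding J_iff[OF homog_part_diff[OF to_z[OF q] var_f[OF f(1)]]] subst_diff
          subst_var xz[OF q] .
      with to_x[OF f(1)] show "\<exists>f\<in>homog_part {1..r} d. q - x r * f \<in> I" ..
    qed
  qed
  show "- 1 \<le> d \<Longrightarrow> surjective_mod r I d (x r) \<longleftrightarrow> (\<forall>l\<in>{1..m (r - 1)}. int (n (r - 1) l) \<le> d + 1)"
    by (rule trans[OF surj_iff mult_var_surjective_iff[OF r]]) simp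
qed

text \<open>Injectivity in all degrees would propagate from a degree where everything lies in \<open>J\<close> down
  to degree \<open>0\<close>.\<close>

lemma (in artinian_graded_ideal) exists_noninjective_degree:
  assumes one: "1 \<notin> J" and l: "l \<in> homog_part {1..s} 1"
  shows "\<exists>d. \<not> injective_mod s J d l"
proof (rule ccontr)
  assume "\<not> ?thesis"
  then have inj: "injective_mod s J d l" for d
    by blast
  obtain N where N: "homog_part {1..s} (int N) \<subseteq> J"
    using J_cofinite by blast
  have "homog_part {1..s} d \<subseteq> J" if "d \<le> int N" for d
    using that
  proof (induction d rule: int_le_induct)
    case base
    show ?case
      by (rule N)
  next
    case (step i)
    have "f \<in> J" if f: "f \<in> homog_part {1..s} (i - 1)" for f
    proof -
      have "l * f \<in> homog_part {1..s} i"
        using homog_part_mult[OF l f] by simp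
      then show ?thesis
        using inj[of "i - 1"] f step.IH unfolding injective_mod_def by blast
    qed
    then show ?case ..
  qed
  then have "homog_part {1..s} 0 \<subseteq> J"
    by simp
  moreover have "(1 :: (nat, 'k) mpoly) \<in> homog_part {1..s} 0"
    by (simp add: homog_part_def polys_in_1)
  ultimately show False
    using one by blast
qed

theorem lemma4p6:
  fixes I :: "(nat, 'k::field) mpoly set"
    and r a :: nat and m :: "nat \<Rightarrow> nat" and n :: "nat \<Rightarrow> nat \<Rightarrow> nat"
  assumes "infinite (UNIV :: 'k set)"
    and "r \<ge> 3"
    and "homogeneous_ideal r I"
    and "has_krull_dim (poly_ring r Quot I) 0"
    and "basic_sequence r I a m n"
  shows "weak_lefschetz (poly_ring r Quot I) (quot_part r I) \<longleftrightarrow>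
         n r 1 \<ge> n (r - 1) (m (r - 1))"
proof -
  have id: "ideal I (poly_ring r)"
    using assms(3) by (simp add: homogeneous_ideal_def)
  have one: "1 \<notin> I"
    by (rule one_notin[OF id assms(4)])
  interpret artinian_graded_ideal r I
    using artinian_graded_idealI[OF assms(3,4)] assms(2) by simp
  obtain U where m: "m 1 = 1" "m (r + 1) = 0" and mono: "\<forall>i\<in>{2..r}. mono_on {1..m i} (n i)"
    and U: "zariski_open_bases r U" "U \<noteq> {}"
    and U_basis: "\<forall>x\<in>U. \<exists>e. pseudo_weierstrass_basis r x (*) I (\<lambda>d. I \<inter> homog_part {1..r} d) m e \<and>
          e 1 1 \<in> homog_part {1..r} (int a) \<and>
          (\<forall>i\<in>{2..r}. \<forall>l\<in>{1..m i}. e i l \<in> homog_part {1..r} (int (n i l)))"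
    using assms(5) unfolding basic_sequence_def by blast
  have U_linear: "linear_basis r x" if "x \<in> U" for x
    using U(1) that unfolding zariski_open_bases_def by blast
  have inj_iff: "injective_mod r I d (x r) \<longleftrightarrow> (\<forall>l\<in>{1..m r}. int (n r l) \<noteq> d + 1)"
    and surj_iff: "- 1 \<le> d \<Longrightarrow>
      surjective_mod r I d (x r) \<longleftrightarrow> (\<forall>l\<in>{1..m (r - 1)}. int (n (r - 1) l) \<le> d + 1)"
    if x: "x \<in> U" for x d
  proof -
    obtain e where e: "pseudo_weierstrass_basis r x (*) I (\<lambda>d. I \<inter> homog_part {1..r} d) m e"
      "e 1 1 \<in> homog_part {1..r} (int a)"
      "\<forall>i\<in>{2..r}. \<forall>l\<in>{1..m i}. e i l \<in> homog_part {1..r} (int (n i l))"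
      using U_basis x by blast
    \<comment> \<open>The degree of the generator in the first block is \<open>a\<close>; the degrees \<open>n i l\<close> begin at \<open>i = 2\<close>.\<close>
    let ?n = "\<lambda>i l. if i = 1 then a else n i l"
    have e_homog: "e i l \<in> homog_part {1..r} (int (?n i l))" if "i \<in> {1..r}" "l \<in> {1..m i}" for i l
      using that e(2,3) m(1) by (cases "i = 1") auto
    then have "injective_mod r I d (x r) \<longleftrightarrow> (\<forall>l\<in>{1..m r}. int (?n r l) \<noteq> d + 1)"
      by (rule last_form_injective_surjective_iff(1)[OF assms(2) U_linear[OF x]
        artinian_graded_ideal_axioms m(2) e(1)])
    then show "injective_mod r I d (x r) \<longleftrightarrow> (\<forall>l\<in>{1..m r}. int (n r l) \<noteq> d + 1)"
      using assms(2) by simp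
    show "surjective_mod r I d (x r) \<longleftrightarrow> (\<forall>l\<in>{1..m (r - 1)}. int (n (r - 1) l) \<le> d + 1)" if "- 1 \<le> d"
    proof -
      have "surjective_mod r I d (x r) \<longleftrightarrow> (\<forall>l\<in>{1..m (r - 1)}. int (?n (r - 1) l) \<le> d + 1)"
        using e_homog that by (rule last_form_injective_surjective_iff(2)[OF assms(2) U_linear[OF x]
          artinian_graded_ideal_axioms m(2) e(1)])
      moreover have "r - 1 \<noteq> 1"
        using assms(2) by simp
      ultimately show ?thesis
        by (simp only: if_False)
    qed
  qed
  obtain x where x: "x \<in> U"
    using U(2) by blast
  have xr: "x r \<in> homog_part {1..r} 1"
    using assms(2) by (intro linear_basis_homog[OF U_linear[OF x]]) simp
  have m_r: "m r \<ge> 1"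
    using exists_noninjective_degree[OF one xr] inj_iff[OF x] by fastforce
  have m_r1: "m (r - 1) \<ge> 1"
  proof (rule ccontr)
    assume "\<not> m (r - 1) \<ge> 1"
    \<comment> \<open>The target is degree \<open>0\<close>, which \<open>I\<close> does not contain, and the source is zero.\<close>
    then have "surjective_mod r I (- 1) (x r)"
      using surj_iff[OF x, of "- 1"] by simp
    moreover have "(1 :: (nat, 'k) mpoly) \<in> homog_part {1..r} (- 1 + 1 :: int)"
      by (simp add: homog_part_def polys_in_1)
    ultimately obtain f where f: "f \<in> homog_part {1..r} (- 1)" "1 - x r * f \<in> I"
      unfolding surjective_mod_def by blast
    have "f = 0"
      using homog_part_neg[OF _ f(1)] by simp
    then show False
      using f(2) one by simp
  qed
  have mono_r: "n r 1 \<le> n r l" if "l \<in> {1..m r}" for l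
    using mono assms(2) m_r that by (intro mono_onD[of "{1..m r}" "n r"]) auto
  have mono_r1: "n (r - 1) l \<le> n (r - 1) (m (r - 1))" if "l \<in> {1..m (r - 1)}" for l
    using mono assms(2) m_r1 that by (intro mono_onD[of "{1..m (r - 1)}" "n (r - 1)"]) auto
  show ?thesis
    unfolding weak_lefschetz_iff[OF id]
  proof
    assume le: "n r 1 \<ge> n (r - 1) (m (r - 1))"
    show "\<exists>l\<in>homog_part {1..r} 1. \<forall>d. injective_mod r I d l \<or> surjective_mod r I d l"
    proof (intro bexI[OF _ xr] allI)
      fix d
      consider "d < - 1" | "- 1 \<le> d" "int (n (r - 1) (m (r - 1))) \<le> d + 1"
        | "- 1 \<le> d" "d + 1 < int (n (r - 1) (m (r - 1)))"
        by linarith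
      then show "injective_mod r I d (x r) \<or> surjective_mod r I d (x r)"
      proof cases
        case 1
        then show ?thesis
          unfolding inj_iff[OF x] by auto
      next
        case 2
        then show ?thesis
          unfolding surj_iff[OF x 2(1)] using mono_r1 by force
      next
        case 3
        then have "d + 1 < int (n r l)" if "l \<in> {1..m r}" for l
          using le mono_r[OF that] by linarith
        then show ?thesis
          unfolding inj_iff[OF x] by force
      qed
    qed
  next
    assume "\<exists>l\<in>homog_part {1..r} 1. \<forall>d. injective_mod r I d l \<or> surjective_mod r I d l"
    then obtain l where l: "l \<in> homog_part {1..r} 1"
      and max_rank: "\<And>d. injective_mod r I d l \<or> surjective_mod r I d l"
      by blast
    show "n r 1 \<ge> n (r - 1) (m (r - 1))"
    proof (rule ccontr)
      assume less: "\<not> n r 1 \<ge> n (r - 1) (m (r - 1))"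
      \<comment> \<open>In this degree the last member of every basis in \<open>U\<close> has a kernel, and its cokernel is still nonzero.\<close>
      define d where "d = int (n r 1) - 1"
      have d: "- 1 \<le> d" "d + 1 = int (n r 1)"
        by (simp_all add: d_def)
      have not_inj: "\<not> injective_mod r I d (u r)" and not_surj: "\<not> surjective_mod r I d (u r)"
        if u: "u \<in> U" for u
        unfolding inj_iff[OF u] surj_iff[OF u d(1)] d(2) using m_r m_r1 less by force+
      let ?h = "\<lambda>t. x r + scale t l"
      have "finite {t. x(r := ?h t) \<notin> U}"
        using assms(2) by (intro finite_outside_zariski_open U(1) x l) simp
      moreover have "finite {t. \<not> injective_mod r I d (?h t)} \<or> finite {t. \<not> surjective_mod r I d (?h t)}"
        using max_rank[of d] finite_noninjective_mod[OF homog_part_polys_in[OF l] homog_part_polys_in[OF xr]]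
          finite_nonsurjective_mod[OF l xr] by blast
      moreover have "UNIV \<subseteq> {t. x(r := ?h t) \<notin> U} \<union> {t. \<not> injective_mod r I d (?h t)}"
        "UNIV \<subseteq> {t. x(r := ?h t) \<notin> U} \<union> {t. \<not> surjective_mod r I d (?h t)}"
        using not_inj not_surj by (metis (mono_tags, lifting) UnI1 UnI2 fun_upd_same mem_Collect_eq subsetI)+
      ultimately show False
        using assms(1) by (meson finite_UnI finite_subset)
    qed
  qed
qed

end
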